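(* Let $(\mathbf{M}^n,g)$ be an $n$-dimensional closed Riemannian manifold, $V$ a $C^1$ vector field on $\mathbf{M}^n$, and suppose $Ric_V^m\ge -Kg$ for some $m>n$ and $K\ge 0$. Let $H\in C^2(0,\infty)$ and let $u(x,t)$ be a smooth positive solution of $\partial_t u=\Delta_V u+H(u)$ on $\mathbf{M}^n\times[0,\infty)$. Put $f:=\ln u$ and $h(s):=H(e^s)/e^s$. If there are smooth functions $\gamma,\alpha,\varphi,c$ of $t$ defined on $(0,\infty)$ such that $\gamma,\alpha,\varphi,c,h,f$ satisfy the $A_2$-system (with these $m$, $K$), then $$\gamma\frac{|\nabla u|^2}{u^2}-\alpha\frac{u_t}{u}+\alpha h(f)-\varphi\le 0\qquad\text{on }\mathbf{M}^n\times(0,\infty).$$ If instead $(\mathbf{M}^n,g)$ is an $n$-dimensional compact Riemannian manifold with convex boundary (with the same curvature assumption), and $u$ is a smooth positive solution on $\mathbf{M}^n\times[0,\infty)$ of the Neumann problem $\partial_t u=\Delta_V u+H(u)$ on $\mathbf{M}^n$, $\frac{\partial u}{\partial \mathbf{n}}=0$ on $\partial\mathbf{M}^n$, where $\mathbf{n}$ is the unit outer normal vector field, and the $A_2$-system is satisfied as before, then the same estimate holds.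
   Context: Notation: $\Delta_V u:=\Delta u+\langle V,\nabla u\rangle$; $Ric_V:=Ric-\frac12 L_Vg$ and, for $m>n$, $Ric_V^m:=Ric_V-\frac{1}{m-n}V^\flat\otimes V^\flat$, where $L_Vg$ is the Lie derivative of the metric and $V^\flat$ is the $1$-form dual to $V$. Definition ($A_1$-system). Let $\mathbf{M}^n$ be closed or compact with convex boundary, $m\in(0,\infty)$, $K\in[0,\infty)$, and $f(x,t)$ a smooth function on $\mathbf{M}^n\times(0,\infty)$. Let $\gamma,\alpha,\varphi,c$ be $C^1$ functions of $t$ on $(0,\infty)$ and $h\in C^2(I)$, where $I$ is an open interval containing the image of $f$. These functions satisfy the $A_1$-system if on $\mathbf{M}^n\times(0,\infty)$: (1) $\frac{4\gamma}{m}c+(\alpha-\gamma)h'(f)+\alpha h''(f)-2K\gamma-\gamma'\ge\frac{\gamma}{\alpha}\left(\frac{4\gamma}{m}c-\alpha'\right)$; (2) $\varphi'-\frac{2\gamma}{m}c^2+\frac{\varphi}{\alpha}\left(\frac{4\gamma}{m}c-\alpha h'(f)-\alpha'\right)\ge 0$; (3) $\frac{4\gamma}{m}c-\alpha h'(f)-\alpha'>0$ and $\alpha,\gamma>0$. Definition ($A_2$-system). They satisfy the $A_2$-system if they satisfy the $A_1$-system and moreover $\lim_{t\to0^+}\alpha$ exists, $\lim_{t\to0^+}\gamma$ exists, and $\lim_{t\to0^+}\varphi=\infty$. *)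

theory Defs
  imports "HOL-Analysis.Analysis"
begin

text \<open>
  Derivatives are taken within \<open>S\<close>. On the sets used below (open sets, relatively open subsets of a
  half-space, and products of these with an interval) the derivative within the set is unique; at the
  edge it is the one-sided derivative. For \<open>k = \<infinity>\<close> this is equivalent to local extendability to
  smooth functions on open sets (Seeley).
\<close>

primrec Ck_on :: "nat \<Rightarrow> 'e::euclidean_space set \<Rightarrow> ('e \<Rightarrow> 'f::real_normed_vector) \<Rightarrow> bool" where
  "Ck_on 0 S f \<longleftrightarrow> continuous_on S f"
| "Ck_on (Suc k) S f \<longleftrightarrow> f differentiable_on S \<and>
     (\<forall>b\<in>Basis. Ck_on k S (\<lambda>x. frechet_derivative f (at x within S) b))"

definition smooth_on :: "'e::euclidean_space set \<Rightarrow> ('e \<Rightarrow> 'f::real_normed_vector) \<Rightarrow> bool" where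
  "smooth_on S f \<longleftrightarrow> (\<forall>k. Ck_on k S f)"

definition pd :: "(real^'n) set \<Rightarrow> 'n \<Rightarrow> (real^'n \<Rightarrow> real) \<Rightarrow> real^'n \<Rightarrow> real" where
  "pd S i w p = frechet_derivative w (at p within S) (axis i 1)"

text \<open>
  A chart is a pair of its domain and its coordinate map; values of the map outside the domain are
  irrelevant. Tensor fields are given by their components in each chart of the atlas, subject to the
  transformation law. The dimension is \<open>CARD('n)\<close>, and the model half-space of charts at the boundary
  is the set of \<open>p\<close> with \<open>0 \<le> p $ bidx M\<close>.
\<close>

type_synonym ('a, 'n) chart = "'a set \<times> ('a \<Rightarrow> real^'n)"

record ('a, 'n) riem =
  mtop :: "'a topology"
  atlas :: "('a, 'n) chart set"
  bidx :: 'n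
  metric :: "('a, 'n) chart \<Rightarrow> real^'n \<Rightarrow> real^'n^'n"

definition cimg :: "('a, 'n::finite) chart \<Rightarrow> (real^'n) set" where
  "cimg c = snd c ` fst c"

definition cinv :: "('a, 'n::finite) chart \<Rightarrow> real^'n \<Rightarrow> 'a" where
  "cinv c = inv_into (fst c) (snd c)"

definition overlap :: "('a, 'n::finite) chart \<Rightarrow> ('a, 'n) chart \<Rightarrow> (real^'n) set" where
  "overlap c d = snd c ` (fst c \<inter> fst d)"

definition transition :: "('a, 'n::finite) chart \<Rightarrow> ('a, 'n) chart \<Rightarrow> real^'n \<Rightarrow> real^'n" where
  "transition c d = snd d \<circ> cinv c"

text \<open>The differential of the transition map at the coordinates of the point \<open>x\<close>.\<close>

definition dtrans :: "('a, 'n::finite) chart \<Rightarrow> ('a, 'n) chart \<Rightarrow> 'a \<Rightarrow> real^'n \<Rightarrow> real^'n" where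
  "dtrans c d x = frechet_derivative (transition c d) (at (snd c x) within overlap c d)"

definition smooth_manifold_with_boundary :: "('a, 'n::finite) riem \<Rightarrow> bool" where
  "smooth_manifold_with_boundary M \<longleftrightarrow>
     Hausdorff_space (mtop M) \<and> second_countable (mtop M) \<and>
     (\<Union>c\<in>atlas M. fst c) = topspace (mtop M) \<and>
     (\<forall>c\<in>atlas M. openin (mtop M) (fst c) \<and>
        homeomorphic_map (subtopology (mtop M) (fst c)) (top_of_set (cimg c)) (snd c) \<and>
        (open (cimg c) \<or> openin (top_of_set {p. 0 \<le> p $ bidx M}) (cimg c))) \<and>
     (\<forall>c\<in>atlas M. \<forall>d\<in>atlas M. smooth_on (overlap c d) (transition c d))"

definition riemannian_manifold :: "('a, 'n::finite) riem \<Rightarrow> bool" where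
  "riemannian_manifold M \<longleftrightarrow>
     smooth_manifold_with_boundary M \<and>
     (\<forall>c\<in>atlas M. smooth_on (cimg c) (metric M c) \<and>
        (\<forall>p\<in>cimg c. transpose (metric M c p) = metric M c p \<and>
           (\<forall>v. v \<noteq> 0 \<longrightarrow> v \<bullet> (metric M c p *v v) > 0))) \<and>
     (\<forall>c\<in>atlas M. \<forall>d\<in>atlas M. \<forall>x\<in>fst c \<inter> fst d. \<forall>v w.
        v \<bullet> (metric M c (snd c x) *v w) =
        dtrans c d x v \<bullet> (metric M d (snd d x) *v dtrans c d x w))"

text \<open>
  Charts onto open subsets of \<open>real^'n\<close> are allowed to meet the hyperplane \<open>p $ bidx M = 0\<close>, hence
  the use of the interior; for a chart onto a relatively open subset of the half-space the condition
  says \<open>snd c x $ bidx M = 0\<close>.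
\<close>

definition bdry :: "('a, 'n::finite) riem \<Rightarrow> 'a set" where
  "bdry M = {x. \<exists>c\<in>atlas M. x \<in> fst c \<and> snd c x \<notin> interior (cimg c)}"

definition closed_riemannian_manifold :: "('a, 'n::finite) riem \<Rightarrow> bool" where
  "closed_riemannian_manifold M \<longleftrightarrow>
     riemannian_manifold M \<and> compact_space (mtop M) \<and> bdry M = {}"

definition ginv :: "('a, 'n::finite) riem \<Rightarrow> ('a, 'n) chart \<Rightarrow> real^'n \<Rightarrow> real^'n^'n" where
  "ginv M c p = matrix_inv (metric M c p)"

definition ginner :: "('a, 'n::finite) riem \<Rightarrow> ('a, 'n) chart \<Rightarrow> real^'n \<Rightarrow> real^'n \<Rightarrow> real^'n \<Rightarrow> real" where
  "ginner M c p v w = v \<bullet> (metric M c p *v w)"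

text \<open>\<open>christoffel M c l i j\<close> has upper index \<open>l\<close> and lower indices \<open>i j\<close>.\<close>

definition christoffel ::
  "('a, 'n::finite) riem \<Rightarrow> ('a, 'n) chart \<Rightarrow> 'n \<Rightarrow> 'n \<Rightarrow> 'n \<Rightarrow> real^'n \<Rightarrow> real" where
  "christoffel M c l i j p = (1/2) * (\<Sum>r\<in>UNIV. ginv M c p $ l $ r *
     (pd (cimg c) i (\<lambda>q. metric M c q $ j $ r) p
    + pd (cimg c) j (\<lambda>q. metric M c q $ i $ r) p
    - pd (cimg c) r (\<lambda>q. metric M c q $ i $ j) p))"

text \<open>
  \<open>riemann M c l r i j\<close> is the component of \<open>\<partial>_l\<close> in \<open>R(\<partial>_i, \<partial>_j) \<partial>_r\<close>, where
  \<open>R(X,Y) = \<nabla>_X \<nabla>_Y - \<nabla>_Y \<nabla>_X - \<nabla>_[X,Y]\<close>. The Ricci tensor is \<open>Ric(Y,Z) = tr (X \<mapsto> R(X,Y) Z)\<close>,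
  which is positive on round spheres.
\<close>

definition riemann ::
  "('a, 'n::finite) riem \<Rightarrow> ('a, 'n) chart \<Rightarrow> 'n \<Rightarrow> 'n \<Rightarrow> 'n \<Rightarrow> 'n \<Rightarrow> real^'n \<Rightarrow> real" where
  "riemann M c l r i j p =
     pd (cimg c) i (christoffel M c l j r) p - pd (cimg c) j (christoffel M c l i r) p
   + (\<Sum>s\<in>UNIV. christoffel M c l i s p * christoffel M c s j r p
              - christoffel M c l j s p * christoffel M c s i r p)"

definition ricci :: "('a, 'n::finite) riem \<Rightarrow> ('a, 'n) chart \<Rightarrow> real^'n \<Rightarrow> real^'n^'n" where
  "ricci M c p = (\<chi> j r. \<Sum>i\<in>UNIV. riemann M c i r i j p)"

type_synonym ('a, 'n) vfield = "('a, 'n) chart \<Rightarrow> real^'n \<Rightarrow> real^'n"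

definition C1_vector_field :: "('a, 'n::finite) riem \<Rightarrow> ('a, 'n) vfield \<Rightarrow> bool" where
  "C1_vector_field M V \<longleftrightarrow>
     (\<forall>c\<in>atlas M. Ck_on 1 (cimg c) (V c)) \<and>
     (\<forall>c\<in>atlas M. \<forall>d\<in>atlas M. \<forall>x\<in>fst c \<inter> fst d.
        V d (snd d x) = dtrans c d x (V c (snd c x)))"

definition lie_metric ::
  "('a, 'n::finite) riem \<Rightarrow> ('a, 'n) vfield \<Rightarrow> ('a, 'n) chart \<Rightarrow> real^'n \<Rightarrow> real^'n^'n" where
  "lie_metric M V c p = (\<chi> i j. \<Sum>l\<in>UNIV.
     V c p $ l * pd (cimg c) l (\<lambda>q. metric M c q $ i $ j) p
   + metric M c p $ l $ j * pd (cimg c) i (\<lambda>q. V c q $ l) p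
   + metric M c p $ i $ l * pd (cimg c) j (\<lambda>q. V c q $ l) p)"

definition flat ::
  "('a, 'n::finite) riem \<Rightarrow> ('a, 'n) vfield \<Rightarrow> ('a, 'n) chart \<Rightarrow> real^'n \<Rightarrow> real^'n" where
  "flat M V c p = metric M c p *v V c p"

definition ricV ::
  "('a, 'n::finite) riem \<Rightarrow> ('a, 'n) vfield \<Rightarrow> ('a, 'n) chart \<Rightarrow> real^'n \<Rightarrow> real^'n^'n" where
  "ricV M V c p = ricci M c p - (1/2) *\<^sub>R lie_metric M V c p"

definition ricVm ::
  "('a, 'n::finite) riem \<Rightarrow> ('a, 'n) vfield \<Rightarrow> real \<Rightarrow> ('a, 'n) chart \<Rightarrow> real^'n \<Rightarrow> real^'n^'n" where
  "ricVm M V m c p = ricV M V c p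
     - (1 / (m - real CARD('n))) *\<^sub>R (\<chi> i j. flat M V c p $ i * flat M V c p $ j)"

definition ricVm_ge ::
  "('a, 'n::finite) riem \<Rightarrow> ('a, 'n) vfield \<Rightarrow> real \<Rightarrow> real \<Rightarrow> bool" where
  "ricVm_ge M V m \<kappa> \<longleftrightarrow>
     (\<forall>c\<in>atlas M. \<forall>p\<in>cimg c. \<forall>v. v \<bullet> (ricVm M V m c p *v v) \<ge> \<kappa> * ginner M c p v v)"

text \<open>
  The following depend on the point \<open>x\<close> only, not on the chart \<open>c\<close> around \<open>x\<close> (for the gradient: as a
  tangent vector).
\<close>

definition grad :: "('a, 'n::finite) riem \<Rightarrow> ('a, 'n) chart \<Rightarrow> ('a \<Rightarrow> real) \<Rightarrow> 'a \<Rightarrow> real^'n" where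
  "grad M c w x = ginv M c (snd c x) *v (\<chi> i. pd (cimg c) i (w \<circ> cinv c) (snd c x))"

definition grad_norm2 :: "('a, 'n::finite) riem \<Rightarrow> ('a, 'n) chart \<Rightarrow> ('a \<Rightarrow> real) \<Rightarrow> 'a \<Rightarrow> real" where
  "grad_norm2 M c w x = ginner M c (snd c x) (grad M c w x) (grad M c w x)"

definition laplacian :: "('a, 'n::finite) riem \<Rightarrow> ('a, 'n) chart \<Rightarrow> ('a \<Rightarrow> real) \<Rightarrow> 'a \<Rightarrow> real" where
  "laplacian M c w x = (\<Sum>i\<in>UNIV. \<Sum>j\<in>UNIV. ginv M c (snd c x) $ i $ j *
     (pd (cimg c) i (pd (cimg c) j (w \<circ> cinv c)) (snd c x)
      - (\<Sum>l\<in>UNIV. christoffel M c l i j (snd c x) * pd (cimg c) l (w \<circ> cinv c) (snd c x))))"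

definition laplacianV ::
  "('a, 'n::finite) riem \<Rightarrow> ('a, 'n) vfield \<Rightarrow> ('a, 'n) chart \<Rightarrow> ('a \<Rightarrow> real) \<Rightarrow> 'a \<Rightarrow> real" where
  "laplacianV M V c w x =
     laplacian M c w x + ginner M c (snd c x) (V c (snd c x)) (grad M c w x)"

text \<open>
  In a chart at the boundary the tangent vectors of the boundary are the \<open>v\<close> with \<open>v $ bidx M = 0\<close>.
  At boundary points \<open>outer_normal\<close> is therefore the unit outer normal; at other points it is the
  normal of the coordinate level set, which provides an extension off the boundary that can be
  differentiated.
\<close>

definition outer_normal :: "('a, 'n::finite) riem \<Rightarrow> ('a, 'n) vfield" where
  "outer_normal M c p = (THE \<nu>. ginner M c p \<nu> \<nu> = 1 \<and>
     (\<forall>v. v $ bidx M = 0 \<longrightarrow> ginner M c p \<nu> v = 0) \<and> \<nu> $ bidx M < 0)"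

definition normal_deriv :: "('a, 'n::finite) riem \<Rightarrow> ('a, 'n) chart \<Rightarrow> ('a \<Rightarrow> real) \<Rightarrow> 'a \<Rightarrow> real" where
  "normal_deriv M c w x =
     (\<Sum>i\<in>UNIV. outer_normal M c (snd c x) $ i * pd (cimg c) i (w \<circ> cinv c) (snd c x))"

definition covariant_deriv ::
  "('a, 'n::finite) riem \<Rightarrow> ('a, 'n) chart \<Rightarrow> real^'n \<Rightarrow> (real^'n \<Rightarrow> real^'n) \<Rightarrow> real^'n \<Rightarrow> real^'n" where
  "covariant_deriv M c v W p = (\<chi> l. \<Sum>i\<in>UNIV. v $ i *
     (pd (cimg c) i (\<lambda>q. W q $ l) p + (\<Sum>j\<in>UNIV. christoffel M c l i j p * W p $ j)))"

text \<open>
  Convexity means that the second fundamental form \<open>II(v,w) = \<langle>\<nabla>_v n, w\<rangle>\<close> with respect to the outer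
  normal \<open>n\<close> is positive semidefinite, as for a ball in Euclidean space.
\<close>

definition convex_boundary :: "('a, 'n::finite) riem \<Rightarrow> bool" where
  "convex_boundary M \<longleftrightarrow>
     (\<forall>c\<in>atlas M. \<forall>p\<in>cimg c - interior (cimg c). \<forall>v. v $ bidx M = 0 \<longrightarrow>
        ginner M c p (covariant_deriv M c v (outer_normal M c) p) v \<ge> 0)"

definition compact_riemannian_manifold_convex_boundary :: "('a, 'n::finite) riem \<Rightarrow> bool" where
  "compact_riemannian_manifold_convex_boundary M \<longleftrightarrow>
     riemannian_manifold M \<and> compact_space (mtop M) \<and> convex_boundary M"

definition smooth_spacetime :: "('a, 'n::finite) riem \<Rightarrow> real set \<Rightarrow> ('a \<Rightarrow> real \<Rightarrow> real) \<Rightarrow> bool" where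
  "smooth_spacetime M J u \<longleftrightarrow>
     (\<forall>c\<in>atlas M. smooth_on (cimg c \<times> J) (\<lambda>(p, t). u (cinv c p) t))"

text \<open>One-sided at \<open>t = 0\<close>.\<close>

definition dt :: "('a \<Rightarrow> real \<Rightarrow> real) \<Rightarrow> 'a \<Rightarrow> real \<Rightarrow> real" where
  "dt u x t = vector_derivative (u x) (at t within {0..})"

definition smooth_positive_solution ::
  "('a, 'n::finite) riem \<Rightarrow> ('a, 'n) vfield \<Rightarrow> (real \<Rightarrow> real) \<Rightarrow> ('a \<Rightarrow> real \<Rightarrow> real) \<Rightarrow> bool" where
  "smooth_positive_solution M V H u \<longleftrightarrow>
     smooth_spacetime M {0..} u \<and>
     (\<forall>x\<in>topspace (mtop M). \<forall>t\<ge>0. u x t > 0) \<and>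
     (\<forall>c\<in>atlas M. \<forall>x\<in>fst c. \<forall>t\<ge>0.
        dt u x t = laplacianV M V c (\<lambda>y. u y t) x + H (u x t))"

definition neumann_condition :: "('a, 'n::finite) riem \<Rightarrow> ('a \<Rightarrow> real \<Rightarrow> real) \<Rightarrow> bool" where
  "neumann_condition M u \<longleftrightarrow>
     (\<forall>c\<in>atlas M. \<forall>x\<in>fst c. snd c x \<notin> interior (cimg c) \<longrightarrow>
        (\<forall>t\<ge>0. normal_deriv M c (\<lambda>y. u y t) x = 0))"

definition A1_system ::
  "('a, 'n::finite) riem \<Rightarrow> real \<Rightarrow> real \<Rightarrow> (real \<Rightarrow> real) \<Rightarrow> (real \<Rightarrow> real) \<Rightarrow> (real \<Rightarrow> real) \<Rightarrow>
   (real \<Rightarrow> real) \<Rightarrow> (real \<Rightarrow> real) \<Rightarrow> ('a \<Rightarrow> real \<Rightarrow> real) \<Rightarrow> bool" where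
  "A1_system M m K \<gamma> \<alpha> \<phi> c h f \<longleftrightarrow>
     (closed_riemannian_manifold M \<or> compact_riemannian_manifold_convex_boundary M) \<and>
     m > 0 \<and> K \<ge> 0 \<and> smooth_spacetime M {0<..} f \<and>
     Ck_on 1 {0<..} \<gamma> \<and> Ck_on 1 {0<..} \<alpha> \<and> Ck_on 1 {0<..} \<phi> \<and> Ck_on 1 {0<..} c \<and>
     (\<exists>I. open I \<and> is_interval I \<and> (\<forall>x\<in>topspace (mtop M). \<forall>t>0. f x t \<in> I) \<and> Ck_on 2 I h) \<and>
     (\<forall>x\<in>topspace (mtop M). \<forall>t>0.
        4 * \<gamma> t / m * c t + (\<alpha> t - \<gamma> t) * deriv h (f x t) + \<alpha> t * deriv (deriv h) (f x t)
            - 2 * K * \<gamma> t - deriv \<gamma> t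
          \<ge> \<gamma> t / \<alpha> t * (4 * \<gamma> t / m * c t - deriv \<alpha> t) \<and>
        deriv \<phi> t - 2 * \<gamma> t / m * (c t)\<^sup>2
            + \<phi> t / \<alpha> t * (4 * \<gamma> t / m * c t - \<alpha> t * deriv h (f x t) - deriv \<alpha> t) \<ge> 0 \<and>
        4 * \<gamma> t / m * c t - \<alpha> t * deriv h (f x t) - deriv \<alpha> t > 0 \<and>
        \<alpha> t > 0 \<and> \<gamma> t > 0)"

definition A2_system ::
  "('a, 'n::finite) riem \<Rightarrow> real \<Rightarrow> real \<Rightarrow> (real \<Rightarrow> real) \<Rightarrow> (real \<Rightarrow> real) \<Rightarrow> (real \<Rightarrow> real) \<Rightarrow>
   (real \<Rightarrow> real) \<Rightarrow> (real \<Rightarrow> real) \<Rightarrow> ('a \<Rightarrow> real \<Rightarrow> real) \<Rightarrow> bool" where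
  "A2_system M m K \<gamma> \<alpha> \<phi> c h f \<longleftrightarrow>
     A1_system M m K \<gamma> \<alpha> \<phi> c h f \<and>
     (\<exists>l. (\<alpha> \<longlongrightarrow> l) (at_right 0)) \<and> (\<exists>l. (\<gamma> \<longlongrightarrow> l) (at_right 0)) \<and>
     filterlim \<phi> at_top (at_right 0)"

end

theory Submission
  imports Defs
begin

text \<open>
  Put \<open>Q = |\<nabla>f|\<^sup>2\<close> and \<open>F = \<gamma> Q - \<alpha> (f\<^sub>t - h(f)) - \<phi>\<close>. Since \<open>\<phi>\<close> tends to infinity
  while the other terms stay bounded, \<open>F\<close> is negative near \<open>t = 0\<close>, so a positive value of \<open>F\<close>
  entails a positive maximum over \<open>M \<times> [a, t\<^sub>1]\<close>, attained at a time later than \<open>a\<close>. At an interior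
  maximum the Bochner formula, the bound on \<open>Ric\<^sub>V\<^sup>m\<close> and the inequality \<open>(\<Delta>\<^sub>V f + c)\<^sup>2 \<ge> 0\<close> give
  \<open>0 \<le> F\<^sub>t - \<Delta>\<^sub>V F - 2 \<langle>\<nabla>f, \<nabla>F\<rangle> \<le> - (4 \<gamma> c / m - \<alpha> h'(f) - \<alpha>') F / \<alpha>\<close>, a contradiction. At a boundary
  maximum the Neumann condition and convexity give \<open>\<partial>F/\<partial>n \<le> 0\<close>, which together with maximality
  forces \<open>\<nabla>F = 0\<close>; the Hessian of \<open>F\<close> is then negative semidefinite because one of \<open>v\<close> and \<open>-v\<close>
  points inward for every \<open>v\<close>, and the interior argument applies.
\<close>

subsection \<open>One-sided calculus\<close>

text \<open>The maximum may sit on the boundary, and the whole evolution computation is needed there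
  too. Nothing is extended across the boundary: all derivatives are taken within chart images, and
  what makes this calculus work is that small displacements in the closed positive orthant stay in
  the set. This is enough to fix derivatives and to make second derivatives commute, so interior and
  edge points share one proof of the Bochner formula. The free function \<open>c\<close> linearises
  the quadratic term: with P = \<Delta>_V f the square gives -P^2 \<le> 2 c P + c^2, and since f_t -
  h(f) = P + Q, the definition of F expresses P through Q, \<phi> and F. The three conditions of the
  A1-system then control, in order, the coefficient of Q, the term free of P, Q and F, and the
  coefficient of F. The norm of the gradient is defined chart by chart, so its independence of the
  chart has to be settled before a maximum over the manifold makes sense.\<close>

definition orthant_open :: "'e::euclidean_space set \<Rightarrow> bool" where
  "orthant_open S \<longleftrightarrow>
     (\<forall>p\<in>S. \<exists>\<delta>>0. \<forall>v. (\<forall>b\<in>Basis. 0 \<le> v \<bullet> b) \<longrightarrow> norm v < \<delta> \<longrightarrow> p + v \<in> S)"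

lemma orthant_openE:
  assumes "orthant_open S" "p \<in> S"
  obtains \<delta> where "\<delta> > 0" "\<And>v. (\<And>b. b \<in> Basis \<Longrightarrow> 0 \<le> v \<bullet> b) \<Longrightarrow> norm v < \<delta> \<Longrightarrow> p + v \<in> S"
  using assms unfolding orthant_open_def by metis

lemma open_imp_orthant_open: "open S \<Longrightarrow> orthant_open S"
proof -
  assume "open S"
  { fix p assume "p \<in> S"
    then obtain e where e: "e > 0" "ball p e \<subseteq> S"
      using \<open>open S\<close> open_contains_ball by blast
    have "p + v \<in> S" if "norm v < e" for v
      using e that by (auto simp: subset_iff dist_norm)
    then have "\<exists>\<delta>>0. \<forall>v. (\<forall>b\<in>Basis. 0 \<le> v \<bullet> b) \<longrightarrow> norm v < \<delta> \<longrightarrow> p + v \<in> S"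
      using e by blast }
  then show ?thesis unfolding orthant_open_def by blast
qed

lemma orthant_open_Int:
  assumes "orthant_open S" "orthant_open T"
  shows "orthant_open (S \<inter> T)"
  unfolding orthant_open_def
proof
  fix p assume "p \<in> S \<inter> T"
  then obtain d e where "d > 0" "e > 0"
    "\<And>v. (\<And>b. b \<in> Basis \<Longrightarrow> 0 \<le> v \<bullet> b) \<Longrightarrow> norm v < d \<Longrightarrow> p + v \<in> S"
    "\<And>v. (\<And>b. b \<in> Basis \<Longrightarrow> 0 \<le> v \<bullet> b) \<Longrightarrow> norm v < e \<Longrightarrow> p + v \<in> T"
    using orthant_openE[OF assms(1), of p] orthant_openE[OF assms(2), of p] by (metis Int_iff)
  then show "\<exists>\<delta>>0. \<forall>v. (\<forall>b\<in>Basis. 0 \<le> v \<bullet> b) \<longrightarrow> norm v < \<delta> \<longrightarrow> p + v \<in> S \<inter> T"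
    by (intro exI[of _ "min d e"]) auto
qed

lemma orthant_open_Times:
  assumes "orthant_open S" "orthant_open T"
  shows "orthant_open (S \<times> T)"
  unfolding orthant_open_def
proof
  fix z assume "z \<in> S \<times> T"
  then obtain p q where z: "z = (p, q)" "p \<in> S" "q \<in> T" by auto
  obtain d where d: "d > 0" "\<And>v. (\<And>b. b \<in> Basis \<Longrightarrow> 0 \<le> v \<bullet> b) \<Longrightarrow> norm v < d \<Longrightarrow> p + v \<in> S"
    using orthant_openE[OF assms(1) z(2)] by metis
  obtain e where e: "e > 0" "\<And>v. (\<And>b. b \<in> Basis \<Longrightarrow> 0 \<le> v \<bullet> b) \<Longrightarrow> norm v < e \<Longrightarrow> q + v \<in> T"
    using orthant_openE[OF assms(2) z(3)] by metis
  have "z + v \<in> S \<times> T" if v: "\<forall>b\<in>Basis. 0 \<le> v \<bullet> b" "norm v < min d e" for v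
  proof -
    obtain v1 v2 where vv: "v = (v1, v2)" by fastforce
    have 1: "0 \<le> v1 \<bullet> b" if "b \<in> Basis" for b
      using bspec[OF v(1), of "(b, 0)"] that by (auto simp: vv Basis_prod_def)
    have 2: "0 \<le> v2 \<bullet> b" if "b \<in> Basis" for b
      using bspec[OF v(1), of "(0, b)"] that by (auto simp: vv Basis_prod_def)
    have "norm v1 \<le> norm v" "norm v2 \<le> norm v"
      using norm_fst_le[of v1 v2] norm_snd_le[of v2 v1] vv by auto
    then show ?thesis using d(2)[OF 1] e(2)[OF 2] v(2) by (auto simp: z vv)
  qed
  then show "\<exists>\<delta>>0. \<forall>v. (\<forall>b\<in>Basis. 0 \<le> v \<bullet> b) \<longrightarrow> norm v < \<delta> \<longrightarrow> z + v \<in> S \<times> T"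
    using d e by (intro exI[of _ "min d e"]) auto
qed

lemma orthant_open_halfspace: "orthant_open {p :: real^'n. 0 \<le> p $ i}"
  unfolding orthant_open_def
  by (rule ballI, rule exI[of _ 1]) (auto simp: Basis_vec_def inner_axis)

lemma orthant_open_halfline: "orthant_open {0::real..}" "orthant_open {0::real<..}"
  unfolding orthant_open_def by (auto intro!: exI[of _ 1])

text \<open>A derivative is determined by difference quotients along the basis vectors, and small
  positive multiples of these are admissible displacements even at an edge.\<close>

lemma unique_frechet_within:
  assumes S: "orthant_open S" "p \<in> S"
    and "(w has_derivative D) (at p within S)" "(w has_derivative D') (at p within S)"
  shows "D = D'"
proof (rule frechet_derivative_unique_within[OF assms(3,4)])
  fix i :: 'a and e :: real assume i: "i \<in> Basis" "e > 0"
  obtain d where d: "d > 0" "\<And>v. (\<And>b. b \<in> Basis \<Longrightarrow> 0 \<le> v \<bullet> b) \<Longrightarrow> norm v < d \<Longrightarrow> p + v \<in> S"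
    using orthant_openE[OF S] by metis
  have "p + (min d e / 2) *\<^sub>R i \<in> S"
    using d i by (intro d(2)) (auto simp: inner_Basis)
  then show "\<exists>d. 0 < \<bar>d\<bar> \<and> \<bar>d\<bar> < e \<and> p + d *\<^sub>R i \<in> S"
    using d i by (intro exI[of _ "min d e / 2"]) auto
qed

lemma frechet_derivative_within_eq:
  assumes "orthant_open S" "p \<in> S" "(w has_derivative D) (at p within S)"
  shows "frechet_derivative w (at p within S) = D"
  by (rule unique_frechet_within[OF assms(1,2) _ assms(3)])
     (use assms(3) differentiableI frechet_derivative_works in blast)

text \<open>Young's form of the symmetry of second derivatives: differentiability of the first
  derivatives at one point suffices, so the point may lie on the edge of \<open>S\<close>.\<close>

lemma second_difference_limit:
  fixes w :: "'e::euclidean_space \<Rightarrow> real"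
  assumes \<delta>: "\<delta> > 0" "\<And>s r. 0 \<le> s \<Longrightarrow> s \<le> \<delta> \<Longrightarrow> 0 \<le> r \<Longrightarrow> r \<le> \<delta> \<Longrightarrow> x + s *\<^sub>R a + r *\<^sub>R b \<in> S"
    and W: "\<And>y. y \<in> S \<Longrightarrow> (w has_derivative W y) (at y within S)"
    and A: "((\<lambda>y. W y a) has_derivative A) (at x within S)"
  shows "((\<lambda>s. (w (x + s *\<^sub>R a + s *\<^sub>R b) - w (x + s *\<^sub>R a) - w (x + s *\<^sub>R b) + w x) / s\<^sup>2)
            \<longlongrightarrow> A b) (at_right 0)"
proof (rule tendstoI)
  fix e :: real assume "e > 0"
  \<comment> \<open>The errors in \<open>e1\<close> and \<open>e2\<close> are proportional to s
    (norm a + norm b) and to s norm a. Their sum is below s \<open>?c\<close>, so the weight e / (2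
    \<open>?c\<close>) leaves at most s e / 2 in total; the summand 1 keeps \<open>?c\<close>
    positive.\<close>
  let ?c = "2 * norm a + norm b + 1"
  have c: "?c > 0" by (smt (verit) norm_ge_zero)
  interpret A: bounded_linear A using A has_derivative_bounded_linear by blast
  obtain d where d: "d > 0" "\<And>y. y \<in> S \<Longrightarrow> norm (y - x) < d \<Longrightarrow>
      \<bar>W y a - W x a - A (y - x)\<bar> \<le> (e / (2 * ?c)) * norm (y - x)"
    using A \<open>e > 0\<close> c unfolding has_derivative_within_alt by (metis divide_pos_pos mult_pos_pos real_norm_def zero_less_numeral)
  have main: "\<bar>(w (x + s *\<^sub>R a + s *\<^sub>R b) - w (x + s *\<^sub>R a) - w (x + s *\<^sub>R b) + w x) / s\<^sup>2 - A b\<bar> < e"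
    if s: "0 < s" "s \<le> \<delta>" "s * ?c < d" for s
  proof -
    \<comment> \<open>The second difference is the increment of \<phi> over [0, s]. The mean value
      theorem along \<open>a\<close> turns it into a difference of \<open>W\<close> at two points
      near \<open>x\<close>, and the derivative \<open>A\<close> at \<open>x\<close> alone evaluates
      that difference.\<close>
    define \<phi> where "\<phi> r = w (x + r *\<^sub>R a + s *\<^sub>R b) - w (x + r *\<^sub>R a)" for r
    have in1: "x + r *\<^sub>R a + s *\<^sub>R b \<in> S" "x + r *\<^sub>R a \<in> S" if "0 \<le> r" "r \<le> s" for r
      using \<delta>(2)[of r s] \<delta>(2)[of r 0] that s \<delta>(1) by auto
    have lin: "linear (W y)" if "y \<in> S" for y
      using W[OF that] has_derivative_bounded_linear bounded_linear.linear by blast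
    have der: "(\<phi> has_derivative (\<lambda>h. h * (W (x + r *\<^sub>R a + s *\<^sub>R b) a - W (x + r *\<^sub>R a) a))) (at r within {0..s})"
      if r: "0 \<le> r" "r \<le> s" for r
    proof -
      have 1: "((\<lambda>r. w (x + r *\<^sub>R a + s *\<^sub>R b)) has_derivative (\<lambda>h. W (x + r *\<^sub>R a + s *\<^sub>R b) (h *\<^sub>R a))) (at r within {0..s})"
        by (rule has_derivative_in_compose2[where t=S and g=w and g'=W])
           (use in1 r in \<open>auto intro!: derivative_eq_intros W\<close>)
      have 2: "((\<lambda>r. w (x + r *\<^sub>R a)) has_derivative (\<lambda>h. W (x + r *\<^sub>R a) (h *\<^sub>R a))) (at r within {0..s})"
        by (rule has_derivative_in_compose2[where t=S and g=w and g'=W])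
           (use in1 r in \<open>auto intro!: derivative_eq_intros W\<close>)
      show ?thesis unfolding \<phi>_def
        using has_derivative_diff[OF 1 2] in1[OF r]
        by (simp add: linear_scale[OF lin] algebra_simps)
    qed
    obtain \<xi> where \<xi>: "0 < \<xi>" "\<xi> < s" "\<phi> s - \<phi> 0 = (s - 0) * (W (x + \<xi> *\<^sub>R a + s *\<^sub>R b) a - W (x + \<xi> *\<^sub>R a) a)"
      using mvt_simple[of 0 s \<phi> "\<lambda>r h. h * (W (x + r *\<^sub>R a + s *\<^sub>R b) a - W (x + r *\<^sub>R a) a)"] s der
      by auto
    let ?y = "x + \<xi> *\<^sub>R a + s *\<^sub>R b" and ?z = "x + \<xi> *\<^sub>R a"
    have S: "?y \<in> S" "?z \<in> S" using in1[of \<xi>] \<xi> by auto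
    have na: "norm (\<xi> *\<^sub>R a) \<le> s * norm a" using \<xi> by (simp add: mult_right_mono)
    have nb: "norm (\<xi> *\<^sub>R a + s *\<^sub>R b) \<le> s * norm a + s * norm b"
      using na norm_triangle_ineq[of "\<xi> *\<^sub>R a" "s *\<^sub>R b"] s by simp
    have le: "s * norm a + s * norm b \<le> s * ?c" "s * norm a \<le> s * ?c"
      using s by (auto simp: algebra_simps)
    have e1: "\<bar>W ?y a - W x a - A (\<xi> *\<^sub>R a + s *\<^sub>R b)\<bar> \<le> (e / (2 * ?c)) * (s * norm a + s * norm b)"
    proof -
      have "\<bar>W ?y a - W x a - A (?y - x)\<bar> \<le> (e / (2 * ?c)) * norm (?y - x)"
        using order.strict_trans1[OF order.trans[OF nb le(1)] s(3)] by (intro d(2) S) (simp add: add.assoc)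
      also have "\<dots> \<le> (e / (2 * ?c)) * (s * norm a + s * norm b)"
        using nb \<open>e > 0\<close> c by (intro mult_left_mono) (auto simp: algebra_simps)
      finally show ?thesis by (simp add: algebra_simps)
    qed
    have e2: "\<bar>W ?z a - W x a - A (\<xi> *\<^sub>R a)\<bar> \<le> (e / (2 * ?c)) * (s * norm a)"
    proof -
      have "\<bar>W ?z a - W x a - A (?z - x)\<bar> \<le> (e / (2 * ?c)) * norm (?z - x)"
        using order.strict_trans1[OF order.trans[OF na le(2)] s(3)] by (intro d(2) S) simp
      also have "\<dots> \<le> (e / (2 * ?c)) * (s * norm a)"
        using na \<open>e > 0\<close> c by (intro mult_left_mono) auto
      finally show ?thesis by simp
    qed
    have "\<bar>W ?y a - W ?z a - s * A b\<bar> \<le> (e / (2 * ?c)) * (s * norm a + s * norm b) + (e / (2 * ?c)) * (s * norm a)"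
      using e1 e2 by (simp add: A.add A.scaleR abs_le_iff)
    also have "\<dots> = (e / (2 * ?c)) * (s * (2 * norm a + norm b))"
      unfolding distrib_left[symmetric] by (simp add: algebra_simps)
    also have "\<dots> \<le> (e / (2 * ?c)) * (s * ?c)"
      using \<open>e > 0\<close> c s by (intro mult_left_mono) auto
    also have "\<dots> = s * e / 2" using c by (simp add: field_simps)
    also have "\<dots> < s * e" using s \<open>e > 0\<close> by simp
    finally have fin: "\<bar>W ?y a - W ?z a - s * A b\<bar> < s * e" .
    have eq: "w (x + s *\<^sub>R a + s *\<^sub>R b) - w (x + s *\<^sub>R a) - w (x + s *\<^sub>R b) + w x = \<phi> s - \<phi> 0"
      by (simp add: \<phi>_def)
    have "(w (x + s *\<^sub>R a + s *\<^sub>R b) - w (x + s *\<^sub>R a) - w (x + s *\<^sub>R b) + w x) / s\<^sup>2 - A b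
        = (W ?y a - W ?z a - s * A b) / s"
      unfolding eq \<xi>(3) using s by (simp add: power2_eq_square field_simps)
    then show ?thesis using fin s by (simp add: abs_divide divide_less_eq mult.commute)
  qed
  show "eventually (\<lambda>s. dist ((w (x + s *\<^sub>R a + s *\<^sub>R b) - w (x + s *\<^sub>R a) - w (x + s *\<^sub>R b) + w x) / s\<^sup>2) (A b) < e) (at_right 0)"
    unfolding eventually_at_right_field dist_real_def
    using main c d(1) \<delta>(1)
    by (intro exI[of _ "min \<delta> (d / ?c)"]) (auto simp: pos_less_divide_eq)
qed

text \<open>The second difference is symmetric in \<open>a\<close> and \<open>b\<close>, so one and
  the same quotient tends to both mixed derivatives.\<close>

lemma second_derivative_symmetric:
  fixes w :: "'e::euclidean_space \<Rightarrow> real"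
  assumes S: "orthant_open S" "x \<in> S" and ab: "a \<in> Basis" "b \<in> Basis"
    and W: "\<And>y. y \<in> S \<Longrightarrow> (w has_derivative W y) (at y within S)"
    and A: "((\<lambda>y. W y a) has_derivative A) (at x within S)"
    and B: "((\<lambda>y. W y b) has_derivative B) (at x within S)"
  shows "A b = B a"
proof -
  obtain d where d: "d > 0" "\<And>v. (\<And>b. b \<in> Basis \<Longrightarrow> 0 \<le> v \<bullet> b) \<Longrightarrow> norm v < d \<Longrightarrow> x + v \<in> S"
    using orthant_openE[OF S] by metis
  \<comment> \<open>With both parameters at most d/3 the displacement has norm at most 2d/3 <
    d.\<close>
  have in1: "x + s *\<^sub>R a + r *\<^sub>R b \<in> S" if "0 \<le> s" "s \<le> d/3" "0 \<le> r" "r \<le> d/3" for s r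
  proof -
    have "norm (s *\<^sub>R a + r *\<^sub>R b) \<le> s + r"
      using norm_triangle_ineq[of "s *\<^sub>R a" "r *\<^sub>R b"] that ab by simp
    then have "x + (s *\<^sub>R a + r *\<^sub>R b) \<in> S"
      using that d(1) ab by (intro d(2)) (auto simp: inner_add_left inner_Basis)
    then show ?thesis by (simp add: add.assoc)
  qed
  have in2: "x + s *\<^sub>R b + r *\<^sub>R a \<in> S" if "0 \<le> s" "s \<le> d/3" "0 \<le> r" "r \<le> d/3" for s r
    using in1[OF that(3,4,1,2)] by (simp add: add_ac)
  have 1: "((\<lambda>s. (w (x + s *\<^sub>R a + s *\<^sub>R b) - w (x + s *\<^sub>R a) - w (x + s *\<^sub>R b) + w x) / s\<^sup>2)
            \<longlongrightarrow> A b) (at_right 0)"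
    by (rule second_difference_limit[of "d/3", OF _ in1 W A]) (use d in auto)
  have 2: "((\<lambda>s. (w (x + s *\<^sub>R b + s *\<^sub>R a) - w (x + s *\<^sub>R b) - w (x + s *\<^sub>R a) + w x) / s\<^sup>2)
            \<longlongrightarrow> B a) (at_right 0)"
    by (rule second_difference_limit[of "d/3", OF _ in2 W B]) (use d in auto)
  have eq: "(\<lambda>s. (w (x + s *\<^sub>R b + s *\<^sub>R a) - w (x + s *\<^sub>R b) - w (x + s *\<^sub>R a) + w x) / s\<^sup>2)
     = (\<lambda>s. (w (x + s *\<^sub>R a + s *\<^sub>R b) - w (x + s *\<^sub>R a) - w (x + s *\<^sub>R b) + w x) / s\<^sup>2)"
    by (auto simp: algebra_simps)
  show ?thesis by (rule tendsto_unique[OF _ 1 2[unfolded eq]]) simp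
qed

lemma sum_axis: "(\<Sum>k\<in>UNIV. axis (l::'n::finite) (1::real) $ k * x k) = x l"
proof -
  have "axis l (1::real) $ k * x k = (if k = l then x k else 0)" for k
    by (simp add: axis_def)
  then show ?thesis by simp
qed

lemma pd_eq:
  assumes "orthant_open S" "p \<in> S" "(w has_derivative D) (at p within S)"
  shows "pd S i w p = D (axis i 1)"
  unfolding pd_def frechet_derivative_within_eq[OF assms] ..

lemma differentiable_on_cong:
  assumes "f differentiable_on S" "\<And>q. q \<in> S \<Longrightarrow> f q = g q"
  shows "g differentiable_on S"
  using assms unfolding differentiable_on_def
  by (metis differentiable_transform_within zero_less_one)

lemma frechet_derivative_within_cong:
  assumes "orthant_open S" "p \<in> S" "\<And>q. q \<in> S \<Longrightarrow> f q = g q"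
  shows "frechet_derivative f (at p within S) = frechet_derivative g (at p within S)"
proof -
  have "(f has_derivative D) (at p within S) \<longleftrightarrow> (g has_derivative D) (at p within S)" for D
    using assms(2,3) by (metis has_derivative_transform)
  then show ?thesis unfolding frechet_derivative_def by simp
qed

lemma Ck_on_cong:
  assumes "orthant_open S" "\<And>q. q \<in> S \<Longrightarrow> f q = g q" "Ck_on k S f"
  shows "Ck_on k S g"
  using assms(2,3)
proof (induction k arbitrary: f g)
  case 0
  then show ?case by (simp cong: continuous_on_cong)
next
  case (Suc k)
  have "Ck_on k S (\<lambda>x. frechet_derivative g (at x within S) b)" if "b \<in> Basis" for b
  proof (rule Suc.IH)
    show "Ck_on k S (\<lambda>x. frechet_derivative f (at x within S) b)" using Suc.prems that by simp
    show "frechet_derivative f (at q within S) b = frechet_derivative g (at q within S) b" if "q \<in> S" for q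
      using frechet_derivative_within_cong[OF assms(1) that Suc.prems(1)] by simp
  qed
  moreover have "g differentiable_on S"
    using differentiable_on_cong[of f S g] Suc.prems by simp
  ultimately show ?case by simp
qed

lemma Ck_on_bounded_linear:
  assumes S: "orthant_open S" and L: "bounded_linear L" and "Ck_on k S f"
  shows "Ck_on k S (\<lambda>x. L (f x))"
  using assms(3)
proof (induction k arbitrary: f)
  case 0
  then show ?case using bounded_linear.continuous_on[OF L] by simp
next
  case (Suc k)
  have d: "(f has_derivative frechet_derivative f (at x within S)) (at x within S)" if "x \<in> S" for x
    using Suc.prems that by (simp add: differentiable_on_def frechet_derivative_works)
  have dL: "((\<lambda>x. L (f x)) has_derivative (\<lambda>v. L (frechet_derivative f (at x within S) v))) (at x within S)" if "x \<in> S" for x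
    by (rule bounded_linear.has_derivative[OF L d[OF that]])
  have "Ck_on k S (\<lambda>x. frechet_derivative (\<lambda>x. L (f x)) (at x within S) b)" if "b \<in> Basis" for b
    by (rule Ck_on_cong[OF S _ Suc.IH[of "\<lambda>x. frechet_derivative f (at x within S) b"]])
       (use Suc.prems that frechet_derivative_within_eq[OF S _ dL] in auto)
  then show ?case using dL unfolding Ck_on.simps differentiable_on_def differentiable_def by blast
qed

lemma smooth_on_bounded_linear:
  "orthant_open S \<Longrightarrow> bounded_linear L \<Longrightarrow> smooth_on S f \<Longrightarrow> smooth_on S (\<lambda>x. L (f x))"
  unfolding smooth_on_def by (simp add: Ck_on_bounded_linear)

lemma smooth_on_derivative:
  "smooth_on S f \<Longrightarrow> b \<in> Basis \<Longrightarrow> smooth_on S (\<lambda>x. frechet_derivative f (at x within S) b)"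
  unfolding smooth_on_def using Ck_on.simps(2) by blast

lemma smooth_on_imp_differentiable_on: "smooth_on S f \<Longrightarrow> f differentiable_on S"
  unfolding smooth_on_def using Ck_on.simps(2) by blast

lemma smooth_on_imp_continuous_on: "smooth_on S f \<Longrightarrow> continuous_on S f"
  unfolding smooth_on_def using Ck_on.simps(1) by blast

lemma smooth_on_pd: "smooth_on S f \<Longrightarrow> smooth_on S (pd S i f)"
  unfolding pd_def using smooth_on_derivative[of S f "axis i 1"] by auto

text \<open>Bridges two ways of differentiating \<open>h\<close>: \<open>Ck_on\<close> uses
  derivatives within \<open>I\<close>, the A1-system uses \<open>deriv\<close>; on an open set they
  agree.\<close>

lemma Ck_on_2_real:
  fixes h :: "real \<Rightarrow> real"
  assumes "open I" "Ck_on 2 I h" "s \<in> I"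
  shows "(h has_real_derivative deriv h s) (at s)"
    "(deriv h has_real_derivative deriv (deriv h) s) (at s)"
proof -
  have 1: "h differentiable_on I"
    and 2: "(\<lambda>x. frechet_derivative h (at x within I) 1) differentiable_on I"
    using assms(2) by (auto simp: numeral_2_eq_2)
  have hs: "(h has_real_derivative deriv h r) (at r)" if "r \<in> I" for r
    using 1 that at_within_open[OF that assms(1)]
    by (metis DERIV_deriv_iff_real_differentiable differentiable_on_def)
  then show "(h has_real_derivative deriv h s) (at s)" using assms by blast
  have eq: "frechet_derivative h (at r within I) 1 = deriv h r" if "r \<in> I" for r
    using frechet_derivative_at[OF hs[OF that, unfolded has_field_derivative_def]] at_within_open[OF that assms(1)]
    by (metis mult.right_neutral)
  have "deriv h differentiable_on I"
    by (rule differentiable_on_cong[OF 2 eq])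
  then show "(deriv h has_real_derivative deriv (deriv h) s) (at s)"
    using at_within_open[OF assms(3,1)] assms(3)
    by (metis DERIV_deriv_iff_real_differentiable differentiable_on_def)
qed

text \<open>Rules for partial derivatives on a set of which only the orthant property is known;
  chart images in the interior and at the boundary are both instances.\<close>

locale one_sided_domain =
  fixes S :: "(real^'n::finite) set"
  assumes orthant_open: "orthant_open S"
begin

lemma has_derivative_pd:
  assumes "w differentiable_on S" "p \<in> S"
  shows "(w has_derivative (\<lambda>v. \<Sum>i\<in>UNIV. v $ i * pd S i w p)) (at p within S)"
proof -
  obtain D where D: "(w has_derivative D) (at p within S)"
    using assms unfolding differentiable_on_def differentiable_def by blast
  interpret D: bounded_linear D using D has_derivative_bounded_linear by blast
  have "D v = (\<Sum>i\<in>UNIV. v $ i * pd S i w p)" for v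
  proof -
    have "D v = D (\<Sum>i\<in>UNIV. v $ i *\<^sub>R axis i 1)"
      using basis_expansion[of v] by (simp add: scalar_mult_eq_scaleR)
    then show ?thesis
      by (simp add: D.sum D.scaleR pd_eq[OF orthant_open assms(2) D])
  qed
  then have "D = (\<lambda>v. \<Sum>i\<in>UNIV. v $ i * pd S i w p)" by (rule ext)
  then show ?thesis using D by simp
qed

lemma pd_const: "p \<in> S \<Longrightarrow> pd S i (\<lambda>q. k) p = 0"
  by (subst pd_eq[OF orthant_open]) (auto intro: derivative_eq_intros)

lemma pd_add:
  assumes "w differentiable_on S" "z differentiable_on S" "p \<in> S"
  shows "pd S i (\<lambda>q. w q + z q) p = pd S i w p + pd S i z p"
  by (subst pd_eq[OF orthant_open assms(3) has_derivative_add[OF assms(1,2)[THEN has_derivative_pd, OF assms(3)]]])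
     (simp add: sum_axis)

lemma pd_diff:
  assumes "w differentiable_on S" "z differentiable_on S" "p \<in> S"
  shows "pd S i (\<lambda>q. w q - z q) p = pd S i w p - pd S i z p"
  by (subst pd_eq[OF orthant_open assms(3) has_derivative_diff[OF assms(1,2)[THEN has_derivative_pd, OF assms(3)]]])
     (simp add: sum_axis)

lemma pd_mult:
  assumes "w differentiable_on S" "z differentiable_on S" "p \<in> S"
  shows "pd S i (\<lambda>q. w q * z q) p = pd S i w p * z p + w p * pd S i z p"
  by (subst pd_eq[OF orthant_open assms(3) has_derivative_mult[OF assms(1,2)[THEN has_derivative_pd, OF assms(3)]]])
     (simp add: sum_axis)

lemma pd_cmult:
  assumes "w differentiable_on S" "p \<in> S"
  shows "pd S i (\<lambda>q. k * w q) p = k * pd S i w p"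
  using pd_mult[of "\<lambda>q. k" w p i] assms by (simp add: pd_const)

lemma pd_sum:
  assumes "\<And>a. a \<in> A \<Longrightarrow> w a differentiable_on S" "p \<in> S"
  shows "pd S i (\<lambda>q. \<Sum>a\<in>A. w a q) p = (\<Sum>a\<in>A. pd S i (w a) p)"
  by (subst pd_eq[OF orthant_open assms(2) has_derivative_sum[OF has_derivative_pd[OF assms(1) assms(2)]]])
     (simp_all add: sum_axis)

lemma differentiable_on_compose_real:
  assumes "w differentiable_on S" "\<And>p. p \<in> S \<Longrightarrow> (h has_real_derivative h' (w p)) (at (w p))"
  shows "(\<lambda>q. h (w q)) differentiable_on S"
  unfolding differentiable_on_def
proof
  fix q assume "q \<in> S"
  then show "(\<lambda>q. h (w q)) differentiable (at q within S)"
    using has_derivative_compose[OF has_derivative_pd[OF assms(1)] assms(2)[unfolded has_field_derivative_def]]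
    by (auto intro: differentiableI)
qed

lemma pd_compose_real:
  assumes "w differentiable_on S" "(h has_real_derivative d) (at (w p))" "p \<in> S"
  shows "pd S i (\<lambda>q. h (w q)) p = d * pd S i w p"
  by (subst pd_eq[OF orthant_open assms(3) has_derivative_compose[OF has_derivative_pd[OF assms(1,3)] assms(2)[unfolded has_field_derivative_def]]])
     (simp add: sum_axis)

lemma pd_cong:
  assumes "\<And>q. q \<in> S \<Longrightarrow> w q = z q" "p \<in> S"
  shows "pd S i w p = pd S i z p"
  unfolding pd_def using frechet_derivative_within_cong[OF orthant_open assms(2,1)] by simp

text \<open>This weak form is the one that applies to the components of \<open>gradv f\<close>,
  whose first derivatives are shown to be differentiable and no more.\<close>

lemma pd_commute:
  assumes w: "w differentiable_on S" "pd S i w differentiable_on S" "pd S j w differentiable_on S" and p: "p \<in> S"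
  shows "pd S i (pd S j w) p = pd S j (pd S i w) p"
proof -
  have eq: "(\<Sum>k\<in>UNIV. axis l 1 $ k * pd S k w y) = pd S l w y" for l y
    by (simp add: sum_axis)
  show ?thesis
    using second_derivative_symmetric[where W="\<lambda>y v. \<Sum>k\<in>UNIV. v $ k * pd S k w y",
        OF orthant_open p, of "axis i 1" "axis j 1" w, unfolded eq,
        OF _ _ has_derivative_pd[OF w(1)] has_derivative_pd[OF w(2) p] has_derivative_pd[OF w(3) p]]
    by (simp add: sum_axis)
qed

lemma pd_sum_mult:
  assumes "\<And>a. x a differentiable_on S" "\<And>a. y a differentiable_on S" "p \<in> S"
  shows "pd S i (\<lambda>q. \<Sum>a\<in>A. x a q * y a q) p = (\<Sum>a\<in>A. pd S i (x a) p * y a p + x a p * pd S i (y a) p)"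
  using assms by (subst pd_sum) (auto intro: differentiable_on_mult simp: pd_mult)

lemma differentiable_on_sum:
  "(\<And>a. a \<in> A \<Longrightarrow> w a differentiable_on S) \<Longrightarrow> (\<lambda>q. \<Sum>a\<in>A. w a q) differentiable_on S" for w :: "'i \<Rightarrow> real^'n \<Rightarrow> real"
  unfolding differentiable_on_def by (cases "finite A") (auto intro: differentiable_sum)

end

section \<open>Derivatives on products of a chart image with a time interval\<close>

definition space_deriv :: "(real^'n) set \<Rightarrow> real set \<Rightarrow> 'n \<Rightarrow> ((real^'n) \<times> real \<Rightarrow> real) \<Rightarrow> (real^'n) \<times> real \<Rightarrow> real" where
  "space_deriv S J i W z = frechet_derivative W (at z within S \<times> J) (axis i 1, 0)"

definition time_deriv :: "(real^'n) set \<Rightarrow> real set \<Rightarrow> ((real^'n) \<times> real \<Rightarrow> real) \<Rightarrow> (real^'n) \<times> real \<Rightarrow> real" where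
  "time_deriv S J W z = frechet_derivative W (at z within S \<times> J) (0, 1)"

lemma smooth_on_space_deriv:
  "smooth_on (S \<times> J) W \<Longrightarrow> smooth_on (S \<times> J) (space_deriv S J i W)"
  using smooth_on_derivative[of "S \<times> J" W "(axis i 1, 0)"]
  unfolding space_deriv_def by (auto simp: Basis_prod_def)

lemma smooth_on_time_deriv:
  "smooth_on (S \<times> J) W \<Longrightarrow> smooth_on (S \<times> J) (time_deriv S J W)"
  using smooth_on_derivative[of "S \<times> J" W "(0, 1)"]
  unfolding time_deriv_def by (auto simp: Basis_prod_def)

locale one_sided_spacetime = one_sided_domain S for S :: "(real^'n::finite) set" +
  fixes J :: "real set"
  assumes orthant_open_J: "orthant_open J"
begin

lemma orthant_open_SJ: "orthant_open (S \<times> J)"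
  using orthant_open_Times orthant_open orthant_open_J by blast

lemma has_derivative_W:
  assumes "W differentiable_on S \<times> J" "p \<in> S" "t \<in> J"
  shows "(W has_derivative frechet_derivative W (at (p, t) within S \<times> J)) (at (p, t) within S \<times> J)"
  using assms by (simp add: differentiable_on_def frechet_derivative_works)

lemma space_slice:
  assumes "W differentiable_on S \<times> J" "p \<in> S" "t \<in> J"
  shows "((\<lambda>q. W (q, t)) has_derivative (\<lambda>v. frechet_derivative W (at (p, t) within S \<times> J) (v, 0))) (at p within S)"
proof -
  have "((\<lambda>q. (q, t)) has_derivative (\<lambda>v. (v, 0))) (at p within S)"
    by (rule has_derivative_Pair[OF has_derivative_ident has_derivative_const])
  from has_derivative_in_compose2[where t="S \<times> J" and s=S and g=W and f="\<lambda>q. (q, t)"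
      and g'="\<lambda>z. frechet_derivative W (at z within S \<times> J)", OF _ _ assms(2) this]
  show ?thesis using assms has_derivative_W[OF assms(1)] by (simp add: image_subset_iff mem_Times_iff split_paired_all)
qed

lemma time_slice:
  assumes "W differentiable_on S \<times> J" "p \<in> S" "t \<in> J"
  shows "((\<lambda>s. W (p, s)) has_real_derivative time_deriv S J W (p, t)) (at t within J)"
proof -
  let ?D = "frechet_derivative W (at (p, t) within S \<times> J)"
  have "((\<lambda>s. (p, s)) has_derivative (\<lambda>v. (0, v))) (at t within J)"
    by (rule has_derivative_Pair[OF has_derivative_const has_derivative_ident])
  then have d: "((\<lambda>s. W (p, s)) has_derivative (\<lambda>v. ?D (0, v))) (at t within J)"
    using has_derivative_in_compose2[where t="S \<times> J" and s=J and g=W and f="\<lambda>s. (p, s)"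
      and g'="\<lambda>z. frechet_derivative W (at z within S \<times> J)", OF _ _ assms(3)]
      assms has_derivative_W[OF assms(1)] by (simp add: image_subset_iff mem_Times_iff split_paired_all)
  have "linear ?D" using has_derivative_W[OF assms] has_derivative_bounded_linear bounded_linear.linear by blast
  have "?D (0, v) = ?D (0, 1) * v" for v
    using linear_scale[OF \<open>linear ?D\<close>, of v "(0, 1)"]
    by (simp only: scaleR_Pair scaleR_zero_right real_scaleR_def mult_1_right mult_1_left mult.commute)
  then have "(\<lambda>v. ?D (0, v)) = (*) (?D (0, 1))" by (rule ext)
  then show ?thesis using d unfolding has_field_derivative_def time_deriv_def by simp
qed

lemma slice_differentiable_on:
  assumes "W differentiable_on S \<times> J" "t \<in> J"
  shows "(\<lambda>q. W (q, t)) differentiable_on S"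
  using space_slice[OF assms(1) _ assms(2)] unfolding differentiable_on_def differentiable_def by blast

lemma pd_slice:
  assumes "W differentiable_on S \<times> J" "p \<in> S" "t \<in> J"
  shows "pd S i (\<lambda>q. W (q, t)) p = space_deriv S J i W (p, t)"
  unfolding space_deriv_def by (rule pd_eq[OF orthant_open assms(2) space_slice[OF assms]])

text \<open>Symmetry of second derivatives on \<open>S \<times> J\<close>, which inherits the
  orthant property from its factors; it moves time derivatives past the spatial operators.\<close>

lemma space_time_commute:
  assumes W: "smooth_on (S \<times> J) W" and "p \<in> S" "t \<in> J"
  shows "space_deriv S J i (time_deriv S J W) (p, t) = time_deriv S J (space_deriv S J i W) (p, t)"
proof -
  have d: "V differentiable_on S \<times> J" if "smooth_on (S \<times> J) V" for V :: "(real^'n) \<times> real \<Rightarrow> real"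
    using that smooth_on_imp_differentiable_on by blast
  have "frechet_derivative (space_deriv S J i W) (at (p, t) within S \<times> J) (0, 1)
      = frechet_derivative (time_deriv S J W) (at (p, t) within S \<times> J) (axis i 1, 0)"
  proof (rule second_derivative_symmetric[OF orthant_open_SJ])
    show "(W has_derivative frechet_derivative W (at y within S \<times> J)) (at y within S \<times> J)" if "y \<in> S \<times> J" for y
      using has_derivative_W[OF d[OF W]] that by auto
    show "((\<lambda>y. frechet_derivative W (at y within S \<times> J) (axis i 1, 0)) has_derivative
        frechet_derivative (space_deriv S J i W) (at (p, t) within S \<times> J)) (at (p, t) within S \<times> J)"
      using has_derivative_W[OF d[OF smooth_on_space_deriv[OF W]] assms(2,3)]
      unfolding space_deriv_def .
    show "((\<lambda>y. frechet_derivative W (at y within S \<times> J) (0, 1)) has_derivative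
        frechet_derivative (time_deriv S J W) (at (p, t) within S \<times> J)) (at (p, t) within S \<times> J)"
      using has_derivative_W[OF d[OF smooth_on_time_deriv[OF W]] assms(2,3)]
      unfolding time_deriv_def .
  qed (use assms in \<open>auto simp: Basis_prod_def\<close>)
  then show ?thesis unfolding space_deriv_def time_deriv_def by simp
qed

end

subsection \<open>Positive semidefinite matrices\<close>

text \<open>\<open>matrix_inv\<close> is a choice, so some two-sided inverse must be exhibited: a
  trivial kernel gives a left inverse, which for a square matrix is also a right inverse.\<close>

lemma matrix_inv_both:
  fixes A :: "real^'n^'n"
  assumes "\<And>v. A *v v = 0 \<Longrightarrow> v = 0"
  shows "A ** matrix_inv A = mat 1" "matrix_inv A ** A = mat 1"
proof -
  obtain B where "B ** A = mat 1"
    using assms matrix_left_invertible_ker by blast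
  then have "A ** B = mat 1 \<and> B ** A = mat 1"
    using matrix_left_right_inverse by blast
  then have "A ** matrix_inv A = mat 1 \<and> matrix_inv A ** A = mat 1"
    unfolding matrix_inv_def by (rule someI)
  then show "A ** matrix_inv A = mat 1" "matrix_inv A ** A = mat 1" by auto
qed

text \<open>Cholesky elimination, one index at a time.\<close>

lemma psd_decomposition_on:
  fixes G :: "'n::finite \<Rightarrow> 'n \<Rightarrow> real"
  assumes "finite I" "\<And>i j. G i j = G j i" "\<And>i j. i \<notin> I \<Longrightarrow> G i j = 0"
    and "\<And>x. (\<Sum>i\<in>UNIV. \<Sum>j\<in>UNIV. G i j * x i * x j) \<ge> 0"
  shows "\<exists>w :: 'n \<Rightarrow> 'n \<Rightarrow> real. \<forall>i j. G i j = (\<Sum>a\<in>I. w a i * w a j)"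
  using assms
proof (induction I arbitrary: G)
  case empty
  then show ?case by auto
next
  case (insert k I)
  let ?q = "\<lambda>x. \<Sum>i\<in>UNIV. \<Sum>j\<in>UNIV. G i j * x i * x j"
  \<comment> \<open>Expansion of the form when coordinate \<open>k\<close> is shifted by
    \<open>s\<close>; the argument for a zero pivot and the completion of the square are both
    instances.\<close>
  have two: "?q (\<lambda>i. x i + s * (if i = k then 1 else 0)) = ?q x + 2 * s * (\<Sum>i\<in>UNIV. G k i * x i) + s\<^sup>2 * G k k" for x s
  proof -
    have "?q (\<lambda>i. x i + s * (if i = k then 1 else 0)) =
      (\<Sum>i\<in>UNIV. \<Sum>j\<in>UNIV. G i j * x i * x j + s * (if j = k then G i j * x i else 0)
        + s * (if i = k then G i j * x j else 0) + s\<^sup>2 * (if i = k then if j = k then G i j else 0 else 0))"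
      by (intro sum.cong refl) (auto simp: algebra_simps power2_eq_square)
    also have "\<dots> = ?q x + s * (\<Sum>i\<in>UNIV. G i k * x i) + s * (\<Sum>i\<in>UNIV. G k i * x i) + s\<^sup>2 * G k k"
    proof -
      have "(\<Sum>i\<in>UNIV. \<Sum>j\<in>UNIV. s * (if i = k then G i j * x j else 0)) = s * (\<Sum>i\<in>UNIV. G k i * x i)"
        by (subst sum.swap) (simp add: sum_distrib_left[symmetric])
      moreover have "(\<Sum>i\<in>UNIV. \<Sum>j\<in>UNIV. s * (if j = k then G i j * x i else 0)) = s * (\<Sum>i\<in>UNIV. G i k * x i)"
        by (simp add: sum_distrib_left[symmetric])
      moreover have "(\<Sum>i\<in>UNIV. \<Sum>j\<in>UNIV. s\<^sup>2 * (if i = k then if j = k then G i j else 0 else 0)) = s\<^sup>2 * G k k"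
        by (subst sum.swap) (simp add: sum_distrib_left[symmetric])
      ultimately show ?thesis by (simp only: sum.distrib)
    qed
    also have "(\<Sum>i\<in>UNIV. G i k * x i) = (\<Sum>i\<in>UNIV. G k i * x i)" using insert.prems(1) by simp
    finally show ?thesis by simp
  qed
  have kk: "G k k \<ge> 0"
    using insert.prems(3)[of "\<lambda>i. 0 + 1 * (if i = k then 1 else 0)"] unfolding two by simp
  show ?case
  proof (cases "G k k = 0")
    case True
    \<comment> \<open>With a zero pivot the form along the shift is affine in \<open>s\<close> with
      slope 2 G k i. Being nonnegative for all \<open>s\<close> it has slope zero; otherwise the
      \<open>s\<close> chosen below would give the value -1.\<close>
    have zero: "G k i = 0" for i
    proof (rule ccontr)
      assume n: "G k i \<noteq> 0"
      let ?x = "\<lambda>j. if j = i then 1 else (0::real)"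
      have e: "(\<Sum>j\<in>UNIV. G k j * ?x j) = G k i" by (simp add: if_distrib cong: if_cong)
      have "0 \<le> ?q ?x + 2 * s * G k i" for s
        using insert.prems(3)[of "\<lambda>j. ?x j + s * (if j = k then 1 else 0)"] unfolding two e by (simp add: True)
      from this[of "- (?q ?x + 1) / (2 * G k i)"] show False using n by (simp add: field_simps)
    qed
    have "\<exists>w :: 'n \<Rightarrow> 'n \<Rightarrow> real. \<forall>i j. G i j = (\<Sum>a\<in>I. w a i * w a j)"
    proof (rule insert.IH)
      show "G i j = 0" if "i \<notin> I" for i j
        using zero insert.prems(2) that by (cases "i = k") auto
    qed (fact insert.prems)+
    then obtain w where "\<forall>i j. G i j = (\<Sum>a\<in>I. w a i * w a j)" by blast
    then show ?thesis
      using insert.hyps by (intro exI[of _ "w(k := (\<lambda>_. 0))"]) (auto intro!: sum.cong)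
  next
    case False
    then have pos: "G k k > 0" using kk by simp
    \<comment> \<open>The Schur complement of the pivot. Its form at \<open>x\<close> is the minimum
      over \<open>s\<close> of \<open>?q\<close> at \<open>x\<close> shifted by \<open>s\<close> in
      coordinate \<open>k\<close>, hence again nonnegative.\<close>
    define G' where "G' i j = G i j - G k i * G k j / G k k" for i j
    have "\<exists>w :: 'n \<Rightarrow> 'n \<Rightarrow> real. \<forall>i j. G' i j = (\<Sum>a\<in>I. w a i * w a j)"
    proof (rule insert.IH)
      show "G' i j = G' j i" for i j unfolding G'_def using insert.prems(1)[of i j] by simp
      show "G' i j = 0" if "i \<notin> I" for i j
      proof (cases "i = k")
        case True then show ?thesis using pos by (simp add: G'_def)
      next
        case False
        then have "G i j = 0" "G i k = 0" using that insert.prems(2) by auto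
        then show ?thesis using insert.prems(1)[of i k] by (simp add: G'_def)
      qed
      show "(\<Sum>i\<in>UNIV. \<Sum>j\<in>UNIV. G' i j * x i * x j) \<ge> 0" for x
      proof -
        let ?L = "\<Sum>i\<in>UNIV. G k i * x i"
        have "(\<Sum>i\<in>UNIV. \<Sum>j\<in>UNIV. G' i j * x i * x j) = ?q x - ?L * ?L / G k k"
          unfolding sum_product sum_divide_distrib
          by (simp add: G'_def sum_subtractf[symmetric] algebra_simps)
        also have "\<dots> = ?q x + 2 * (- ?L / G k k) * ?L + (- ?L / G k k)\<^sup>2 * G k k"
          using pos by (simp add: field_simps power2_eq_square)
        also have "\<dots> \<ge> 0" unfolding two[symmetric] by (rule insert.prems(3))
        finally show ?thesis .
      qed
    qed
    then obtain w where w: "\<And>i j. G' i j = (\<Sum>a\<in>I. w a i * w a j)" by blast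
    have "G i j = (\<Sum>a\<in>insert k I. (w(k := (\<lambda>i. G k i / sqrt (G k k)))) a i * (w(k := (\<lambda>i. G k i / sqrt (G k k)))) a j)" for i j
    proof -
      have "G i j = G k i * G k j / G k k + G' i j" by (simp add: G'_def)
      also have "\<dots> = (G k i / sqrt (G k k)) * (G k j / sqrt (G k k)) + (\<Sum>a\<in>I. w a i * w a j)"
        using pos by (simp add: w field_simps)
      also have "(\<Sum>a\<in>I. w a i * w a j) = (\<Sum>a\<in>I. (w(k := (\<lambda>i. G k i / sqrt (G k k)))) a i * (w(k := (\<lambda>i. G k i / sqrt (G k k)))) a j)"
        using insert.hyps by (intro sum.cong) auto
      finally show ?thesis using insert.hyps by simp
    qed
    then show ?thesis by blast
  qed
qed

text \<open>The rows \<open>w a\<close> replace an orthonormal frame: they express the trace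
  inequality as a sum of squares and the second order part of the Laplacian as a sum of second
  derivatives along fixed directions.\<close>

lemma psd_decomposition:
  fixes G :: "'n::finite \<Rightarrow> 'n \<Rightarrow> real"
  assumes "\<And>i j. G i j = G j i"
    and "\<And>x. (\<Sum>i\<in>UNIV. \<Sum>j\<in>UNIV. G i j * x i * x j) \<ge> 0"
  obtains w :: "'n \<Rightarrow> 'n \<Rightarrow> real" where "\<And>i j. G i j = (\<Sum>a\<in>UNIV. w a i * w a j)"
proof -
  have "\<exists>w :: 'n \<Rightarrow> 'n \<Rightarrow> real. \<forall>i j. G i j = (\<Sum>a\<in>UNIV. w a i * w a j)"
    by (rule psd_decomposition_on) (use assms in simp_all)
  then show ?thesis using that by blast
qed

text \<open>Serves Cramer's rule, through which the inverse metric inherits differentiability from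
  the metric.\<close>

lemma det_differentiable_on:
  fixes A :: "'e::real_normed_vector \<Rightarrow> real^'n^'n"
  assumes "\<And>i j. (\<lambda>p. A p $ i $ j) differentiable_on S"
  shows "(\<lambda>p. det (A p)) differentiable_on S"
proof -
  have prod: "(\<lambda>p. \<Prod>i\<in>UNIV. A p $ i $ \<sigma> i) differentiable (at q within S)" if "q \<in> S" for \<sigma> q
  proof -
    have "((\<lambda>p. A p $ i $ \<sigma> i) has_derivative
        frechet_derivative (\<lambda>p. A p $ i $ \<sigma> i) (at q within S)) (at q within S)" for i
      using assms that by (simp add: differentiable_on_def frechet_derivative_works)
    then have "((\<lambda>p. \<Prod>i\<in>UNIV. A p $ i $ \<sigma> i) has_derivative
        (\<lambda>y. \<Sum>i\<in>UNIV. frechet_derivative (\<lambda>p. A p $ i $ \<sigma> i) (at q within S) y * (\<Prod>j\<in>UNIV - {i}. A q $ j $ \<sigma> j)))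
        (at q within S)"
      by (intro has_derivative_prod)
    then show ?thesis by (rule differentiableI)
  qed
  show ?thesis
    unfolding det_def differentiable_on_def
    by (intro ballI differentiable_sum finite_permutations finite differentiable_mult prod differentiable_const)
qed

text \<open>The Cauchy--Schwarz inequality for the inner product of symmetric bilinear forms induced by
  \<open>G\<close>, applied to \<open>H\<close> and the metric \<open>g\<close>.\<close>

lemma trace_square_le:
  fixes G g H :: "'n::finite \<Rightarrow> 'n \<Rightarrow> real"
  assumes G: "\<And>i j. G i j = G j i" "\<And>x. (\<Sum>i\<in>UNIV. \<Sum>j\<in>UNIV. G i j * x i * x j) \<ge> 0"
    and inv: "\<And>i k. (\<Sum>j\<in>UNIV. G i j * g j k) = (if i = k then 1 else 0)"
    and H: "\<And>i j. H i j = H j i" "\<And>i j. g i j = g j i"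
  defines "N \<equiv> \<lambda>i k. \<Sum>j\<in>UNIV. G i j * H j k"
  shows "(\<Sum>i\<in>UNIV. N i i)\<^sup>2 \<le> real CARD('n) * (\<Sum>i\<in>UNIV. \<Sum>k\<in>UNIV. N i k * N k i)"
proof -
  obtain w :: "'n \<Rightarrow> 'n \<Rightarrow> real" where w: "\<And>i j. G i j = (\<Sum>a\<in>UNIV. w a i * w a j)"
    using psd_decomposition[of G] G by metis
  \<comment> \<open>The trace of \<open>N\<close> divided by the dimension, so that \<open>T\<close>
    is the trace-free part of \<open>H\<close>; the claim says that the squared norm of
    \<open>T\<close> is nonnegative.\<close>
  define l where "l = (\<Sum>i\<in>UNIV. N i i) / real CARD('n)"
  define T where "T i j = H i j - l * g i j" for i j
  define P where "P i k = (\<Sum>j\<in>UNIV. G i j * T j k)" for i k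
  have P: "P i k = N i k - l * (if i = k then 1 else 0)" for i k
    unfolding P_def N_def T_def inv[symmetric] by (simp add: algebra_simps sum_subtractf sum_distrib_left)
  have T: "T i j = T j i" for i j unfolding T_def using H by metis
  define y where "y a k = (\<Sum>j\<in>UNIV. w a j * T j k)" for a k
  \<comment> \<open>\<open>X\<close> is the form \<open>T\<close> evaluated on the vectors
    \<open>w a\<close> and \<open>w b\<close>. By the factorisation of \<open>G\<close> the trace of
    the square of \<open>P\<close> equals that of the square of \<open>X\<close>, and the symmetry
    of \<open>X\<close> makes this a sum of squares.\<close>
  define X where "X a b = (\<Sum>k\<in>UNIV. y a k * w b k)" for a b
  have Py: "P i k = (\<Sum>a\<in>UNIV. w a i * y a k)" for i k
    unfolding P_def w y_def sum_distrib_right sum_distrib_left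
    by (subst sum.swap) (simp add: mult_ac)
  have Xs: "X a b = X b a" for a b
  proof -
    have "X a b = (\<Sum>k\<in>UNIV. \<Sum>j\<in>UNIV. w a j * T j k * w b k)"
      unfolding X_def y_def sum_distrib_right ..
    also have "\<dots> = (\<Sum>j\<in>UNIV. \<Sum>k\<in>UNIV. w a j * T j k * w b k)" by (rule sum.swap)
    also have "\<dots> = X b a"
      unfolding X_def y_def sum_distrib_right by (intro sum.cong refl) (simp add: T mult_ac)
    finally show ?thesis .
  qed
  have sw: "(\<Sum>x\<in>UNIV. \<Sum>a\<in>UNIV. \<Sum>b\<in>UNIV. f x a b) = (\<Sum>a\<in>UNIV. \<Sum>b\<in>UNIV. \<Sum>x\<in>UNIV. f x a b)"
    for f :: "'n \<Rightarrow> 'n \<Rightarrow> 'n \<Rightarrow> real"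
    by (subst sum.swap) (rule sum.cong[OF refl], rule sum.swap)
  have "(\<Sum>i\<in>UNIV. \<Sum>k\<in>UNIV. P i k * P k i)
      = (\<Sum>i\<in>UNIV. \<Sum>k\<in>UNIV. \<Sum>a\<in>UNIV. \<Sum>b\<in>UNIV. (w a i * y a k) * (w b k * y b i))"
    unfolding Py sum_product ..
  also have "\<dots> = (\<Sum>a\<in>UNIV. \<Sum>b\<in>UNIV. \<Sum>i\<in>UNIV. \<Sum>k\<in>UNIV. (w a i * y a k) * (w b k * y b i))"
    by (rule trans[OF sum.cong[OF refl sw] sw])
  also have "\<dots> = (\<Sum>a\<in>UNIV. \<Sum>b\<in>UNIV. X b a * X a b)"
    unfolding X_def sum_product by (intro sum.cong refl) (simp add: mult_ac)
  also have "\<dots> = (\<Sum>a\<in>UNIV. \<Sum>b\<in>UNIV. (X a b)\<^sup>2)"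
    by (intro sum.cong refl) (simp add: Xs power2_eq_square)
  also have "\<dots> \<ge> 0" by (intro sum_nonneg) auto
  finally have "0 \<le> (\<Sum>i\<in>UNIV. \<Sum>k\<in>UNIV. P i k * P k i)" .
  also have "\<dots> = (\<Sum>i\<in>UNIV. \<Sum>k\<in>UNIV. N i k * N k i - (if i = k then 2 * l * N i i - l\<^sup>2 else 0))"
    unfolding P by (intro sum.cong refl) (auto simp: algebra_simps power2_eq_square)
  also have "\<dots> = (\<Sum>i\<in>UNIV. \<Sum>k\<in>UNIV. N i k * N k i) - 2 * l * (\<Sum>i\<in>UNIV. N i i) + real CARD('n) * l\<^sup>2"
    by (simp add: sum_subtractf sum_distrib_left)
  also have "\<dots> = (\<Sum>i\<in>UNIV. \<Sum>k\<in>UNIV. N i k * N k i) - (\<Sum>i\<in>UNIV. N i i)\<^sup>2 / real CARD('n)"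
    by (simp add: l_def power2_eq_square field_simps)
  finally show ?thesis by (simp add: divide_le_eq mult.commute)
qed

subsection \<open>The metric in a chart\<close>

locale riem_chart =
  fixes M :: "('a, 'n::finite) riem" and c :: "('a, 'n) chart"
  assumes riem: "riemannian_manifold M" and in_atlas: "c \<in> atlas M"
begin

abbreviation "S \<equiv> cimg c"
abbreviation g :: "'n \<Rightarrow> 'n \<Rightarrow> real^'n \<Rightarrow> real" where "g i j p \<equiv> metric M c p $ i $ j"
abbreviation G :: "'n \<Rightarrow> 'n \<Rightarrow> real^'n \<Rightarrow> real" where "G i j p \<equiv> ginv M c p $ i $ j"
abbreviation \<Gamma> :: "'n \<Rightarrow> 'n \<Rightarrow> 'n \<Rightarrow> real^'n \<Rightarrow> real" where "\<Gamma> \<equiv> christoffel M c"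
abbreviation D :: "'n \<Rightarrow> (real^'n \<Rightarrow> real) \<Rightarrow> real^'n \<Rightarrow> real" where "D \<equiv> pd (cimg c)"

lemma cimg_cases: "open S \<or> openin (top_of_set {p. 0 \<le> p $ bidx M}) S"
  using riem in_atlas unfolding riemannian_manifold_def smooth_manifold_with_boundary_def by blast

text \<open>Displacements in the positive orthant cannot decrease the coordinate
  \<open>bidx M\<close>, so they never leave the half-space of a boundary chart.\<close>

lemma orthant_open_cimg: "orthant_open S"
proof -
  consider "open S" | T where "open T" "S = {p. 0 \<le> p $ bidx M} \<inter> T"
    using cimg_cases unfolding openin_open by blast
  then show ?thesis
    by cases (auto intro: open_imp_orthant_open orthant_open_Int orthant_open_halfspace)
qed

sublocale one_sided_domain S
  by unfold_locales (rule orthant_open_cimg)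

lemma smooth_on_g: "smooth_on S (g i j)"
proof -
  have "smooth_on S (metric M c)"
    using riem in_atlas unfolding riemannian_manifold_def by blast
  moreover have "bounded_linear (\<lambda>A::real^'n^'n. A $ i $ j)"
    by (rule bounded_linear_compose[OF bounded_linear_vec_nth bounded_linear_vec_nth])
  ultimately show ?thesis using smooth_on_bounded_linear[OF orthant_open] by blast
qed

lemma g_differentiable: "g i j differentiable_on S" "D k (g i j) differentiable_on S"
  using smooth_on_g smooth_on_pd smooth_on_imp_differentiable_on by blast+

lemma metric_symmetric: "p \<in> S \<Longrightarrow> transpose (metric M c p) = metric M c p"
  and metric_pos: "p \<in> S \<Longrightarrow> v \<noteq> 0 \<Longrightarrow> v \<bullet> (metric M c p *v v) > 0"
  using riem in_atlas unfolding riemannian_manifold_def by blast+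

lemma g_sym: "p \<in> S \<Longrightarrow> g i j p = g j i p"
  using metric_symmetric[of p] by (metis transpose_def vec_lambda_beta)

lemma metric_mult_ginv: "p \<in> S \<Longrightarrow> metric M c p ** ginv M c p = mat 1"
  and ginv_mult_metric: "p \<in> S \<Longrightarrow> ginv M c p ** metric M c p = mat 1"
  unfolding ginv_def using metric_pos[of p]
  by (metis inner_zero_right less_irrefl matrix_inv_both(1), metis inner_zero_right less_irrefl matrix_inv_both(2))

lemma G_g: "p \<in> S \<Longrightarrow> (\<Sum>j\<in>UNIV. G i j p * g j k p) = (if i = k then 1 else 0)"
  using arg_cong[OF ginv_mult_metric, of p "\<lambda>A. A $ i $ k"] by (simp add: matrix_matrix_mult_def mat_def)

lemma g_G: "p \<in> S \<Longrightarrow> (\<Sum>j\<in>UNIV. g i j p * G j k p) = (if i = k then 1 else 0)"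
  using arg_cong[OF metric_mult_ginv, of p "\<lambda>A. A $ i $ k"] by (simp add: matrix_matrix_mult_def mat_def)

lemma ginv_symmetric: assumes "p \<in> S" shows "transpose (ginv M c p) = ginv M c p"
proof -
  have "transpose (ginv M c p) ** metric M c p = transpose (metric M c p ** ginv M c p)"
    by (simp add: matrix_transpose_mul metric_symmetric[OF assms])
  also have "\<dots> = mat 1" by (simp add: metric_mult_ginv[OF assms])
  finally have "transpose (ginv M c p) ** metric M c p ** ginv M c p = ginv M c p" by simp
  then show ?thesis by (simp add: matrix_mul_assoc[symmetric] metric_mult_ginv[OF assms])
qed

lemma G_sym: "p \<in> S \<Longrightarrow> G i j p = G j i p"
  using ginv_symmetric[of p] by (metis transpose_def vec_lambda_beta)

lemma metric_ginv_vec: "p \<in> S \<Longrightarrow> metric M c p *v (ginv M c p *v x) = x"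
  and ginv_metric_vec: "p \<in> S \<Longrightarrow> ginv M c p *v (metric M c p *v x) = x"
  by (simp_all add: matrix_vector_mul_assoc metric_mult_ginv ginv_mult_metric)

lemma ginv_pos: assumes "p \<in> S" "x \<noteq> 0" shows "x \<bullet> (ginv M c p *v x) > 0"
proof -
  let ?y = "ginv M c p *v x"
  have "?y \<noteq> 0" using assms metric_ginv_vec[OF assms(1), of x] by auto
  then have "?y \<bullet> (metric M c p *v ?y) > 0" by (rule metric_pos[OF assms(1)])
  then show ?thesis by (simp add: metric_ginv_vec[OF assms(1)] inner_commute)
qed

lemma quadratic_form_sum: "x \<bullet> (A *v y) = (\<Sum>i\<in>UNIV. \<Sum>j\<in>UNIV. A $ i $ j * x $ i * y $ j)"
  for x y :: "real^'n" and A :: "real^'n^'n"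
  by (simp add: inner_vec_def matrix_vector_mult_def sum_distrib_left mult_ac)

lemma G_psd: assumes "p \<in> S" shows "(\<Sum>i\<in>UNIV. \<Sum>j\<in>UNIV. G i j p * x i * x j) \<ge> 0"
  using ginv_pos[OF assms, of "\<chi> i. x i"] quadratic_form_sum[of "\<chi> i. x i" "ginv M c p" "\<chi> i. x i"]
  by (cases "(\<chi> i. x i) = 0") (auto simp: vec_eq_iff)

lemma G_diag_pos: assumes "p \<in> S" shows "G i i p > 0"
  using ginv_pos[OF assms, of "axis i 1"]
  by (simp add: inner_axis' matrix_vector_mult_basis column_def axis_eq_0_iff)

text \<open>Cramer's rule writes each entry as a quotient of determinants in the entries of the
  metric. First derivatives are enough: below, derivatives of \<open>G\<close> are replaced by
  Christoffel symbols before differentiating again.\<close>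

lemma G_differentiable: "G i k differentiable_on S"
proof (rule differentiable_on_cong)
  let ?N = "\<lambda>p. det (\<chi> a b. if b = i then axis k 1 $ a else g a b p)"
  let ?D = "\<lambda>p. det (metric M c p)"
  have D0: "?D p \<noteq> 0" if "p \<in> S" for p
    using metric_mult_ginv[OF that] invertible_det_nz ginv_mult_metric[OF that] invertible_def by blast
  have "?N differentiable_on S"
  proof (rule det_differentiable_on)
    show "(\<lambda>p. (\<chi> a b. if b = i then axis k 1 $ a else g a b p) $ a $ b) differentiable_on S" for a b
      by (cases "b = i") (simp_all add: g_differentiable)
  qed
  moreover have "?D differentiable_on S"
    by (rule det_differentiable_on) (rule g_differentiable)
  ultimately show "(\<lambda>p. ?N p / ?D p) differentiable_on S"
    using D0 by (simp add: differentiable_on_def)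
  fix p assume p: "p \<in> S"
  have "metric M c p *v (ginv M c p *v axis k 1) = axis k 1"
    by (rule metric_ginv_vec[OF p])
  then have "ginv M c p *v axis k 1 = (\<chi> i. det (\<chi> a b. if b = i then axis k 1 $ a else g a b p) / ?D p)"
    using cramer[OF D0[OF p]] by blast
  then have "(ginv M c p *v axis k 1) $ i = ?N p / ?D p" by simp
  then show "?N p / ?D p = G i k p" by (simp add: matrix_vector_mult_basis column_def)
qed

lemma christoffel_sym: assumes "p \<in> S" shows "\<Gamma> l i j p = \<Gamma> l j i p"
proof -
  have "D r (g i j) p = D r (g j i) p" for r
    by (rule pd_cong[OF g_sym assms])
  then show ?thesis unfolding christoffel_def by (simp add: algebra_simps)
qed

lemma christoffel_differentiable: "\<Gamma> l i j differentiable_on S"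
proof -
  have "(\<lambda>p. (1/2) * (\<Sum>r\<in>UNIV. G l r p * (D i (g j r) p + D j (g i r) p - D r (g i j) p))) differentiable_on S"
    by (intro differentiable_on_mult differentiable_on_const differentiable_on_sum
        differentiable_on_add differentiable_on_diff G_differentiable g_differentiable)
  then show ?thesis by (rule differentiable_on_cong) (simp add: christoffel_def)
qed

lemma christoffel_lower:
  assumes "p \<in> S"
  shows "(\<Sum>l\<in>UNIV. g r l p * \<Gamma> l i j p) = (D i (g j r) p + D j (g i r) p - D r (g i j) p) / 2"
proof -
  let ?E = "\<lambda>s. D i (g j s) p + D j (g i s) p - D s (g i j) p"
  have "(\<Sum>l\<in>UNIV. g r l p * \<Gamma> l i j p) = (\<Sum>l\<in>UNIV. \<Sum>s\<in>UNIV. (g r l p * G l s p) * (?E s / 2))"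
    unfolding christoffel_def by (simp add: sum_distrib_left mult_ac)
  also have "\<dots> = (\<Sum>s\<in>UNIV. (\<Sum>l\<in>UNIV. g r l p * G l s p) * (?E s / 2))"
    by (subst sum.swap) (simp only: sum_distrib_right)
  also have "\<dots> = (\<Sum>s\<in>UNIV. if s = r then ?E s / 2 else 0)"
    by (intro sum.cong refl) (simp add: g_G[OF assms])
  finally show ?thesis by simp
qed

text \<open>After contraction both Christoffel terms are symbols of the first kind, and in their sum
  all derivatives cancel except those in direction \<open>k\<close>.\<close>

lemma metric_compatible:
  assumes "p \<in> S"
  shows "D k (g i j) p = (\<Sum>l\<in>UNIV. \<Gamma> l k i p * g l j p + \<Gamma> l k j p * g i l p)"
proof -
  have s: "D r (g a b) p = D r (g b a) p" for r a b
    by (rule pd_cong[OF g_sym assms])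
  have "(\<Sum>l\<in>UNIV. \<Gamma> l k i p * g l j p + \<Gamma> l k j p * g i l p)
      = (\<Sum>l\<in>UNIV. g j l p * \<Gamma> l k i p) + (\<Sum>l\<in>UNIV. g i l p * \<Gamma> l k j p)"
    unfolding sum.distrib[symmetric] using g_sym[OF assms] by (intro sum.cong refl) (simp add: mult.commute)
  also have "\<dots> = D k (g i j) p"
    unfolding christoffel_lower[OF assms] using s[of k i j] s[of i k j] s[of j k i] by (simp add: field_simps)
  finally show ?thesis by simp
qed

text \<open>The inverse metric is parallel as well. In matrix form, differentiating G g = 1 gives dG
  = - G dg G, and inserting dg = transpose A g + g A leaves two products.\<close>

lemma ginv_compatible:
  assumes p: "p \<in> S"
  shows "D k (G i j) p = - (\<Sum>l\<in>UNIV. \<Gamma> i k l p * G l j p + \<Gamma> j k l p * G i l p)"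
proof -
  define A where "A = (\<chi> l m. \<Gamma> l k m p)"
  define dG where "dG = (\<chi> i j. D k (G i j) p)"
  define dg where "dg = (\<chi> i j. D k (g i j) p)"
  let ?g = "metric M c p" and ?G = "ginv M c p"
  have dg: "dg = transpose A ** ?g + ?g ** A"
    unfolding dg_def A_def vec_eq_iff
    by (simp add: matrix_matrix_mult_def transpose_def metric_compatible[OF p] sum.distrib mult_ac)
  have "dG ** ?g + ?G ** dg = 0"
  proof -
    have "(\<Sum>l\<in>UNIV. D k (G i l) p * g l j p + G i l p * D k (g l j) p) = 0" for i j
    proof -
      have "(\<Sum>l\<in>UNIV. D k (G i l) p * g l j p + G i l p * D k (g l j) p)
          = D k (\<lambda>q. \<Sum>l\<in>UNIV. G i l q * g l j q) p"
        by (simp add: pd_sum[OF differentiable_on_mult[OF G_differentiable g_differentiable(1)] p]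
            pd_mult[OF G_differentiable g_differentiable(1) p])
      also have "\<dots> = D k (\<lambda>q. if i = j then 1 else 0) p"
        by (rule pd_cong[OF G_g p])
      finally show ?thesis by (simp add: pd_const[OF p])
    qed
    then show ?thesis unfolding dG_def dg_def vec_eq_iff
      by (simp add: matrix_matrix_mult_def sum.distrib)
  qed
  then have e: "dG ** ?g = - (?G ** dg)" by (simp add: add_eq_0_iff2)
  have "dG = (dG ** ?g) ** ?G"
    by (simp add: matrix_mul_assoc[symmetric] metric_mult_ginv[OF p])
  also have "\<dots> = - ((?G ** transpose A ** ?g + ?G ** ?g ** A) ** ?G)"
  proof -
    have neg: "(- X) ** Y = - (X ** Y)" for X Y :: "real^'n^'n"
      by (simp add: vec_eq_iff matrix_matrix_mult_def sum_negf)
    show ?thesis unfolding e dg neg matrix_add_ldistrib matrix_mul_assoc ..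
  qed
  also have "\<dots> = - (?G ** transpose A + A ** ?G)"
  proof -
    have "(X + Y) ** Z = X ** Z + Y ** Z" for X Y Z :: "real^'n^'n"
      by (simp add: vec_eq_iff matrix_matrix_mult_def distrib_right sum.distrib)
    then show ?thesis
      by (simp add: ginv_mult_metric[OF p]) (simp add: matrix_mul_assoc[symmetric] metric_mult_ginv[OF p])
  qed
  finally have "dG $ i $ j = - ((?G ** transpose A) $ i $ j + (A ** ?G) $ i $ j)" by simp
  then show ?thesis
    by (simp add: dG_def A_def matrix_matrix_mult_def transpose_def sum.distrib mult_ac)
qed

subsection \<open>The Bochner inequality\<close>

text \<open>\<open>gradv\<close>, \<open>hess\<close>, \<open>normsq\<close> and \<open>lap\<close>
  act on functions of the coordinates. The operators on manifold functions reduce to them by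
  \<open>gradient_norm2_eq\<close> and \<open>laplacianV_eq\<close>.\<close>

definition gradv :: "(real^'n \<Rightarrow> real) \<Rightarrow> 'n \<Rightarrow> real^'n \<Rightarrow> real" where
  "gradv f l p = (\<Sum>j\<in>UNIV. G l j p * D j f p)"

definition hess :: "(real^'n \<Rightarrow> real) \<Rightarrow> 'n \<Rightarrow> 'n \<Rightarrow> real^'n \<Rightarrow> real" where
  "hess f i j p = D i (D j f) p - (\<Sum>l\<in>UNIV. \<Gamma> l i j p * D l f p)"

text \<open>\<open>hessup f k l\<close> has lower index \<open>k\<close> and upper index \<open>l\<close>.\<close>

definition hessup :: "(real^'n \<Rightarrow> real) \<Rightarrow> 'n \<Rightarrow> 'n \<Rightarrow> real^'n \<Rightarrow> real" where
  "hessup f k l p = (\<Sum>j\<in>UNIV. G l j p * hess f k j p)"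

definition normsq :: "(real^'n \<Rightarrow> real) \<Rightarrow> real^'n \<Rightarrow> real" where
  "normsq f p = (\<Sum>l\<in>UNIV. gradv f l p * D l f p)"

definition lap :: "(real^'n \<Rightarrow> real) \<Rightarrow> real^'n \<Rightarrow> real" where
  "lap f p = (\<Sum>i\<in>UNIV. \<Sum>j\<in>UNIV. G i j p * hess f i j p)"

text \<open>\<open>diff1\<close> is the regularity under which the Hessian exists and is symmetric;
  \<open>diff2\<close> adds the third derivatives that enter the Bochner formula.\<close>

definition diff1 :: "(real^'n \<Rightarrow> real) \<Rightarrow> bool" where
  "diff1 f \<longleftrightarrow> f differentiable_on S \<and> (\<forall>i. D i f differentiable_on S)"

definition diff2 :: "(real^'n \<Rightarrow> real) \<Rightarrow> bool" where
  "diff2 f \<longleftrightarrow> diff1 f \<and> (\<forall>i j. D i (D j f) differentiable_on S)"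

lemma diff1D: "diff1 f \<Longrightarrow> f differentiable_on S" "diff1 f \<Longrightarrow> D i f differentiable_on S"
  unfolding diff1_def by auto

lemma diff2D: "diff2 f \<Longrightarrow> f differentiable_on S" "diff2 f \<Longrightarrow> D i f differentiable_on S"
    "diff2 f \<Longrightarrow> D i (D j f) differentiable_on S" "diff2 f \<Longrightarrow> diff1 f"
  unfolding diff1_def diff2_def by auto

lemmas chart_diff = differentiable_on_mult differentiable_on_add differentiable_on_diff
  differentiable_on_sum differentiable_on_const G_differentiable christoffel_differentiable g_differentiable

lemma gradv_differentiable: assumes "diff1 f" shows "gradv f l differentiable_on S"
proof (rule differentiable_on_cong)
  show "(\<lambda>p. \<Sum>j\<in>UNIV. G l j p * D j f p) differentiable_on S"
    by (intro chart_diff diff1D(2)[OF assms])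
qed (simp add: gradv_def)

lemma hess_differentiable: assumes "diff2 f" shows "hess f i j differentiable_on S"
proof (rule differentiable_on_cong)
  show "(\<lambda>p. D i (D j f) p - (\<Sum>l\<in>UNIV. \<Gamma> l i j p * D l f p)) differentiable_on S"
    by (intro chart_diff diff2D(2,3)[OF assms])
qed (simp add: hess_def)

lemma hessup_differentiable: assumes "diff2 f" shows "hessup f i j differentiable_on S"
proof (rule differentiable_on_cong)
  show "(\<lambda>p. \<Sum>k\<in>UNIV. G j k p * hess f i k p) differentiable_on S"
    by (intro chart_diff hess_differentiable[OF assms])
qed (simp add: hessup_def)

lemma hess_sym: "diff1 f \<Longrightarrow> p \<in> S \<Longrightarrow> hess f i j p = hess f j i p"
  unfolding hess_def using pd_commute[of f i j p] christoffel_sym[of p _ i j] by (simp add: diff1D)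

text \<open>Differentiating the inverse metric produces two Christoffel terms: one completes the
  second derivatives to \<open>hess\<close>, the other is the correction in the covariant derivative
  of the vector field \<open>gradv f\<close>.\<close>

lemma pd_gradv:
  assumes f: "diff1 f" and p: "p \<in> S"
  shows "D k (gradv f l) p = hessup f k l p - (\<Sum>s\<in>UNIV. \<Gamma> l k s p * gradv f s p)"
proof -
  have 1: "D k (G l j) p * D j f p = - (\<Sum>s\<in>UNIV. \<Gamma> l k s p * G s j p * D j f p)
      - (\<Sum>s\<in>UNIV. \<Gamma> j k s p * G l s p * D j f p)" for j
    by (simp add: ginv_compatible[OF p] sum.distrib sum_distrib_right distrib_right left_diff_distrib)
  have "D k (gradv f l) p = (\<Sum>j\<in>UNIV. D k (G l j) p * D j f p + G l j p * D k (D j f) p)"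
    unfolding gradv_def by (rule pd_sum_mult[OF G_differentiable diff1D(2)[OF f] p])
  also have "\<dots> = (\<Sum>j\<in>UNIV. G l j p * D k (D j f) p)
      - (\<Sum>j\<in>UNIV. \<Sum>s\<in>UNIV. \<Gamma> l k s p * G s j p * D j f p)
      - (\<Sum>j\<in>UNIV. \<Sum>s\<in>UNIV. \<Gamma> j k s p * G l s p * D j f p)"
    by (simp add: 1 sum.distrib sum_negf sum_subtractf)
  also have "(\<Sum>j\<in>UNIV. \<Sum>s\<in>UNIV. \<Gamma> l k s p * G s j p * D j f p) = (\<Sum>s\<in>UNIV. \<Gamma> l k s p * gradv f s p)"
    unfolding gradv_def by (subst sum.swap) (simp add: sum_distrib_left mult_ac)
  also have "(\<Sum>j\<in>UNIV. \<Sum>s\<in>UNIV. \<Gamma> j k s p * G l s p * D j f p)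
      = (\<Sum>s\<in>UNIV. G l s p * (\<Sum>j\<in>UNIV. \<Gamma> j k s p * D j f p))"
    by (subst sum.swap) (simp add: sum_distrib_left mult_ac)
  finally show ?thesis
    unfolding hessup_def hess_def by (simp add: right_diff_distrib sum_subtractf)
qed

lemma normsq_differentiable: assumes "diff1 f" shows "normsq f differentiable_on S"
proof (rule differentiable_on_cong)
  show "(\<lambda>p. \<Sum>l\<in>UNIV. gradv f l p * D l f p) differentiable_on S"
    by (intro chart_diff gradv_differentiable[OF assms] diff1D(2)[OF assms])
qed (simp add: normsq_def)

lemma hessup_contract:
  assumes p: "p \<in> S"
  shows "(\<Sum>l\<in>UNIV. hessup f k l p * D l f p) = (\<Sum>j\<in>UNIV. hess f k j p * gradv f j p)"
proof -
  have "(\<Sum>l\<in>UNIV. hessup f k l p * D l f p) = (\<Sum>l\<in>UNIV. \<Sum>j\<in>UNIV. hess f k j p * (G j l p * D l f p))"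
    unfolding hessup_def sum_distrib_right
    by (intro sum.cong refl) (simp add: G_sym[OF p] mult_ac)
  also have "\<dots> = (\<Sum>j\<in>UNIV. hess f k j p * gradv f j p)"
    by (subst sum.swap) (simp add: gradv_def sum_distrib_left)
  finally show ?thesis .
qed

text \<open>The Christoffel correction coming from \<open>gradv f\<close> turns the second
  derivatives of the other factor into a second copy of the Hessian term, whence the factor
  2.\<close>

lemma pd_normsq:
  assumes f: "diff1 f" and p: "p \<in> S"
  shows "D k (normsq f) p = 2 * (\<Sum>l\<in>UNIV. hessup f k l p * D l f p)"
proof -
  have "D k (normsq f) p = (\<Sum>l\<in>UNIV. D k (gradv f l) p * D l f p + gradv f l p * D k (D l f) p)"
    unfolding normsq_def by (rule pd_sum_mult[OF gradv_differentiable[OF f] diff1D(2)[OF f] p])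
  also have "\<dots> = (\<Sum>l\<in>UNIV. hessup f k l p * D l f p) + (\<Sum>l\<in>UNIV. D k (D l f) p * gradv f l p)
      - (\<Sum>l\<in>UNIV. \<Sum>s\<in>UNIV. \<Gamma> l k s p * gradv f s p * D l f p)"
    by (simp add: pd_gradv[OF f p] left_diff_distrib sum.distrib sum_subtractf sum_distrib_right mult.commute[of _ "gradv f _ p"])
  also have "(\<Sum>l\<in>UNIV. \<Sum>s\<in>UNIV. \<Gamma> l k s p * gradv f s p * D l f p)
      = (\<Sum>s\<in>UNIV. (\<Sum>l\<in>UNIV. \<Gamma> l k s p * D l f p) * gradv f s p)"
    by (subst sum.swap) (simp add: sum_distrib_left sum_distrib_right mult_ac)
  also have "(\<Sum>l\<in>UNIV. hessup f k l p * D l f p) + (\<Sum>l\<in>UNIV. D k (D l f) p * gradv f l p) -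
      (\<Sum>s\<in>UNIV. (\<Sum>l\<in>UNIV. \<Gamma> l k s p * D l f p) * gradv f s p)
      = (\<Sum>l\<in>UNIV. hessup f k l p * D l f p) + (\<Sum>j\<in>UNIV. hess f k j p * gradv f j p)"
    unfolding hess_def by (simp add: left_diff_distrib sum_subtractf)
  finally show ?thesis unfolding hessup_contract[OF p, symmetric] by simp
qed

lemma lap_eq_trace: "lap f p = (\<Sum>l\<in>UNIV. hessup f l l p)"
  unfolding lap_def hessup_def ..

lemma lap_differentiable: "diff2 f \<Longrightarrow> lap f differentiable_on S"
  by (rule differentiable_on_cong[of "\<lambda>p. \<Sum>l\<in>UNIV. hessup f l l p"])
     (auto simp: lap_eq_trace intro!: differentiable_on_sum hessup_differentiable)

lemma hessup_eq: "diff1 f \<Longrightarrow> p \<in> S \<Longrightarrow> hessup f k l p = D k (gradv f l) p + (\<Sum>s\<in>UNIV. \<Gamma> l k s p * gradv f s p)"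
  by (simp add: pd_gradv)

lemma pd_gradv_differentiable:
  assumes f: "diff2 f" shows "D k (gradv f l) differentiable_on S"
proof (rule differentiable_on_cong)
  show "(\<lambda>p. hessup f k l p - (\<Sum>s\<in>UNIV. \<Gamma> l k s p * gradv f s p)) differentiable_on S"
    by (intro chart_diff hessup_differentiable[OF f] gradv_differentiable[OF diff2D(4)[OF f]])
qed (simp add: pd_gradv[OF diff2D(4)[OF f]])

text \<open>Reading \<open>hessup\<close> as the covariant derivative of \<open>gradv f\<close>
  brings out the derivatives of Christoffel symbols of which \<open>riemann\<close> is made.\<close>

lemma pd_hessup:
  assumes f: "diff2 f" and p: "p \<in> S"
  shows "D i (hessup f k l) p = D i (D k (gradv f l)) p
    + (\<Sum>s\<in>UNIV. D i (\<Gamma> l k s) p * gradv f s p + \<Gamma> l k s p * D i (gradv f s) p)"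
proof -
  have "D i (hessup f k l) p = D i (\<lambda>q. D k (gradv f l) q + (\<Sum>s\<in>UNIV. \<Gamma> l k s q * gradv f s q)) p"
    by (rule pd_cong[OF hessup_eq[OF diff2D(4)[OF f]] p])
  also have "\<dots> = D i (D k (gradv f l)) p + D i (\<lambda>q. (\<Sum>s\<in>UNIV. \<Gamma> l k s q * gradv f s q)) p"
    by (intro pd_add p chart_diff pd_gradv_differentiable[OF f] gradv_differentiable[OF diff2D(4)[OF f]])
  also have "D i (\<lambda>q. (\<Sum>s\<in>UNIV. \<Gamma> l k s q * gradv f s q)) p
    = (\<Sum>s\<in>UNIV. D i (\<Gamma> l k s) p * gradv f s p + \<Gamma> l k s p * D i (gradv f s) p)"
    by (rule pd_sum_mult[OF christoffel_differentiable gradv_differentiable[OF diff2D(4)[OF f]] p])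
  finally show ?thesis .
qed

text \<open>The contracted Ricci identity for the vector field \<open>gradv f\<close>; no lowering of the curvature
  tensor is needed in this form.\<close>

lemma divergence_hessup:
  assumes f: "diff2 f" and p: "p \<in> S"
  shows "(\<Sum>l\<in>UNIV. D l (hessup f i l) p - (\<Sum>s\<in>UNIV. \<Gamma> s l i p * hessup f s l p)
            + (\<Sum>s\<in>UNIV. \<Gamma> l l s p * hessup f i s p))
    = D i (lap f) p + (\<Sum>s\<in>UNIV. ricci M c p $ i $ s * gradv f s p)"
proof -
  let ?v = "\<lambda>s. gradv f s p"
  have f1: "diff1 f" using f diff2D by blast
  have lap: "D i (lap f) p = (\<Sum>l\<in>UNIV. D i (hessup f l l) p)"
    unfolding lap_eq_trace by (rule pd_sum[OF hessup_differentiable[OF f] p])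
  have comm: "D l (D i (gradv f l)) p = D i (D l (gradv f l)) p" for l
    by (rule pd_commute[OF gradv_differentiable[OF f1] pd_gradv_differentiable[OF f] pd_gradv_differentiable[OF f] p])
  have 1: "(\<Sum>l\<in>UNIV. \<Sum>s\<in>UNIV. \<Gamma> l i s p * D l (gradv f s) p) = (\<Sum>l\<in>UNIV. \<Sum>s\<in>UNIV. \<Gamma> s l i p * D s (gradv f l) p)"
    by (subst sum.swap) (simp add: christoffel_sym[OF p, of _ i])
  have 2: "(\<Sum>l\<in>UNIV. \<Sum>s\<in>UNIV. \<Sum>m\<in>UNIV. \<Gamma> s l i p * \<Gamma> l s m p * ?v m)
      = (\<Sum>m\<in>UNIV. \<Sum>l\<in>UNIV. \<Sum>s\<in>UNIV. \<Gamma> l i s p * \<Gamma> s l m p * ?v m)"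
  proof -
    have "(\<Sum>l\<in>UNIV. \<Sum>s\<in>UNIV. \<Sum>m\<in>UNIV. \<Gamma> s l i p * \<Gamma> l s m p * ?v m)
      = (\<Sum>s\<in>UNIV. \<Sum>l\<in>UNIV. \<Sum>m\<in>UNIV. \<Gamma> s i l p * \<Gamma> l s m p * ?v m)"
      by (subst sum.swap) (simp add: christoffel_sym[OF p, of _ i])
    also have "\<dots> = (\<Sum>s\<in>UNIV. \<Sum>m\<in>UNIV. \<Sum>l\<in>UNIV. \<Gamma> s i l p * \<Gamma> l s m p * ?v m)"
      by (rule sum.cong[OF refl], rule sum.swap)
    also have "\<dots> = (\<Sum>m\<in>UNIV. \<Sum>s\<in>UNIV. \<Sum>l\<in>UNIV. \<Gamma> s i l p * \<Gamma> l s m p * ?v m)"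
      by (rule sum.swap)
    finally show ?thesis .
  qed
  have 3: "(\<Sum>l\<in>UNIV. \<Sum>s\<in>UNIV. \<Sum>m\<in>UNIV. \<Gamma> l l s p * \<Gamma> s i m p * ?v m)
      = (\<Sum>m\<in>UNIV. \<Sum>l\<in>UNIV. \<Sum>s\<in>UNIV. \<Gamma> l l s p * \<Gamma> s i m p * ?v m)"
    by (rule trans[OF sum.cong[OF refl sum.swap] sum.swap])
  have ric: "(\<Sum>m\<in>UNIV. ricci M c p $ i $ m * ?v m) =
      (\<Sum>m\<in>UNIV. \<Sum>l\<in>UNIV. D l (\<Gamma> l i m) p * ?v m) - (\<Sum>m\<in>UNIV. \<Sum>l\<in>UNIV. D i (\<Gamma> l l m) p * ?v m)
      + (\<Sum>m\<in>UNIV. \<Sum>l\<in>UNIV. \<Sum>s\<in>UNIV. \<Gamma> l l s p * \<Gamma> s i m p * ?v m)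
      - (\<Sum>m\<in>UNIV. \<Sum>l\<in>UNIV. \<Sum>s\<in>UNIV. \<Gamma> l i s p * \<Gamma> s l m p * ?v m)"
    unfolding ricci_def riemann_def
    by (simp add: sum_distrib_right left_diff_distrib distrib_right sum.distrib sum_subtractf)
  have L: "(\<Sum>l\<in>UNIV. D l (hessup f i l) p) = (\<Sum>l\<in>UNIV. D l (D i (gradv f l)) p)
      + (\<Sum>m\<in>UNIV. \<Sum>l\<in>UNIV. D l (\<Gamma> l i m) p * ?v m) + (\<Sum>l\<in>UNIV. \<Sum>s\<in>UNIV. \<Gamma> l i s p * D l (gradv f s) p)"
    by (subst sum.swap[of "\<lambda>m l. D l (\<Gamma> l i m) p * ?v m"]) (simp add: pd_hessup[OF f p] sum.distrib)
  have R: "D i (lap f) p = (\<Sum>l\<in>UNIV. D l (D i (gradv f l)) p)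
      + (\<Sum>m\<in>UNIV. \<Sum>l\<in>UNIV. D i (\<Gamma> l l m) p * ?v m) + (\<Sum>l\<in>UNIV. \<Sum>s\<in>UNIV. \<Gamma> l l s p * D i (gradv f s) p)"
    unfolding lap
    by (subst sum.swap[of "\<lambda>m l. D i (\<Gamma> l l m) p * ?v m"]) (simp add: pd_hessup[OF f p] sum.distrib comm)
  have T1: "(\<Sum>l\<in>UNIV. \<Sum>s\<in>UNIV. \<Gamma> s l i p * hessup f s l p)
      = (\<Sum>l\<in>UNIV. \<Sum>s\<in>UNIV. \<Gamma> s l i p * D s (gradv f l) p)
        + (\<Sum>l\<in>UNIV. \<Sum>s\<in>UNIV. \<Sum>m\<in>UNIV. \<Gamma> s l i p * \<Gamma> l s m p * ?v m)"
    by (simp add: hessup_eq[OF f1 p] distrib_left sum.distrib sum_distrib_left mult.assoc)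
  have T2: "(\<Sum>l\<in>UNIV. \<Sum>s\<in>UNIV. \<Gamma> l l s p * hessup f i s p)
      = (\<Sum>l\<in>UNIV. \<Sum>s\<in>UNIV. \<Gamma> l l s p * D i (gradv f s) p)
        + (\<Sum>l\<in>UNIV. \<Sum>s\<in>UNIV. \<Sum>m\<in>UNIV. \<Gamma> l l s p * \<Gamma> s i m p * ?v m)"
    by (simp add: hessup_eq[OF f1 p] distrib_left sum.distrib sum_distrib_left mult.assoc)
  \<comment> \<open>In L - T1 + T2 - R the second derivatives of \<open>gradv f\<close> cancel
    because they commute, and its first derivatives cancel by \<open>1\<close> and between
    \<open>R\<close> and \<open>T2\<close>; what remains is \<open>ric\<close>.\<close>
  show ?thesis
    using 1 2 3 ric L R T1 T2 by (simp only: sum.distrib sum_subtractf)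
qed

text \<open>Since the inverse metric is parallel, the trace of the covariant derivative of a
  covector field is the divergence of the field with raised index. In this form the divergence of
  \<open>hessup\<close> appears in the Bochner formula.\<close>

lemma divergence_form:
  assumes X: "\<And>l. X l differentiable_on S" and p: "p \<in> S"
  shows "(\<Sum>k\<in>UNIV. \<Sum>l\<in>UNIV. G k l p * (D k (X l) p - (\<Sum>m\<in>UNIV. \<Gamma> m k l p * X m p)))
    = (\<Sum>k\<in>UNIV. D k (\<lambda>q. \<Sum>l\<in>UNIV. G k l q * X l q) p + (\<Sum>m\<in>UNIV. \<Gamma> k k m p * (\<Sum>l\<in>UNIV. G m l p * X l p)))"
proof -
  have 1: "D k (\<lambda>q. \<Sum>l\<in>UNIV. G k l q * X l q) p = (\<Sum>l\<in>UNIV. D k (G k l) p * X l p + G k l p * D k (X l) p)" for k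
    by (rule pd_sum_mult[OF G_differentiable X p])
  have 2: "(\<Sum>k\<in>UNIV. \<Sum>l\<in>UNIV. D k (G k l) p * X l p)
     = - (\<Sum>k\<in>UNIV. \<Sum>l\<in>UNIV. \<Sum>m\<in>UNIV. \<Gamma> k k m p * G m l p * X l p)
       - (\<Sum>k\<in>UNIV. \<Sum>l\<in>UNIV. \<Sum>m\<in>UNIV. \<Gamma> l k m p * G k m p * X l p)"
    by (simp add: ginv_compatible[OF p] sum.distrib sum_distrib_right distrib_right left_diff_distrib sum_negf sum_subtractf)
  have 3: "(\<Sum>k\<in>UNIV. \<Sum>l\<in>UNIV. \<Sum>m\<in>UNIV. \<Gamma> k k m p * G m l p * X l p)
     = (\<Sum>k\<in>UNIV. \<Sum>m\<in>UNIV. \<Gamma> k k m p * (\<Sum>l\<in>UNIV. G m l p * X l p))"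
  proof (rule sum.cong[OF refl])
    fix k show "(\<Sum>l\<in>UNIV. \<Sum>m\<in>UNIV. \<Gamma> k k m p * G m l p * X l p)
     = (\<Sum>m\<in>UNIV. \<Gamma> k k m p * (\<Sum>l\<in>UNIV. G m l p * X l p))"
      by (subst sum.swap) (simp add: sum_distrib_left mult_ac)
  qed
  have 4: "(\<Sum>k\<in>UNIV. \<Sum>l\<in>UNIV. \<Sum>m\<in>UNIV. \<Gamma> l k m p * G k m p * X l p)
     = (\<Sum>k\<in>UNIV. \<Sum>l\<in>UNIV. G k l p * (\<Sum>m\<in>UNIV. \<Gamma> m k l p * X m p))"
  proof (rule sum.cong[OF refl])
    fix k show "(\<Sum>l\<in>UNIV. \<Sum>m\<in>UNIV. \<Gamma> l k m p * G k m p * X l p)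
     = (\<Sum>l\<in>UNIV. G k l p * (\<Sum>m\<in>UNIV. \<Gamma> m k l p * X m p))"
      by (subst sum.swap) (simp add: sum_distrib_left mult_ac)
  qed
  show ?thesis
    unfolding 1 right_diff_distrib sum_subtractf sum.distrib using 2 3 4 by linarith
qed

lemma hessup_gradv_swap:
  assumes f: "diff1 f" and p: "p \<in> S"
  shows "(\<Sum>l\<in>UNIV. G k l p * (\<Sum>s\<in>UNIV. hessup f l s p * D s f p)) = (\<Sum>s\<in>UNIV. hessup f s k p * gradv f s p)"
proof -
  have "(\<Sum>l\<in>UNIV. G k l p * (\<Sum>s\<in>UNIV. hessup f l s p * D s f p))
      = (\<Sum>l\<in>UNIV. \<Sum>j\<in>UNIV. G k l p * hess f j l p * gradv f j p)"
    unfolding hessup_contract[OF p] sum_distrib_left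
    by (intro sum.cong refl) (simp add: hess_sym[OF f p] mult_ac)
  also have "\<dots> = (\<Sum>s\<in>UNIV. hessup f s k p * gradv f s p)"
    by (subst sum.swap) (simp add: hessup_def sum_distrib_right)
  finally show ?thesis .
qed

text \<open>Half the differential of \<open>normsq f\<close> is the Hessian applied to the gradient.
  By the product rule its divergence splits into the squared Hessian and the divergence of
  \<open>hessup\<close> paired with the gradient; \<open>divergence_hessup\<close> evaluates the
  latter.\<close>

lemma bochner:
  assumes f: "diff2 f" and p: "p \<in> S"
  shows "lap (normsq f) p / 2 =
    (\<Sum>s\<in>UNIV. gradv f s p * D s (lap f) p)
    + (\<Sum>i\<in>UNIV. \<Sum>s\<in>UNIV. ricci M c p $ i $ s * gradv f i p * gradv f s p)
    + (\<Sum>k\<in>UNIV. \<Sum>s\<in>UNIV. hessup f s k p * hessup f k s p)"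
proof -
  have f1: "diff1 f" using f diff2D by blast
  let ?v = "\<lambda>s. gradv f s p"
  define X where "X l q = (\<Sum>s\<in>UNIV. hessup f l s q * D s f q)" for l q
  have X: "X l differentiable_on S" for l
    unfolding X_def by (intro chart_diff hessup_differentiable[OF f] diff2D(2)[OF f])
  have DQ: "D l (normsq f) q = 2 * X l q" if "q \<in> S" for l q
    using pd_normsq[OF f1 that] by (simp add: X_def)
  have DDQ: "D k (D l (normsq f)) p = 2 * D k (X l) p" for k l
    by (simp add: pd_cong[OF DQ p] pd_cmult[OF X p])
  have "lap (normsq f) p / 2 = (\<Sum>k\<in>UNIV. \<Sum>l\<in>UNIV. G k l p * (D k (X l) p - (\<Sum>m\<in>UNIV. \<Gamma> m k l p * X m p)))"
  proof -
    have "(\<Sum>m\<in>UNIV. \<Gamma> m k l p * (2 * X m p)) = 2 * (\<Sum>m\<in>UNIV. \<Gamma> m k l p * X m p)" for k l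
      by (simp add: sum_distrib_left mult_ac)
    then show ?thesis
      unfolding lap_def hess_def DDQ DQ[OF p] sum_divide_distrib
      by (intro sum.cong refl) (simp add: right_diff_distrib)
  qed
  also have "\<dots> = (\<Sum>k\<in>UNIV. D k (\<lambda>q. \<Sum>l\<in>UNIV. G k l q * X l q) p + (\<Sum>m\<in>UNIV. \<Gamma> k k m p * (\<Sum>l\<in>UNIV. G m l p * X l p)))"
    by (rule divergence_form[OF X p])
  also have "\<dots> = (\<Sum>k\<in>UNIV. D k (\<lambda>q. \<Sum>s\<in>UNIV. hessup f s k q * gradv f s q) p
      + (\<Sum>m\<in>UNIV. \<Gamma> k k m p * (\<Sum>s\<in>UNIV. hessup f s m p * ?v s)))"
  proof -
    have "D k (\<lambda>q. \<Sum>l\<in>UNIV. G k l q * X l q) p = D k (\<lambda>q. \<Sum>s\<in>UNIV. hessup f s k q * gradv f s q) p" for k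
      by (rule pd_cong[OF _ p]) (simp add: X_def hessup_gradv_swap[OF f1])
    then show ?thesis by (simp add: X_def hessup_gradv_swap[OF f1 p])
  qed
  also have "\<dots> = (\<Sum>k\<in>UNIV. \<Sum>s\<in>UNIV. D k (hessup f s k) p * ?v s)
      + (\<Sum>k\<in>UNIV. \<Sum>s\<in>UNIV. hessup f s k p * D k (gradv f s) p)
      + (\<Sum>k\<in>UNIV. \<Sum>m\<in>UNIV. \<Gamma> k k m p * (\<Sum>s\<in>UNIV. hessup f s m p * ?v s))"
    by (simp add: pd_sum_mult[OF hessup_differentiable[OF f] gradv_differentiable[OF f1] p] sum.distrib)
  also have "(\<Sum>k\<in>UNIV. \<Sum>s\<in>UNIV. hessup f s k p * D k (gradv f s) p)
      = (\<Sum>k\<in>UNIV. \<Sum>s\<in>UNIV. hessup f s k p * hessup f k s p)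
        - (\<Sum>k\<in>UNIV. \<Sum>s\<in>UNIV. \<Sum>i\<in>UNIV. ?v i * (\<Gamma> s k i p * hessup f s k p))"
    by (simp add: pd_gradv[OF f1 p] right_diff_distrib sum_subtractf sum_distrib_left mult_ac)
  also have "(\<Sum>k\<in>UNIV. \<Sum>s\<in>UNIV. \<Sum>i\<in>UNIV. ?v i * (\<Gamma> s k i p * hessup f s k p))
      = (\<Sum>i\<in>UNIV. ?v i * (\<Sum>l\<in>UNIV. \<Sum>s\<in>UNIV. \<Gamma> s l i p * hessup f s l p))"
    unfolding sum_distrib_left by (rule trans[OF sum.cong[OF refl sum.swap] sum.swap])
  also have "(\<Sum>k\<in>UNIV. \<Sum>s\<in>UNIV. D k (hessup f s k) p * ?v s) = (\<Sum>i\<in>UNIV. ?v i * (\<Sum>l\<in>UNIV. D l (hessup f i l) p))"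
    by (subst sum.swap) (simp add: sum_distrib_left mult_ac)
  also have "(\<Sum>k\<in>UNIV. \<Sum>m\<in>UNIV. \<Gamma> k k m p * (\<Sum>s\<in>UNIV. hessup f s m p * ?v s))
      = (\<Sum>i\<in>UNIV. ?v i * (\<Sum>l\<in>UNIV. \<Sum>s\<in>UNIV. \<Gamma> l l s p * hessup f i s p))"
  proof -
    have "(\<Sum>k\<in>UNIV. \<Sum>m\<in>UNIV. \<Gamma> k k m p * (\<Sum>s\<in>UNIV. hessup f s m p * ?v s))
      = (\<Sum>k\<in>UNIV. \<Sum>m\<in>UNIV. \<Sum>i\<in>UNIV. ?v i * (\<Gamma> k k m p * hessup f i m p))"
      by (simp add: sum_distrib_left mult_ac)
    also have "\<dots> = (\<Sum>i\<in>UNIV. ?v i * (\<Sum>l\<in>UNIV. \<Sum>s\<in>UNIV. \<Gamma> l l s p * hessup f i s p))"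
      unfolding sum_distrib_left by (rule trans[OF sum.cong[OF refl sum.swap] sum.swap])
    finally show ?thesis .
  qed
  also have "(\<Sum>i\<in>UNIV. ?v i * (\<Sum>l\<in>UNIV. D l (hessup f i l) p)) +
      ((\<Sum>k\<in>UNIV. \<Sum>s\<in>UNIV. hessup f s k p * hessup f k s p)
        - (\<Sum>i\<in>UNIV. ?v i * (\<Sum>l\<in>UNIV. \<Sum>s\<in>UNIV. \<Gamma> s l i p * hessup f s l p))) +
      (\<Sum>i\<in>UNIV. ?v i * (\<Sum>l\<in>UNIV. \<Sum>s\<in>UNIV. \<Gamma> l l s p * hessup f i s p))
    = (\<Sum>i\<in>UNIV. ?v i * (\<Sum>l\<in>UNIV. D l (hessup f i l) p - (\<Sum>s\<in>UNIV. \<Gamma> s l i p * hessup f s l p)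
            + (\<Sum>s\<in>UNIV. \<Gamma> l l s p * hessup f i s p)))
      + (\<Sum>k\<in>UNIV. \<Sum>s\<in>UNIV. hessup f s k p * hessup f k s p)"
    by (simp add: distrib_left right_diff_distrib sum.distrib sum_subtractf)
  also have "(\<Sum>i\<in>UNIV. ?v i * (\<Sum>l\<in>UNIV. D l (hessup f i l) p - (\<Sum>s\<in>UNIV. \<Gamma> s l i p * hessup f s l p)
            + (\<Sum>s\<in>UNIV. \<Gamma> l l s p * hessup f i s p)))
      = (\<Sum>s\<in>UNIV. ?v s * D s (lap f) p) + (\<Sum>i\<in>UNIV. \<Sum>s\<in>UNIV. ricci M c p $ i $ s * ?v i * ?v s)"
    unfolding divergence_hessup[OF f p] by (simp add: distrib_left sum.distrib sum_distrib_left mult_ac)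
  finally show ?thesis by simp
qed

lemma lower_gradv: assumes p: "p \<in> S" shows "(\<Sum>l\<in>UNIV. g j l p * gradv f l p) = D j f p"
proof -
  have "(\<Sum>l\<in>UNIV. g j l p * gradv f l p) = (\<Sum>l\<in>UNIV. \<Sum>k\<in>UNIV. (g j l p * G l k p) * D k f p)"
    by (simp add: gradv_def sum_distrib_left mult_ac)
  also have "\<dots> = (\<Sum>k\<in>UNIV. (\<Sum>l\<in>UNIV. g j l p * G l k p) * D k f p)"
    by (subst sum.swap) (simp add: sum_distrib_right)
  also have "\<dots> = (\<Sum>k\<in>UNIV. if k = j then D k f p else 0)"
    by (intro sum.cong refl) (simp add: g_G[OF p])
  finally show ?thesis by simp
qed

lemma normsq_nonneg: assumes p: "p \<in> S" shows "normsq f p \<ge> 0"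
proof -
  have "normsq f p = (\<Sum>l\<in>UNIV. \<Sum>j\<in>UNIV. G l j p * D l f p * D j f p)"
    unfolding normsq_def gradv_def sum_distrib_right
    by (intro sum.cong refl) (simp add: mult_ac)
  then show ?thesis using G_psd[OF p, of "\<lambda>i. D i f p"] by simp
qed

lemma pd_metric_gradv:
  assumes p: "p \<in> S"
  shows "(\<Sum>i\<in>UNIV. \<Sum>j\<in>UNIV. D k (g i j) p * gradv f i p * gradv f j p)
    = 2 * (\<Sum>j\<in>UNIV. (\<Sum>l\<in>UNIV. \<Gamma> l k j p * D l f p) * gradv f j p)"
proof -
  let ?v = "\<lambda>i. gradv f i p"
  have "(\<Sum>i\<in>UNIV. \<Sum>j\<in>UNIV. D k (g i j) p * ?v i * ?v j)
      = (\<Sum>i\<in>UNIV. \<Sum>j\<in>UNIV. \<Sum>l\<in>UNIV. \<Gamma> l k i p * (g l j p * ?v j) * ?v i)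
      + (\<Sum>i\<in>UNIV. \<Sum>j\<in>UNIV. \<Sum>l\<in>UNIV. \<Gamma> l k j p * (g l i p * ?v i) * ?v j)"
    by (simp add: metric_compatible[OF p] sum_distrib_right sum.distrib distrib_right)
      (simp add: g_sym[OF p] mult_ac)
  also have "(\<Sum>i\<in>UNIV. \<Sum>j\<in>UNIV. \<Sum>l\<in>UNIV. \<Gamma> l k i p * (g l j p * ?v j) * ?v i)
      = (\<Sum>i\<in>UNIV. \<Sum>l\<in>UNIV. \<Gamma> l k i p * (\<Sum>j\<in>UNIV. g l j p * ?v j) * ?v i)"
  proof (rule sum.cong[OF refl])
    fix i show "(\<Sum>j\<in>UNIV. \<Sum>l\<in>UNIV. \<Gamma> l k i p * (g l j p * ?v j) * ?v i)
      = (\<Sum>l\<in>UNIV. \<Gamma> l k i p * (\<Sum>j\<in>UNIV. g l j p * ?v j) * ?v i)"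
      by (subst sum.swap) (simp add: sum_distrib_left sum_distrib_right)
  qed
  also have "(\<Sum>i\<in>UNIV. \<Sum>j\<in>UNIV. \<Sum>l\<in>UNIV. \<Gamma> l k j p * (g l i p * ?v i) * ?v j)
      = (\<Sum>j\<in>UNIV. \<Sum>l\<in>UNIV. \<Gamma> l k j p * (\<Sum>i\<in>UNIV. g l i p * ?v i) * ?v j)"
  proof -
    have "(\<Sum>i\<in>UNIV. \<Sum>j\<in>UNIV. \<Sum>l\<in>UNIV. \<Gamma> l k j p * (g l i p * ?v i) * ?v j)
      = (\<Sum>j\<in>UNIV. \<Sum>l\<in>UNIV. \<Sum>i\<in>UNIV. \<Gamma> l k j p * (g l i p * ?v i) * ?v j)"
      by (rule trans[OF sum.swap sum.cong[OF refl sum.swap]])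
    then show ?thesis by (simp add: sum_distrib_left sum_distrib_right)
  qed
  finally show ?thesis by (simp add: lower_gradv[OF p] sum_distrib_right)
qed

text \<open>The curvature hypothesis tested on the gradient. Lowering the gradient gives the partial
  derivatives, so pairing it with \<open>flat M V\<close> gives the derivative of \<open>f\<close>
  along \<open>V\<close>.\<close>

lemma curvature_bound:
  assumes p: "p \<in> S" and ric: "ricVm_ge M V m (- K)"
  shows "(\<Sum>i\<in>UNIV. \<Sum>s\<in>UNIV. ricci M c p $ i $ s * gradv f i p * gradv f s p)
    - (\<Sum>i\<in>UNIV. \<Sum>j\<in>UNIV. lie_metric M V c p $ i $ j * gradv f i p * gradv f j p) / 2
    - (\<Sum>i\<in>UNIV. V c p $ i * D i f p)\<^sup>2 / (m - real CARD('n)) \<ge> - K * normsq f p"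
proof -
  define v where "v = (\<chi> i. gradv f i p)"
  have g: "metric M c p *v v = (\<chi> i. D i f p)"
    using lower_gradv[OF p] by (simp add: vec_eq_iff matrix_vector_mult_def v_def)
  have "ginner M c p v v = normsq f p"
    unfolding ginner_def g normsq_def by (simp add: v_def inner_vec_def)
  moreover have "flat M V c p \<bullet> v = (\<Sum>i\<in>UNIV. V c p $ i * D i f p)"
  proof -
    have "flat M V c p \<bullet> v = V c p \<bullet> (metric M c p *v v)"
      unfolding flat_def by (metis dot_lmul_matrix metric_symmetric p vector_transpose_matrix)
    then show ?thesis by (simp add: g inner_vec_def)
  qed
  moreover have "v \<bullet> ((\<chi> i j. flat M V c p $ i * flat M V c p $ j) *v v) = (flat M V c p \<bullet> v)\<^sup>2"
    unfolding quadratic_form_sum unfolding power2_eq_square inner_vec_def sum_product by (simp add: mult_ac)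
  moreover have "v \<bullet> (ricVm M V m c p *v v) = v \<bullet> (ricci M c p *v v) - v \<bullet> (lie_metric M V c p *v v) / 2
      - v \<bullet> ((\<chi> i j. flat M V c p $ i * flat M V c p $ j) *v v) / (m - real CARD('n))"
    unfolding ricVm_def ricV_def
    by (simp add: matrix_vector_mult_diff_rdistrib scaleR_matrix_vector_assoc[symmetric] inner_diff_right)
  moreover have "v \<bullet> (ricVm M V m c p *v v) \<ge> - K * ginner M c p v v"
    using ric in_atlas p unfolding ricVm_ge_def by blast
  ultimately show ?thesis
    by (simp add: quadratic_form_sum) (simp add: v_def)
qed

definition lapV :: "('a, 'n) vfield \<Rightarrow> (real^'n \<Rightarrow> real) \<Rightarrow> real^'n \<Rightarrow> real" where
  "lapV V f p = lap f p + (\<Sum>i\<in>UNIV. V c p $ i * D i f p)"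

text \<open>The drift part of the Bochner formula: commuting the derivative along \<open>V\<close>
  past the gradient leaves half the Lie derivative of the metric on the gradient, which is exactly
  the correction in \<open>ricV\<close>.\<close>

lemma lie_metric_gradv:
  assumes f: "diff1 f" and p: "p \<in> S" and V: "\<And>l. (\<lambda>q. V c q $ l) differentiable_on S"
  shows "(\<Sum>k\<in>UNIV. V c p $ k * D k (normsq f) p) / 2
    = (\<Sum>s\<in>UNIV. gradv f s p * D s (\<lambda>q. \<Sum>l\<in>UNIV. V c q $ l * D l f q) p)
      - (\<Sum>i\<in>UNIV. \<Sum>j\<in>UNIV. lie_metric M V c p $ i $ j * gradv f i p * gradv f j p) / 2"
proof -
  let ?v = "\<lambda>i. gradv f i p" and ?V = "\<lambda>l. V c p $ l" and ?DV = "\<lambda>i l. D i (\<lambda>q. V c q $ l) p"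
  \<comment> \<open>\<open>E\<close> collects the second derivatives of \<open>f\<close>,
    \<open>B\<close> the derivatives of \<open>V\<close>, and \<open>A\<close> the Christoffel
    symbols. The claim reduces to E - A = (B + E) - (2 A + 2 B) / 2.\<close>
  define A where "A = (\<Sum>k\<in>UNIV. ?V k * (\<Sum>j\<in>UNIV. (\<Sum>l\<in>UNIV. \<Gamma> l k j p * D l f p) * ?v j))"
  define B where "B = (\<Sum>i\<in>UNIV. ?v i * (\<Sum>l\<in>UNIV. ?DV i l * D l f p))"
  define E where "E = (\<Sum>k\<in>UNIV. ?V k * (\<Sum>j\<in>UNIV. D k (D j f) p * ?v j))"
  have 1: "(\<Sum>k\<in>UNIV. ?V k * D k (normsq f) p) / 2 = E - A"
  proof -
    have "?V k * D k (normsq f) p = 2 * (?V k * (\<Sum>j\<in>UNIV. D k (D j f) p * ?v j)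
        - ?V k * (\<Sum>j\<in>UNIV. (\<Sum>l\<in>UNIV. \<Gamma> l k j p * D l f p) * ?v j))" for k
      unfolding pd_normsq[OF f p] hessup_contract[OF p] hess_def
      by (simp add: left_diff_distrib sum_subtractf right_diff_distrib)
    then show ?thesis
      by (simp add: E_def A_def sum_subtractf sum_distrib_left[symmetric])
  qed
  have 2: "(\<Sum>s\<in>UNIV. ?v s * D s (\<lambda>q. \<Sum>l\<in>UNIV. V c q $ l * D l f q) p) = B + E"
  proof -
    have "(\<Sum>s\<in>UNIV. ?v s * D s (\<lambda>q. \<Sum>l\<in>UNIV. V c q $ l * D l f q) p)
      = B + (\<Sum>s\<in>UNIV. \<Sum>l\<in>UNIV. ?v s * (?V l * D s (D l f) p))"
      unfolding B_def by (simp add: pd_sum_mult[OF V diff1D(2)[OF f] p] sum.distrib distrib_left sum_distrib_left)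
    also have "(\<Sum>s\<in>UNIV. \<Sum>l\<in>UNIV. ?v s * (?V l * D s (D l f) p)) = E"
    proof -
      have "D s (D l f) p = D l (D s f) p" for s l
        by (rule pd_commute[OF diff1D(1)[OF f] diff1D(2)[OF f] diff1D(2)[OF f] p])
      then show ?thesis unfolding E_def by (subst sum.swap) (simp add: sum_distrib_left mult_ac)
    qed
    finally show ?thesis .
  qed
  have 3: "(\<Sum>i\<in>UNIV. \<Sum>j\<in>UNIV. lie_metric M V c p $ i $ j * ?v i * ?v j) = 2 * A + 2 * B"
  proof -
    have "(\<Sum>i\<in>UNIV. \<Sum>j\<in>UNIV. lie_metric M V c p $ i $ j * ?v i * ?v j)
      = (\<Sum>i\<in>UNIV. \<Sum>j\<in>UNIV. \<Sum>l\<in>UNIV. ?V l * (D l (g i j) p * ?v i * ?v j))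
      + (\<Sum>i\<in>UNIV. \<Sum>j\<in>UNIV. \<Sum>l\<in>UNIV. ?v i * (?DV i l * (g l j p * ?v j)))
      + (\<Sum>i\<in>UNIV. \<Sum>j\<in>UNIV. \<Sum>l\<in>UNIV. ?v j * (?DV j l * (g l i p * ?v i)))"
      unfolding lie_metric_def
      by (simp add: sum_distrib_right sum.distrib distrib_right) (simp add: g_sym[OF p] mult_ac)
    also have "(\<Sum>i\<in>UNIV. \<Sum>j\<in>UNIV. \<Sum>l\<in>UNIV. ?V l * (D l (g i j) p * ?v i * ?v j))
        = (\<Sum>l\<in>UNIV. ?V l * (\<Sum>i\<in>UNIV. \<Sum>j\<in>UNIV. D l (g i j) p * ?v i * ?v j))"
      unfolding sum_distrib_left by (rule trans[OF sum.cong[OF refl sum.swap] sum.swap])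
    also have "\<dots> = 2 * A"
      unfolding pd_metric_gradv[OF p] A_def by (simp add: sum_distrib_left mult_ac)
    also have "(\<Sum>i\<in>UNIV. \<Sum>j\<in>UNIV. \<Sum>l\<in>UNIV. ?v i * (?DV i l * (g l j p * ?v j)))
        = (\<Sum>i\<in>UNIV. \<Sum>l\<in>UNIV. ?v i * (?DV i l * (\<Sum>j\<in>UNIV. g l j p * ?v j)))"
      unfolding sum_distrib_left by (rule sum.cong[OF refl sum.swap])
    also have "\<dots> = B" unfolding B_def by (simp add: lower_gradv[OF p] sum_distrib_left)
    also have "(\<Sum>i\<in>UNIV. \<Sum>j\<in>UNIV. \<Sum>l\<in>UNIV. ?v j * (?DV j l * (g l i p * ?v i)))
        = (\<Sum>j\<in>UNIV. \<Sum>l\<in>UNIV. ?v j * (?DV j l * (\<Sum>i\<in>UNIV. g l i p * ?v i)))"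
      unfolding sum_distrib_left by (rule trans[OF sum.swap sum.cong[OF refl sum.swap]])
    also have "\<dots> = B" unfolding B_def by (simp add: lower_gradv[OF p] sum_distrib_left)
    finally show ?thesis by simp
  qed
  show ?thesis unfolding 1 2 3 by (simp add: field_simps)
qed

text \<open>Convexity of the square with weights n/m and (m - n)/m, the defect being an explicit
  square.\<close>

lemma bakry_emery_split:
  fixes a b n m :: real
  assumes "0 < n" "n < m"
  shows "(a + b)\<^sup>2 / m \<le> a\<^sup>2 / n + b\<^sup>2 / (m - n)"
proof -
  have "a\<^sup>2 / n + b\<^sup>2 / (m - n) - (a + b)\<^sup>2 / m = ((m - n) * a - n * b)\<^sup>2 / (n * (m - n) * m)"
    using assms by (simp add: divide_simps) (simp add: power2_eq_square algebra_simps)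
  also have "\<dots> \<ge> 0" using assms by simp
  finally show ?thesis by simp
qed

text \<open>The curvature-dimension inequality CD(-K, m). The squared Hessian dominates the squared
  Laplacian over n, and the term with 1/(m - n) in \<open>ricVm\<close> pays for replacing n by
  \<open>m\<close> and the Laplacian by its drift version.\<close>

lemma bochner_inequality:
  assumes f: "diff2 f" and p: "p \<in> S" and V: "\<And>l. (\<lambda>q. V c q $ l) differentiable_on S"
    and ric: "ricVm_ge M V m (- K)" and m: "m > real CARD('n)"
  shows "(lapV V f p)\<^sup>2 / m - K * normsq f p + (\<Sum>s\<in>UNIV. gradv f s p * D s (lapV V f) p)
    \<le> lapV V (normsq f) p / 2"
proof -
  have f1: "diff1 f" using f diff2D by blast
  let ?v = "\<lambda>i. gradv f i p"
  let ?b = "\<Sum>i\<in>UNIV. V c p $ i * D i f p"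
  have "(lap f p)\<^sup>2 \<le> real CARD('n) * (\<Sum>k\<in>UNIV. \<Sum>s\<in>UNIV. hessup f s k p * hessup f k s p)"
  proof -
    have N: "(\<Sum>j\<in>UNIV. G i j p * hess f j k p) = hessup f k i p" for i k
      unfolding hessup_def by (simp add: hess_sym[OF f1 p, of _ k])
    show ?thesis
      unfolding lap_eq_trace N[symmetric]
      by (rule trace_square_le[of "\<lambda>i j. G i j p" "\<lambda>i j. g i j p" "\<lambda>i j. hess f i j p"])
         (rule G_sym[OF p] G_psd[OF p] G_g[OF p] hess_sym[OF f1 p] g_sym[OF p])+
  qed
  then have tr: "(lap f p)\<^sup>2 / real CARD('n) \<le> (\<Sum>k\<in>UNIV. \<Sum>s\<in>UNIV. hessup f s k p * hessup f k s p)"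
    by (simp add: divide_le_eq mult.commute)
  have split: "(lapV V f p)\<^sup>2 / m \<le> (lap f p)\<^sup>2 / real CARD('n) + ?b\<^sup>2 / (m - real CARD('n))"
    unfolding lapV_def by (rule bakry_emery_split) (use m in auto)
  have "D s (lapV V f) p = D s (lap f) p + D s (\<lambda>q. \<Sum>l\<in>UNIV. V c q $ l * D l f q) p" for s
    unfolding lapV_def by (intro pd_add lap_differentiable f chart_diff V diff1D(2)[OF f1] p)
  then have "(\<Sum>s\<in>UNIV. ?v s * D s (lapV V f) p) = (\<Sum>s\<in>UNIV. ?v s * D s (lap f) p)
     + (\<Sum>s\<in>UNIV. ?v s * D s (\<lambda>q. \<Sum>l\<in>UNIV. V c q $ l * D l f q) p)"
    by (simp add: distrib_left sum.distrib)
  moreover have "lapV V (normsq f) p / 2 = lap (normsq f) p / 2 + (\<Sum>k\<in>UNIV. V c p $ k * D k (normsq f) p) / 2"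
    unfolding lapV_def by simp
  ultimately show ?thesis
    using tr split curvature_bound[OF p ric, of f] bochner[OF f p] lie_metric_gradv[where V=V, OF f1 p V] by linarith
qed

subsection \<open>Maxima at interior and boundary points\<close>

text \<open>At a point outside the interior the image is relatively open in the half-space, and a
  direction with nonnegative component \<open>bidx M\<close> does not leave it; at interior points
  every direction is admissible.\<close>

lemma inward_segment:
  assumes p: "p \<in> S" and w: "p \<in> interior S \<or> 0 \<le> w $ bidx M"
  obtains \<delta> where "\<delta> > 0" "\<And>s. 0 \<le> s \<Longrightarrow> s < \<delta> \<Longrightarrow> p + s *\<^sub>R w \<in> S"
proof -
  have line: "\<exists>\<delta>>0. \<forall>s. 0 \<le> s \<and> s < \<delta> \<longrightarrow> p + s *\<^sub>R w \<in> T" if T: "open T" "p \<in> T" for T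
  proof -
    obtain e where e: "e > 0" "ball p e \<subseteq> T" using T open_contains_ball by blast
    have "p + s *\<^sub>R w \<in> T" if s: "0 \<le> s" "s < e / (norm w + 1)" for s
    proof -
      have "s * (norm w + 1) < e" using s by (simp add: pos_less_divide_eq add_nonneg_pos)
      moreover have "s * norm w \<le> s * (norm w + 1)" using s by (intro mult_left_mono) auto
      ultimately have "dist p (p + s *\<^sub>R w) < e" using s by (simp add: dist_norm)
      then show ?thesis using e(2) by auto
    qed
    then show ?thesis using e(1) by (intro exI[of _ "e / (norm w + 1)"]) (auto simp: add_nonneg_pos)
  qed
  show ?thesis
  proof (cases "p \<in> interior S")
    case True
    then obtain \<delta> where "\<delta> > 0" "\<And>s. 0 \<le> s \<Longrightarrow> s < \<delta> \<Longrightarrow> p + s *\<^sub>R w \<in> interior S"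
      using line[OF open_interior True] by blast
    then show ?thesis using that interior_subset by blast
  next
    case False
    then have "\<not> open S" using p by (metis interior_open)
    then obtain T where T: "open T" "S = {p. 0 \<le> p $ bidx M} \<inter> T"
      using cimg_cases unfolding openin_open by blast
    obtain \<delta> where \<delta>: "\<delta> > 0" "\<And>s. 0 \<le> s \<Longrightarrow> s < \<delta> \<Longrightarrow> p + s *\<^sub>R w \<in> T"
      using line[OF T(1)] p T(2) by blast
    have "p + s *\<^sub>R w \<in> S" if "0 \<le> s" "s < \<delta>" for s
      using \<delta>(2)[OF that] p w False that unfolding T(2) by auto
    then show ?thesis using that \<delta>(1) by blast
  qed
qed

text \<open>Non-interior points occur only in half-space charts, where they fill the part of the
  image on the hyperplane. The second claim makes the Neumann condition available along whole
  tangential segments.\<close>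

lemma edge_point:
  assumes "p \<in> S" "p \<notin> interior S"
  shows "p $ bidx M = 0" and "q \<in> S \<Longrightarrow> q $ bidx M = 0 \<Longrightarrow> q \<notin> interior S"
proof -
  have "\<not> open S" using assms by (metis interior_open)
  then obtain T where T: "open T" "S = {p. 0 \<le> p $ bidx M} \<inter> T"
    using cimg_cases unfolding openin_open by blast
  show "p $ bidx M = 0"
  proof (rule ccontr)
    assume "p $ bidx M \<noteq> 0"
    then have "p \<in> {p. 0 < p $ bidx M} \<inter> T" using assms T by auto
    moreover have "open ({p. 0 < p $ bidx M} \<inter> T)"
      using T open_halfspace_component_gt_cart[of 0 "bidx M"] by (intro open_Int) auto
    moreover have "{p. 0 < p $ bidx M} \<inter> T \<subseteq> S" unfolding T(2) by auto
    ultimately show False using assms(2) interior_maximal by blast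
  qed
  assume q: "q \<in> S" "q $ bidx M = 0"
  show "q \<notin> interior S"
  proof
    assume "q \<in> interior S"
    then obtain e where e: "e > 0" "ball q e \<subseteq> S" by (meson mem_interior)
    have "q - (e/2) *\<^sub>R axis (bidx M) 1 \<in> S"
      using e by (intro subsetD[OF e(2)]) (simp add: dist_norm)
    then have "0 \<le> (q - (e/2) *\<^sub>R axis (bidx M) 1) $ bidx M" using T by blast
    then show False using q(2) e(1) by simp
  qed
qed

lemma has_derivative_along:
  assumes y: "y differentiable_on S" and \<delta>: "\<And>s. 0 \<le> s \<Longrightarrow> s < \<delta> \<Longrightarrow> p + s *\<^sub>R w \<in> S" and s: "0 \<le> s" "s < \<delta>"
  shows "((\<lambda>s. y (p + s *\<^sub>R w)) has_real_derivative (\<Sum>i\<in>UNIV. w $ i * D i y (p + s *\<^sub>R w))) (at s within {0..<\<delta>})"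
proof -
  have "((\<lambda>s. p + s *\<^sub>R w) has_derivative (\<lambda>h. h *\<^sub>R w)) (at s within {0..<\<delta>})"
    by (auto intro!: derivative_eq_intros)
  from has_derivative_in_compose2[where t=S and g=y
      and g'="\<lambda>q v. \<Sum>i\<in>UNIV. v $ i * D i y q", OF has_derivative_pd[OF y] _ _ this]
  have "((\<lambda>s. y (p + s *\<^sub>R w)) has_derivative (\<lambda>h. \<Sum>i\<in>UNIV. (h *\<^sub>R w) $ i * D i y (p + s *\<^sub>R w))) (at s within {0..<\<delta>})"
    using \<delta> s by (simp add: image_subset_iff)
  then show ?thesis
    unfolding has_field_derivative_def
    by (rule has_derivative_eq_rhs) (auto simp: fun_eq_iff sum_distrib_left sum_distrib_right mult_ac)
qed

lemma pd_inward_max: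
  assumes y: "y differentiable_on S" and p: "p \<in> S" "\<And>q. q \<in> S \<Longrightarrow> y q \<le> y p"
    and w: "p \<in> interior S \<or> 0 \<le> w $ bidx M"
  shows "(\<Sum>i\<in>UNIV. w $ i * D i y p) \<le> 0"
proof (rule ccontr)
  assume n: "\<not> ?thesis"
  obtain \<delta> where \<delta>: "\<delta> > 0" "\<And>s. 0 \<le> s \<Longrightarrow> s < \<delta> \<Longrightarrow> p + s *\<^sub>R w \<in> S"
    using inward_segment[OF p(1) w] by blast
  have d: "((\<lambda>s. y (p + s *\<^sub>R w)) has_real_derivative (\<Sum>i\<in>UNIV. w $ i * D i y p)) (at 0 within {0..<\<delta>})"
    using has_derivative_along[OF y \<delta>(2), where s=0] \<delta>(1) by simp
  then obtain e where e: "e > 0" "\<And>h. 0 < h \<Longrightarrow> 0 + h \<in> {0..<\<delta>} \<Longrightarrow> h < e \<Longrightarrow> y (p + 0 *\<^sub>R w) < y (p + (0 + h) *\<^sub>R w)"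
    using has_real_derivative_pos_inc_right[OF d] n by auto
  have "y p < y (p + (min e \<delta> / 2) *\<^sub>R w)"
    using e(2)[of "min e \<delta> / 2"] e(1) \<delta>(1) by (auto simp: min_def split: if_splits)
  moreover have "p + (min e \<delta> / 2) *\<^sub>R w \<in> S" using \<delta> e(1) by (intro \<delta>(2)) auto
  ultimately show False using p(2) by force
qed

text \<open>A second derivative test that uses a half-open segment only: a positive value would make
  the directional derivative \<psi> positive just inside, and the mean value theorem would then make
  \<open>y\<close> exceed its maximum.\<close>

lemma second_pd_inward_max:
  assumes y: "diff1 y" and p: "p \<in> S" "\<And>q. q \<in> S \<Longrightarrow> y q \<le> y p"
    and 0: "\<And>i. D i y p = 0"
    and w: "p \<in> interior S \<or> 0 \<le> w $ bidx M"
  shows "(\<Sum>i\<in>UNIV. \<Sum>j\<in>UNIV. w $ i * w $ j * D i (D j y) p) \<le> 0"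
proof (rule ccontr)
  assume n: "\<not> ?thesis"
  obtain \<delta> where \<delta>: "\<delta> > 0" "\<And>s. 0 \<le> s \<Longrightarrow> s < \<delta> \<Longrightarrow> p + s *\<^sub>R w \<in> S"
    using inward_segment[OF p(1) w] by blast
  define \<psi> where "\<psi> q = (\<Sum>j\<in>UNIV. w $ j * D j y q)" for q
  have \<psi>: "\<psi> differentiable_on S"
    unfolding \<psi>_def by (intro chart_diff diff1D(2)[OF y])
  have "D i \<psi> p = (\<Sum>j\<in>UNIV. w $ j * D i (D j y) p)" for i
    unfolding \<psi>_def by (simp add: pd_sum_mult[OF differentiable_on_const diff1D(2)[OF y] p(1)] pd_const[OF p(1)])
  then have eq: "(\<Sum>i\<in>UNIV. w $ i * D i \<psi> p) = (\<Sum>i\<in>UNIV. \<Sum>j\<in>UNIV. w $ i * w $ j * D i (D j y) p)"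
    by (simp add: sum_distrib_left mult_ac)
  have d: "((\<lambda>s. \<psi> (p + s *\<^sub>R w)) has_real_derivative (\<Sum>i\<in>UNIV. w $ i * D i \<psi> p)) (at 0 within {0..<\<delta>})"
    using has_derivative_along[OF \<psi> \<delta>(2), where s=0] \<delta>(1) by simp
  obtain e where e: "e > 0" "\<And>h. 0 < h \<Longrightarrow> 0 + h \<in> {0..<\<delta>} \<Longrightarrow> h < e \<Longrightarrow> \<psi> (p + 0 *\<^sub>R w) < \<psi> (p + (0 + h) *\<^sub>R w)"
    using has_real_derivative_pos_inc_right[OF d] n eq by auto
  define s where "s = min e \<delta> / 2"
  have s: "0 < s" "s < e" "s < \<delta>" using e(1) \<delta>(1) by (auto simp: s_def)
  have "\<psi> p = 0" unfolding \<psi>_def by (simp add: 0)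
  have der: "((\<lambda>s. y (p + s *\<^sub>R w)) has_derivative (*) (\<psi> (p + r *\<^sub>R w))) (at r within {0..s})" if "0 \<le> r" "r \<le> s" for r
  proof -
    have "((\<lambda>s. y (p + s *\<^sub>R w)) has_derivative (*) (\<psi> (p + r *\<^sub>R w))) (at r within {0..<\<delta>})"
      using has_derivative_along[OF diff1D(1)[OF y] \<delta>(2), where s=r] that s
      unfolding has_field_derivative_def \<psi>_def by auto
    then show ?thesis by (rule has_derivative_subset) (use s in auto)
  qed
  obtain r where r: "0 < r" "r < s" "y (p + s *\<^sub>R w) - y (p + 0 *\<^sub>R w) = \<psi> (p + r *\<^sub>R w) * (s - 0)"
    using mvt_simple[OF s(1) der] by auto
  have "\<psi> (p + r *\<^sub>R w) > 0" using e(2)[of r] r s \<open>\<psi> p = 0\<close> by auto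
  then have "y (p + s *\<^sub>R w) > y p" using r(3) s(1) by (simp add: algebra_simps)
  moreover have "p + s *\<^sub>R w \<in> S" using s by (intro \<delta>(2)) auto
  ultimately show False using p(2) by force
qed

text \<open>The factorisation of \<open>G\<close> reduces the second order part to single directions
  \<open>w a\<close>; their sign is irrelevant for a quadratic form, so each may be taken inward.
  The Christoffel and drift terms vanish with the gradient.\<close>

lemma lapV_max_le_0:
  assumes y: "diff1 y" and p: "p \<in> S" "\<And>q. q \<in> S \<Longrightarrow> y q \<le> y p"
    and 0: "\<And>i. D i y p = 0"
  shows "lapV V y p \<le> 0"
proof -
  obtain w :: "'n \<Rightarrow> 'n \<Rightarrow> real" where w: "\<And>i j. G i j p = (\<Sum>a\<in>UNIV. w a i * w a j)"
    by (rule psd_decomposition[of "\<lambda>i j. G i j p", OF G_sym[OF p(1)] G_psd[OF p(1)]]) blast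
  have neg: "(\<Sum>i\<in>UNIV. \<Sum>j\<in>UNIV. w a i * w a j * D i (D j y) p) \<le> 0" for a
  proof -
    let ?w = "(\<chi> i. w a i) :: real^'n"
    show ?thesis
    proof (cases "0 \<le> ?w $ bidx M")
      case True
      then show ?thesis using second_pd_inward_max[OF y p 0, of ?w] by simp
    next
      case False
      then show ?thesis using second_pd_inward_max[OF y p 0, of "- ?w"] by simp
    qed
  qed
  have "lapV V y p = (\<Sum>i\<in>UNIV. \<Sum>j\<in>UNIV. \<Sum>a\<in>UNIV. w a i * w a j * D i (D j y) p)"
    unfolding lapV_def lap_def hess_def by (simp add: 0 w sum_distrib_right)
  also have "\<dots> = (\<Sum>a\<in>UNIV. \<Sum>i\<in>UNIV. \<Sum>j\<in>UNIV. w a i * w a j * D i (D j y) p)"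
    by (rule trans[OF sum.cong[OF refl sum.swap] sum.swap])
  also have "\<dots> \<le> 0" by (intro sum_nonpos neg)
  finally show ?thesis .
qed

text \<open>A vector orthogonal to all tangents of the level set is, after lowering, a multiple of
  the differential of the coordinate \<open>bidx M\<close>. The closed formula is what allows the
  normal, given only by a description, to be differentiated.\<close>

lemma outer_normal_eq:
  assumes p: "p \<in> S"
  shows "outer_normal M c p = (\<chi> i. - G i (bidx M) p / sqrt (G (bidx M) (bidx M) p))"
proof -
  let ?b = "bidx M" and ?r = "sqrt (G (bidx M) (bidx M) p)"
  let ?e = "axis (bidx M) 1 :: real^'n"
  let ?\<nu> = "(\<chi> i. - G i (bidx M) p / sqrt (G (bidx M) (bidx M) p)) :: real^'n"
  have r: "?r > 0" "?r * ?r = G ?b ?b p" using G_diag_pos[OF p, of ?b] by auto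
  have \<nu>: "?\<nu> = (- 1 / ?r) *\<^sub>R (ginv M c p *v ?e)"
    by (simp add: vec_eq_iff matrix_vector_mult_basis column_def)
  have inner: "ginner M c p v w = w \<bullet> (metric M c p *v v)" for v w
    unfolding ginner_def by (metis dot_lmul_matrix inner_commute metric_symmetric p vector_transpose_matrix)
  have in\<nu>: "ginner M c p ?\<nu> v = - (v $ ?b) / ?r" for v
    unfolding inner \<nu>
    by (simp only: matrix_vector_mult_scaleR metric_ginv_vec[OF p]) (simp add: inner_axis)
  show ?thesis unfolding outer_normal_def
  proof (rule the_equality, intro conjI allI impI)
    show "ginner M c p ?\<nu> ?\<nu> = 1" unfolding in\<nu> using r by (simp add: field_simps)
    show "ginner M c p ?\<nu> v = 0" if "v $ ?b = 0" for v unfolding in\<nu> using that by simp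
    show "?\<nu> $ ?b < 0" using r G_diag_pos[OF p, of ?b] by simp
  next
    fix \<mu> assume \<mu>: "ginner M c p \<mu> \<mu> = 1 \<and> (\<forall>v. v $ ?b = 0 \<longrightarrow> ginner M c p \<mu> v = 0) \<and> \<mu> $ ?b < 0"
    \<comment> \<open>The lowered vector has only the component \<open>a\<close> in direction
      \<open>bidx M\<close>; unit length and the sign condition then force a = -1 /
      \<open>?r\<close>.\<close>
    define a where "a = (metric M c p *v \<mu>) $ ?b"
    have low: "metric M c p *v \<mu> = a *\<^sub>R ?e"
    proof -
      have "(metric M c p *v \<mu>) $ i = 0" if "i \<noteq> ?b" for i
      proof -
        have "(axis i 1 :: real^'n) $ ?b = 0" using that by (simp add: axis_def)
        then have "axis i 1 \<bullet> (metric M c p *v \<mu>) = 0" using \<mu> unfolding inner by blast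
        then show ?thesis by (simp add: inner_axis')
      qed
      then show ?thesis by (simp add: vec_eq_iff a_def axis_def)
    qed
    have \<mu>a: "\<mu> = a *\<^sub>R (ginv M c p *v ?e)"
      using ginv_metric_vec[OF p, of \<mu>] unfolding low by (simp add: matrix_vector_mult_scaleR)
    then have \<mu>b: "\<mu> $ ?b = a * G ?b ?b p"
      by (metis vector_scaleR_component real_scaleR_def column_def matrix_vector_mult_basis vec_lambda_beta)
    have "a < 0" using \<mu> \<mu>b G_diag_pos[OF p, of ?b] by (simp add: mult_less_0_iff)
    have "ginner M c p \<mu> \<mu> = a * a * G ?b ?b p"
      unfolding ginner_def low using \<mu>b by (simp add: inner_axis)
    then have "a * a * (?r * ?r) = 1" using \<mu> r by simp
    then have "(a * ?r)\<^sup>2 = 1" by (simp add: power2_eq_square mult_ac)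
    then have "a * ?r = 1 \<or> a * ?r = - 1" by (simp add: power2_eq_1_iff)
    moreover have "a * ?r < 0" using \<open>a < 0\<close> r by (simp add: mult_neg_pos)
    ultimately have "a = - 1 / ?r" using r by (auto simp: field_simps)
    then show "\<mu> = ?\<nu>" unfolding \<nu> using \<mu>a by simp
  qed
qed

lemma outer_normal_differentiable: "(\<lambda>q. outer_normal M c q $ i) differentiable_on S"
proof (rule differentiable_on_cong)
  let ?b = "bidx M"
  have "(\<lambda>q. sqrt (G ?b ?b q)) differentiable_on S"
    by (rule differentiable_on_compose_real[OF G_differentiable])
       (rule DERIV_real_sqrt, rule G_diag_pos)
  then show "(\<lambda>q. - G i ?b q / sqrt (G ?b ?b q)) differentiable_on S"
    unfolding differentiable_on_def
  proof (intro ballI)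
    fix q assume d: "\<forall>x\<in>S. (\<lambda>q. sqrt (G ?b ?b q)) differentiable (at x within S)" and q: "q \<in> S"
    have "sqrt (G ?b ?b q) \<noteq> 0" using G_diag_pos[OF q, of ?b] by simp
    moreover have "G i ?b differentiable (at q within S)"
      using G_differentiable q unfolding differentiable_on_def by blast
    ultimately show "(\<lambda>q. - G i ?b q / sqrt (G ?b ?b q)) differentiable (at q within S)"
      using d q by (intro differentiable_divide differentiable_minus) auto
  qed
qed (simp add: outer_normal_eq)

lemma outer_normal_bidx: assumes p: "p \<in> S" shows "outer_normal M c p $ bidx M < 0"
  using G_diag_pos[OF p, of "bidx M"] by (simp add: outer_normal_eq[OF p])

text \<open>Thanks to this sign no Hopf lemma is needed: at a boundary maximum the whole gradient vanishes.\<close>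

lemma normal_deriv_normsq:
  assumes f: "diff1 f" and p: "p \<in> S" "p \<notin> interior S" and conv: "convex_boundary M"
    and neu: "\<And>q. q \<in> S \<Longrightarrow> q \<notin> interior S \<Longrightarrow> (\<Sum>i\<in>UNIV. outer_normal M c q $ i * D i f q) = 0"
  shows "(\<Sum>k\<in>UNIV. outer_normal M c p $ k * D k (normsq f) p) \<le> 0"
proof -
  let ?b = "bidx M" and ?\<nu> = "\<lambda>i q. outer_normal M c q $ i" and ?v = "\<lambda>i. gradv f i p"
  define v where "v = (\<chi> i. gradv f i p)"
  define y where "y q = (\<Sum>i\<in>UNIV. ?\<nu> i q * D i f q)" for q
  have y: "y differentiable_on S"
    unfolding y_def by (intro chart_diff outer_normal_differentiable diff1D(2)[OF f])
  have vb: "v $ ?b = 0"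
  proof -
    have "y p = - gradv f ?b p / sqrt (G ?b ?b p)"
    proof -
      have "?\<nu> i p = - G ?b i p / sqrt (G ?b ?b p)" for i
        unfolding outer_normal_eq[OF p(1)] using G_sym[OF p(1), of i ?b] by simp
      then show ?thesis unfolding y_def gradv_def by (simp add: sum_negf sum_divide_distrib)
    qed
    moreover have "y p = 0" unfolding y_def by (rule neu[OF p])
    ultimately show ?thesis using G_diag_pos[OF p(1), of ?b] by (simp add: v_def)
  qed
  \<comment> \<open>The Neumann expression \<open>y\<close> vanishes along the boundary, hence so do
    its tangential derivatives. Its derivative transversal to the boundary is unknown, but is always
    multiplied by the component \<open>vb\<close>, which is zero.\<close>
  have tangential: "D i y p = 0" if "i \<noteq> ?b" for i
  proof -
    let ?e = "axis i 1 :: real^'n"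
    have eb: "?e $ ?b = 0" using that by (simp add: axis_def)
    obtain \<delta> where \<delta>: "\<delta> > 0" "\<And>s. 0 \<le> s \<Longrightarrow> s < \<delta> \<Longrightarrow> p + s *\<^sub>R ?e \<in> S"
      using inward_segment[OF p(1), of ?e] eb by auto
    have d: "((\<lambda>s. y (p + s *\<^sub>R ?e)) has_real_derivative D i y p) (at 0 within {0..<\<delta>})"
      using has_derivative_along[OF y \<delta>(2), where s=0] \<delta>(1) by (simp add: sum_axis)
    have z: "y (p + s *\<^sub>R ?e) = 0" if "s \<in> {0..<\<delta>}" for s
      unfolding y_def using that \<delta>(2) edge_point[OF p] eb by (intro neu) auto
    show ?thesis
    proof (rule ccontr)
      assume "D i y p \<noteq> 0"
      then have "\<exists>e>0. \<forall>h>0. 0 + h \<in> {0..<\<delta>} \<longrightarrow> h < e \<longrightarrow> y (p + 0 *\<^sub>R ?e) \<noteq> y (p + (0 + h) *\<^sub>R ?e)"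
        using has_real_derivative_pos_inc_right[OF d] has_real_derivative_neg_dec_right[OF d]
        by (metis less_irrefl linorder_neqE_linordered_idom)
      then obtain e where e: "e > 0" "\<And>h. 0 < h \<Longrightarrow> h < \<delta> \<Longrightarrow> h < e \<Longrightarrow> y p \<noteq> y (p + h *\<^sub>R ?e)"
        by auto
      show False
      proof -
        define h where "h = min e \<delta> / 2"
        have h: "0 < h" "h < \<delta>" "h < e" using e(1) \<delta>(1) by (auto simp: h_def)
        then show False using e(2)[OF h] z[of 0] z[of h] by simp
      qed
    qed
  qed
  have sum0: "(\<Sum>k\<in>UNIV. ?v k * D k y p) = 0"
  proof (rule sum.neutral, rule ballI)
    fix k show "?v k * D k y p = 0"
      using tangential[of k] vb by (cases "k = ?b") (auto simp: v_def)
  qed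
  have Dy: "D k y p = (\<Sum>l\<in>UNIV. D k (?\<nu> l) p * D l f p) + (\<Sum>l\<in>UNIV. ?\<nu> l p * D k (D l f) p)" for k
    unfolding y_def by (simp add: pd_sum_mult[OF outer_normal_differentiable diff1D(2)[OF f] p(1)] sum.distrib)
  \<comment> \<open>The gradient is tangent to the boundary, so convexity applies to it. As the
    derivative of \<open>y\<close> along the gradient vanishes, the second fundamental form on the
    gradient equals minus the Hessian of \<open>f\<close> on gradient and normal, and the normal
    derivative of \<open>normsq f\<close> is twice this Hessian value.\<close>
  have "0 \<le> ginner M c p (covariant_deriv M c v (outer_normal M c) p) v"
    using conv in_atlas p vb unfolding convex_boundary_def by blast
  also have "\<dots> = (\<Sum>l\<in>UNIV. D l f p * (\<Sum>k\<in>UNIV. ?v k * (D k (?\<nu> l) p + (\<Sum>j\<in>UNIV. \<Gamma> l k j p * ?\<nu> j p))))"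
    unfolding ginner_def covariant_deriv_def inner_vec_def
    by (simp add: matrix_vector_mult_def v_def lower_gradv[OF p(1)]) (rule sum.cong[OF refl mult.commute])
  also have "\<dots> = (\<Sum>k\<in>UNIV. ?v k * (\<Sum>l\<in>UNIV. D k (?\<nu> l) p * D l f p))
      + (\<Sum>k\<in>UNIV. ?v k * (\<Sum>j\<in>UNIV. ?\<nu> j p * (\<Sum>l\<in>UNIV. \<Gamma> l k j p * D l f p)))"
  proof -
    have "(\<Sum>l\<in>UNIV. D l f p * (\<Sum>k\<in>UNIV. ?v k * (D k (?\<nu> l) p + (\<Sum>j\<in>UNIV. \<Gamma> l k j p * ?\<nu> j p))))
      = (\<Sum>l\<in>UNIV. \<Sum>k\<in>UNIV. ?v k * (D k (?\<nu> l) p * D l f p))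
        + (\<Sum>l\<in>UNIV. \<Sum>k\<in>UNIV. \<Sum>j\<in>UNIV. ?v k * (?\<nu> j p * (\<Gamma> l k j p * D l f p)))"
      by (simp add: sum_distrib_left distrib_left sum.distrib mult_ac)
    also have "(\<Sum>l\<in>UNIV. \<Sum>k\<in>UNIV. ?v k * (D k (?\<nu> l) p * D l f p))
       = (\<Sum>k\<in>UNIV. ?v k * (\<Sum>l\<in>UNIV. D k (?\<nu> l) p * D l f p))"
      unfolding sum_distrib_left by (rule sum.swap)
    also have "(\<Sum>l\<in>UNIV. \<Sum>k\<in>UNIV. \<Sum>j\<in>UNIV. ?v k * (?\<nu> j p * (\<Gamma> l k j p * D l f p)))
       = (\<Sum>k\<in>UNIV. ?v k * (\<Sum>j\<in>UNIV. ?\<nu> j p * (\<Sum>l\<in>UNIV. \<Gamma> l k j p * D l f p)))"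
      unfolding sum_distrib_left by (rule trans[OF sum.swap sum.cong[OF refl sum.swap]])
    finally show ?thesis .
  qed
  also have "(\<Sum>k\<in>UNIV. ?v k * (\<Sum>l\<in>UNIV. D k (?\<nu> l) p * D l f p))
     = - (\<Sum>k\<in>UNIV. ?v k * (\<Sum>j\<in>UNIV. ?\<nu> j p * D k (D j f) p))"
    using sum0 unfolding Dy by (simp add: distrib_left sum.distrib add_eq_0_iff2)
  finally have le: "(\<Sum>k\<in>UNIV. ?v k * (\<Sum>j\<in>UNIV. ?\<nu> j p * hess f k j p)) \<le> 0"
    unfolding hess_def by (simp add: right_diff_distrib sum_subtractf)
  have "(\<Sum>k\<in>UNIV. ?\<nu> k p * D k (normsq f) p) = 2 * (\<Sum>j\<in>UNIV. \<Sum>k\<in>UNIV. ?v k * (?\<nu> j p * hess f k j p))"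
    unfolding pd_normsq[OF f p(1)] hessup_contract[OF p(1)]
    by (simp add: sum_distrib_left hess_sym[OF f p(1)] mult_ac)
  also have "(\<Sum>j\<in>UNIV. \<Sum>k\<in>UNIV. ?v k * (?\<nu> j p * hess f k j p)) = (\<Sum>k\<in>UNIV. ?v k * (\<Sum>j\<in>UNIV. ?\<nu> j p * hess f k j p))"
    unfolding sum_distrib_left by (rule sum.swap)
  finally show ?thesis using le by simp
qed

text \<open>Maximality alone gives equality in all directions but the inward one, where it gives
  \<le>. The outer normal has a negative component there, so the assumption on the normal derivative
  supplies the opposite sign.\<close>

lemma gradient_zero_at_max:
  assumes y: "y differentiable_on S" and p: "p \<in> S" "\<And>q. q \<in> S \<Longrightarrow> y q \<le> y p"
    and nor: "p \<notin> interior S \<Longrightarrow> (\<Sum>i\<in>UNIV. outer_normal M c p $ i * D i y p) \<le> 0"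
  shows "D i y p = 0"
proof -
  have one: "D i y p \<le> 0" for i
  proof -
    have "0 \<le> (axis i 1 :: real^'n) $ bidx M" by (simp add: axis_def)
    then show ?thesis using pd_inward_max[OF y p, of "axis i 1"] by (simp add: sum_axis)
  qed
  have two: "D i y p \<ge> 0" if "p \<in> interior S \<or> i \<noteq> bidx M" for i
  proof -
    have "p \<in> interior S \<or> 0 \<le> (- axis i 1 :: real^'n) $ bidx M" using that by (auto simp: axis_def)
    then show ?thesis using pd_inward_max[OF y p, of "- axis i 1"] by (simp add: sum_negf sum_axis)
  qed
  show ?thesis
  proof (cases "p \<in> interior S \<or> i \<noteq> bidx M")
    case True
    then show ?thesis using one[of i] two[of i] by simp
  next
    case False
    then have i: "i = bidx M" and "p \<notin> interior S" by auto
    have "(\<Sum>i\<in>UNIV. outer_normal M c p $ i * D i y p)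
        = (\<Sum>j\<in>UNIV. if j = i then outer_normal M c p $ i * D i y p else 0)"
      using one two i by (intro sum.cong) (auto intro: antisym)
    then have "outer_normal M c p $ i * D i y p \<le> 0"
      using nor[OF \<open>p \<notin> interior S\<close>] by simp
    then have "D i y p \<ge> 0" using outer_normal_bidx[OF p(1)] i by (simp add: mult_le_0_iff)
    then show ?thesis using one[of i] by simp
  qed
qed

subsection \<open>Evolution of the Harnack quantity\<close>

lemma diff1_add: assumes "diff1 x" "diff1 y" shows "diff1 (\<lambda>q. x q + y q)"
  unfolding diff1_def
proof (intro conjI allI)
  show "(\<lambda>q. x q + y q) differentiable_on S" using assms by (intro chart_diff diff1D(1))
  show "D i (\<lambda>q. x q + y q) differentiable_on S" for i
    by (rule differentiable_on_cong[OF differentiable_on_add[OF assms[THEN diff1D(2)], of i i]])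
       (simp add: pd_add diff1D(1) assms)
qed

lemma diff1_cmult: assumes "diff1 x" shows "diff1 (\<lambda>q. k * x q)"
  unfolding diff1_def
proof (intro conjI allI)
  show "(\<lambda>q. k * x q) differentiable_on S" by (intro chart_diff diff1D(1)[OF assms])
  show "D i (\<lambda>q. k * x q) differentiable_on S" for i
    by (rule differentiable_on_cong[OF differentiable_on_mult[OF differentiable_on_const diff1D(2)[OF assms], of k i]])
       (simp add: pd_cmult diff1D(1) assms)
qed

lemma diff1_const: "diff1 (\<lambda>q. k)"
  unfolding diff1_def
proof (intro conjI allI)
  show "(\<lambda>q. k) differentiable_on S" by (intro chart_diff)
  show "D i (\<lambda>q. k) differentiable_on S" for i
    by (rule differentiable_on_cong[OF differentiable_on_const[of 0]]) (simp add: pd_const)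
qed

lemma diff1_compose:
  assumes f: "diff1 f"
    and h: "\<And>p. p \<in> S \<Longrightarrow> (h has_real_derivative h' (f p)) (at (f p))"
      "\<And>p. p \<in> S \<Longrightarrow> (h' has_real_derivative h'' (f p)) (at (f p))"
  shows "diff1 (\<lambda>q. h (f q))"
  unfolding diff1_def
proof (intro conjI allI)
  show "(\<lambda>q. h (f q)) differentiable_on S" by (rule differentiable_on_compose_real[OF diff1D(1)[OF f] h(1)])
  have "(\<lambda>q. h' (f q)) differentiable_on S" by (rule differentiable_on_compose_real[OF diff1D(1)[OF f] h(2)])
  then show "D i (\<lambda>q. h (f q)) differentiable_on S" for i
    by (rule differentiable_on_cong[OF differentiable_on_mult[OF _ diff1D(2)[OF f, of i]]])
       (simp add: pd_compose_real[OF diff1D(1)[OF f] h(1)])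
qed

lemma diff1_normsq: assumes f: "diff2 f" shows "diff1 (normsq f)"
  unfolding diff1_def
proof (intro conjI allI)
  have f1: "diff1 f" using f diff2D by blast
  show "normsq f differentiable_on S" by (rule normsq_differentiable[OF f1])
  have "(\<lambda>q. 2 * (\<Sum>l\<in>UNIV. hessup f i l q * D l f q)) differentiable_on S" for i
    by (intro chart_diff hessup_differentiable[OF f] diff1D(2)[OF f1])
  then show "D i (normsq f) differentiable_on S" for i
    by (rule differentiable_on_cong) (simp add: pd_normsq[OF f1])
qed

lemma lapV_add:
  assumes x: "diff1 x" and y: "diff1 y" and p: "p \<in> S"
  shows "lapV V (\<lambda>q. x q + y q) p = lapV V x p + lapV V y p"
proof -
  have 1: "D j (\<lambda>q. x q + y q) q = D j x q + D j y q" if "q \<in> S" for j q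
    by (rule pd_add[OF diff1D(1)[OF x] diff1D(1)[OF y] that])
  have 2: "D i (D j (\<lambda>q. x q + y q)) p = D i (D j x) p + D i (D j y) p" for i j
    using pd_cong[OF 1[where j=j] p, where i=i] pd_add[OF diff1D(2)[OF x] diff1D(2)[OF y] p] by simp
  show ?thesis
    unfolding lapV_def lap_def hess_def 1[OF p] 2
    by (simp add: distrib_left right_diff_distrib sum.distrib sum_subtractf)
qed

lemma lapV_cmult:
  assumes x: "diff1 x" and p: "p \<in> S"
  shows "lapV V (\<lambda>q. k * x q) p = k * lapV V x p"
proof -
  have 1: "D j (\<lambda>q. k * x q) q = k * D j x q" if "q \<in> S" for j q
    by (rule pd_cmult[OF diff1D(1)[OF x] that])
  have 2: "D i (D j (\<lambda>q. k * x q)) p = k * D i (D j x) p" for i j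
    using pd_cong[OF 1[where j=j] p, where i=i] pd_cmult[OF diff1D(2)[OF x] p] by simp
  have 3: "G i j p * (k * D i (D j x) p - (\<Sum>l\<in>UNIV. \<Gamma> l i j p * (k * D l x p)))
      = k * (G i j p * hess x i j p)" for i j
  proof -
    have "(\<Sum>l\<in>UNIV. \<Gamma> l i j p * (k * D l x p)) = k * (\<Sum>l\<in>UNIV. \<Gamma> l i j p * D l x p)"
      by (simp add: sum_distrib_left mult_ac)
    then show ?thesis unfolding hess_def by (simp add: right_diff_distrib)
  qed
  have "lap (\<lambda>q. k * x q) p = k * lap x p"
    unfolding lap_def hess_def[of "\<lambda>q. k * x q"] 1[OF p] 2 3 by (simp add: sum_distrib_left)
  moreover have "(\<Sum>i\<in>UNIV. V c p $ i * D i (\<lambda>q. k * x q) p) = k * (\<Sum>i\<in>UNIV. V c p $ i * D i x p)"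
    unfolding 1[OF p] by (simp add: sum_distrib_left mult_ac)
  ultimately show ?thesis unfolding lapV_def by (simp add: distrib_left)
qed

lemma lapV_const: assumes p: "p \<in> S" shows "lapV V (\<lambda>q. k) p = 0"
proof -
  have "D i (D j (\<lambda>q. k)) p = 0" for i j
    using pd_cong[where w="D j (\<lambda>q. k)" and z="\<lambda>q. 0" and i=i, OF pd_const p] pd_const[OF p] by simp
  then show ?thesis unfolding lapV_def lap_def hess_def by (simp add: pd_const[OF p])
qed

text \<open>Used for \<open>h\<close> composed with \<open>f\<close> inside the Harnack quantity,
  and for the exponential when the equation for \<open>u\<close> is rewritten for its
  logarithm.\<close>

lemma lapV_compose:
  assumes f: "diff1 f" and p: "p \<in> S"
    and h: "\<And>p. p \<in> S \<Longrightarrow> (h has_real_derivative h' (f p)) (at (f p))"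
      "\<And>p. p \<in> S \<Longrightarrow> (h' has_real_derivative h'' (f p)) (at (f p))"
  shows "lapV V (\<lambda>q. h (f q)) p = h' (f p) * lapV V f p + h'' (f p) * normsq f p"
proof -
  have 1: "D j (\<lambda>q. h (f q)) q = h' (f q) * D j f q" if "q \<in> S" for j q
    by (rule pd_compose_real[OF diff1D(1)[OF f] h(1)[OF that] that])
  have h'f: "(\<lambda>q. h' (f q)) differentiable_on S"
    by (rule differentiable_on_compose_real[OF diff1D(1)[OF f] h(2)])
  have 2: "D i (D j (\<lambda>q. h (f q))) p = h'' (f p) * D i f p * D j f p + h' (f p) * D i (D j f) p" for i j
    using pd_cong[OF 1[where j=j] p, where i=i] pd_mult[OF h'f diff1D(2)[OF f] p]
      pd_compose_real[OF diff1D(1)[OF f] h(2)[OF p] p] by simp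
  have 3: "G i j p * (h'' (f p) * D i f p * D j f p + h' (f p) * D i (D j f) p
        - (\<Sum>l\<in>UNIV. \<Gamma> l i j p * (h' (f p) * D l f p)))
      = h' (f p) * (G i j p * hess f i j p) + h'' (f p) * ((G i j p * D j f p) * D i f p)" for i j
  proof -
    have "(\<Sum>l\<in>UNIV. \<Gamma> l i j p * (h' (f p) * D l f p)) = h' (f p) * (\<Sum>l\<in>UNIV. \<Gamma> l i j p * D l f p)"
      by (simp add: sum_distrib_left mult_ac)
    then show ?thesis unfolding hess_def by (simp add: algebra_simps)
  qed
  have "lap (\<lambda>q. h (f q)) p = h' (f p) * lap f p + h'' (f p) * normsq f p"
    unfolding lap_def hess_def[of "\<lambda>q. h (f q)"] 1[OF p] 2 3 normsq_def gradv_def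
    by (simp add: sum_distrib_left sum.distrib sum_distrib_right)
  moreover have "(\<Sum>i\<in>UNIV. V c p $ i * D i (\<lambda>q. h (f q)) p) = h' (f p) * (\<Sum>i\<in>UNIV. V c p $ i * D i f p)"
    unfolding 1[OF p] by (simp add: sum_distrib_left mult_ac)
  ultimately show ?thesis unfolding lapV_def by (simp add: distrib_left)
qed

lemma gradv_swap:
  assumes p: "p \<in> S"
  shows "(\<Sum>l\<in>UNIV. gradv a l p * D l b p) = (\<Sum>l\<in>UNIV. gradv b l p * D l a p)"
proof -
  have "(\<Sum>l\<in>UNIV. gradv a l p * D l b p) = (\<Sum>l\<in>UNIV. \<Sum>j\<in>UNIV. G j l p * D j a p * D l b p)"
    unfolding gradv_def sum_distrib_right by (intro sum.cong refl) (simp add: G_sym[OF p])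
  also have "\<dots> = (\<Sum>l\<in>UNIV. gradv b l p * D l a p)"
    unfolding gradv_def sum_distrib_right by (subst sum.swap) (simp add: mult_ac)
  finally show ?thesis .
qed

end

text \<open>\<open>P\<close> and \<open>Q\<close> stand for \<Delta>_V f and the squared gradient,
  so \<open>E\<close> says that the Harnack quantity is positive. The left-hand side of the
  conclusion bounds its time derivative once the spatial terms have been eliminated at a
  maximum.\<close>

lemma differential_harnack_algebra:
  fixes \<gamma> \<alpha> \<phi> c \<gamma>' \<alpha>' \<phi>' h' h'' m K P Q :: real
  assumes pos: "\<alpha> > 0" "\<gamma> > 0" "m > 0" "Q \<ge> 0"
    and 1: "4 * \<gamma> / m * c + (\<alpha> - \<gamma>) * h' + \<alpha> * h'' - 2 * K * \<gamma> - \<gamma>' \<ge> \<gamma> / \<alpha> * (4 * \<gamma> / m * c - \<alpha>')"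
    and 2: "\<phi>' - 2 * \<gamma> / m * c\<^sup>2 + \<phi> / \<alpha> * (4 * \<gamma> / m * c - \<alpha> * h' - \<alpha>') \<ge> 0"
    and 3: "4 * \<gamma> / m * c - \<alpha> * h' - \<alpha>' > 0"
    and E: "\<gamma> * Q - \<alpha> * (P + Q) - \<phi> > 0"
  shows "\<gamma>' * Q - \<alpha>' * (P + Q) - \<phi>' - 2 * \<gamma> * P\<^sup>2 / m + 2 * \<gamma> * K * Q + 2 * \<gamma> * h' * Q
    - \<alpha> * h' * (P + Q) - \<alpha> * h' * Q - \<alpha> * h'' * Q < 0"
proof -
  define A where "A = 4 * \<gamma> / m * c"
  define B where "B = A - \<alpha> * h' - \<alpha>'"
  \<comment> \<open>The square trades the quadratic term for one linear in \<open>P\<close>, whose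
    coefficient \<open>A\<close> is the leading part of \<open>B\<close>.\<close>
  have "0 \<le> 2 * \<gamma> / m * (P + c)\<^sup>2" using pos by simp
  then have P2: "- 2 * \<gamma> * P\<^sup>2 / m \<le> 2 * \<gamma> / m * c\<^sup>2 + A * P"
    using pos by (simp add: A_def power2_eq_square field_simps)
  have c1: "(\<gamma>' + \<gamma> * h' + 2 * K * \<gamma> - \<alpha> * h' - \<alpha> * h'' - A + \<gamma> / \<alpha> * (A - \<alpha>')) * Q \<le> 0"
    using 1 pos(4) by (intro mult_nonpos_nonneg) (auto simp: A_def algebra_simps)
  \<comment> \<open>Condition \<open>3\<close> permits multiplying \<open>E\<close> by B / \<alpha>.
    Solved for P + Q, this replaces the remaining terms in \<open>P\<close> by terms in
    \<open>Q\<close> and \<phi>.\<close>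
  have "B / \<alpha> * (\<gamma> * Q - \<alpha> * (P + Q) - \<phi>) > 0"
    using 3 E pos by (intro mult_pos_pos) (auto simp: A_def B_def)
  moreover have "B / \<alpha> * (\<gamma> * Q - \<alpha> * (P + Q) - \<phi>)
      = (\<gamma> / \<alpha> * (A - \<alpha>') - \<gamma> * h') * Q - B * (P + Q) - \<phi> / \<alpha> * B"
    using pos by (simp add: B_def field_simps)
  ultimately have c3: "B * (P + Q) < (\<gamma> / \<alpha> * (A - \<alpha>') - \<gamma> * h') * Q - \<phi> / \<alpha> * B" by linarith
  have c2: "\<phi>' - 2 * \<gamma> / m * c\<^sup>2 + \<phi> / \<alpha> * B \<ge> 0" using 2 by (simp add: A_def B_def)
  \<comment> \<open>With the nonlinear terms named, the conditions and the goal are related by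
    linear arithmetic.\<close>
  define U R S T C L where "U = (\<gamma>' + \<gamma> * h' + 2 * K * \<gamma> - \<alpha> * h' - \<alpha> * h'' - A) * Q"
    and "R = \<gamma> / \<alpha> * (A - \<alpha>') * Q" and "S = \<gamma> * h' * Q" and "T = 2 * \<gamma> * P\<^sup>2 / m"
    and "C = 2 * \<gamma> / m * c\<^sup>2" and "L = \<phi> / \<alpha> * B"
  note defs = this
  have "U + R \<le> 0" using c1 by (simp add: defs distrib_right)
  moreover have "B * (P + Q) < R - S - L" using c3 by (simp add: defs left_diff_distrib)
  moreover have "\<phi>' - C + L \<ge> 0" using c2 by (simp add: defs)
  moreover have "- T \<le> C + A * P" using P2 by (simp add: defs)
  moreover have "\<gamma>' * Q - \<alpha>' * (P + Q) - \<phi>' - T + 2 * \<gamma> * K * Q + 2 * \<gamma> * h' * Q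
      - \<alpha> * h' * (P + Q) - \<alpha> * h' * Q - \<alpha> * h'' * Q = U + S + B * (P + Q) - \<phi>' - A * P - T"
    by (simp add: U_def S_def B_def algebra_simps)
  ultimately show ?thesis unfolding T_def[symmetric] by linarith
qed

lemma DERIV_cong_pos:
  assumes "(f has_real_derivative d) (at (t::real))" "t > 0" "\<And>s. s > 0 \<Longrightarrow> f s = g s"
  shows "(g has_real_derivative d) (at t)"
  by (rule has_field_derivative_transform_within_open[OF assms(1), of "{0<..}"]) (use assms in auto)

text \<open>\<open>W\<close> is f = ln u in coordinates, at positive times only. \<open>pde\<close>
  is the equation for \<open>f\<close>: the logarithm adds the squared gradient and turns
  \<open>H\<close> into \<open>h\<close>. The set \<open>I\<close> carries the regularity of
  \<open>h\<close>.\<close>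

locale chart_flow = riem_chart M c for M :: "('a, 'n::finite) riem" and c +
  fixes V :: "('a, 'n) vfield" and m K :: real and h :: "real \<Rightarrow> real" and I :: "real set"
    and W :: "(real^'n) \<times> real \<Rightarrow> real"
  assumes V: "Ck_on 1 S (V c)" and ric: "ricVm_ge M V m (- K)" and m: "m > real CARD('n)"
    and smooth_W: "smooth_on (S \<times> {0<..}) W"
    and I: "open I" "Ck_on 2 I h" "\<And>p t. p \<in> S \<Longrightarrow> t > 0 \<Longrightarrow> W (p, t) \<in> I"
    and pde: "\<And>p t. p \<in> S \<Longrightarrow> t > 0 \<Longrightarrow> time_deriv S {0<..} W (p, t)
      = lapV V (\<lambda>q. W (q, t)) p + normsq (\<lambda>q. W (q, t)) p + h (W (p, t))"
begin

abbreviation "J \<equiv> {0::real<..}"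

sublocale one_sided_spacetime S J
  by unfold_locales (rule orthant_open_halfline)

abbreviation Wt :: "real \<Rightarrow> real^'n \<Rightarrow> real" where "Wt t q \<equiv> W (q, t)"
abbreviation Wdot :: "real \<Rightarrow> real^'n \<Rightarrow> real" where "Wdot t q \<equiv> time_deriv S J W (q, t)"

lemma V_differentiable: "(\<lambda>q. V c q $ l) differentiable_on S"
proof -
  have "V c differentiable_on S" using V by simp
  then show ?thesis
    unfolding differentiable_on_def differentiable_def
    using bounded_linear.has_derivative[OF bounded_linear_vec_nth[of l]] by blast
qed

lemma slice_pd:
  assumes U: "smooth_on (S \<times> J) U" and "p \<in> S" "t > 0"
  shows "D i (\<lambda>q. U (q, t)) p = space_deriv S J i U (p, t)"
  by (rule pd_slice[OF smooth_on_imp_differentiable_on[OF U]]) (use assms in auto)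

lemma slice_pd2:
  assumes U: "smooth_on (S \<times> J) U" and p: "p \<in> S" and t: "t > 0"
  shows "D i (D j (\<lambda>q. U (q, t))) p = space_deriv S J i (space_deriv S J j U) (p, t)"
proof -
  have "D i (D j (\<lambda>q. U (q, t))) p = D i (\<lambda>q. space_deriv S J j U (q, t)) p"
    by (rule pd_cong[OF slice_pd[OF U _ t] p])
  then show ?thesis using slice_pd[OF smooth_on_space_deriv[OF U] p t] by simp
qed

lemma slice_diff2:
  assumes U: "smooth_on (S \<times> J) U" and t: "t > 0"
  shows "diff2 (\<lambda>q. U (q, t))"
proof -
  have d: "(\<lambda>q. Z (q, t)) differentiable_on S" if "smooth_on (S \<times> J) Z" for Z :: "(real^'n) \<times> real \<Rightarrow> real"
    using slice_differentiable_on[OF smooth_on_imp_differentiable_on[OF that]] t by simp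
  have "D i (\<lambda>q. U (q, t)) differentiable_on S" for i
    by (rule differentiable_on_cong[OF d[OF smooth_on_space_deriv[OF U, of i]]]) (simp add: slice_pd[OF U _ t])
  moreover have "D i (D j (\<lambda>q. U (q, t))) differentiable_on S" for i j
    by (rule differentiable_on_cong[OF d[OF smooth_on_space_deriv[OF smooth_on_space_deriv[OF U, of j], of i]]])
       (simp add: slice_pd2[OF U _ t])
  ultimately show ?thesis unfolding diff2_def diff1_def using d[OF U] by blast
qed

lemmas Wt_diff2 = slice_diff2[OF smooth_W]
lemmas smooth_Wdot = smooth_on_time_deriv[OF smooth_W]
lemmas Wdot_diff2 = slice_diff2[OF smooth_Wdot]

lemma time_slice_at:
  assumes U: "smooth_on (S \<times> J) U" and p: "p \<in> S" and t: "t > 0"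
  shows "((\<lambda>s. U (p, s)) has_real_derivative time_deriv S J U (p, t)) (at t)"
proof -
  have "((\<lambda>s. U (p, s)) has_real_derivative time_deriv S J U (p, t)) (at t within J)"
    using time_slice[OF smooth_on_imp_differentiable_on[OF U] p] t by simp
  moreover have "at t within J = at t" using t by (intro at_within_open) auto
  ultimately show ?thesis by simp
qed

lemma time_pd:
  assumes p: "p \<in> S" and t: "t > 0"
  shows "((\<lambda>s. D i (Wt s) p) has_real_derivative D i (Wdot t) p) (at t)"
proof -
  have "((\<lambda>s. space_deriv S J i W (p, s)) has_real_derivative D i (Wdot t) p) (at t)"
    using time_slice_at[OF smooth_on_space_deriv[OF smooth_W, of i] p t]
      space_time_commute[OF smooth_W p, of t i] slice_pd[OF smooth_Wdot p t, of i] t by simp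
  then show ?thesis by (rule DERIV_cong_pos[OF _ t]) (simp add: slice_pd[OF smooth_W p])
qed

lemma time_pd2:
  assumes p: "p \<in> S" and t: "t > 0"
  shows "((\<lambda>s. D i (D j (Wt s)) p) has_real_derivative D i (D j (Wdot t)) p) (at t)"
proof -
  let ?Wj = "space_deriv S J j W"
  have sj: "smooth_on (S \<times> J) ?Wj" by (rule smooth_on_space_deriv[OF smooth_W])
  have "D i (D j (Wdot t)) p = D i (\<lambda>q. time_deriv S J ?Wj (q, t)) p"
  proof (rule pd_cong[OF _ p])
    show "D j (Wdot t) q = time_deriv S J ?Wj (q, t)" if "q \<in> S" for q
      using space_time_commute[OF smooth_W that, of t j] slice_pd[OF smooth_Wdot that t, of j] t by simp
  qed
  also have "\<dots> = space_deriv S J i (time_deriv S J ?Wj) (p, t)"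
    by (rule slice_pd[OF smooth_on_time_deriv[OF sj] p t])
  also have "\<dots> = time_deriv S J (space_deriv S J i ?Wj) (p, t)"
    using space_time_commute[OF sj p, of t i] t by simp
  finally have "((\<lambda>s. space_deriv S J i ?Wj (p, s)) has_real_derivative D i (D j (Wdot t)) p) (at t)"
    using time_slice_at[OF smooth_on_space_deriv[OF sj, of i] p t] by simp
  then show ?thesis by (rule DERIV_cong_pos[OF _ t]) (simp add: slice_pd2[OF smooth_W p])
qed

lemma time_gradv:
  assumes p: "p \<in> S" and t: "t > 0"
  shows "((\<lambda>s. gradv (Wt s) l p) has_real_derivative gradv (Wdot t) l p) (at t)"
  unfolding gradv_def by (intro DERIV_sum DERIV_cmult time_pd p t)

lemma time_normsq:
  assumes p: "p \<in> S" and t: "t > 0"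
  shows "((\<lambda>s. normsq (Wt s) p) has_real_derivative 2 * (\<Sum>l\<in>UNIV. gradv (Wt t) l p * D l (Wdot t) p)) (at t)"
proof -
  have "((\<lambda>s. normsq (Wt s) p) has_real_derivative
      (\<Sum>l\<in>UNIV. gradv (Wdot t) l p * D l (Wt t) p + D l (Wdot t) p * gradv (Wt t) l p)) (at t)"
    unfolding normsq_def by (intro DERIV_sum DERIV_mult time_gradv time_pd p t)
  also have "(\<Sum>l\<in>UNIV. gradv (Wdot t) l p * D l (Wt t) p + D l (Wdot t) p * gradv (Wt t) l p)
      = 2 * (\<Sum>l\<in>UNIV. gradv (Wt t) l p * D l (Wdot t) p)"
    using gradv_swap[OF p, of "Wdot t" "Wt t"] by (simp add: sum.distrib mult.commute)
  finally show ?thesis .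
qed

text \<open>Metric and \<open>V\<close> do not depend on time, so the operator commutes with the
  time derivative once the partial derivatives do.\<close>

lemma time_lapV:
  assumes p: "p \<in> S" and t: "t > 0"
  shows "((\<lambda>s. lapV V (Wt s) p) has_real_derivative lapV V (Wdot t) p) (at t)"
  unfolding lapV_def lap_def hess_def
  by (intro DERIV_add DERIV_diff DERIV_sum DERIV_cmult time_pd time_pd2 p t)

lemma h_deriv:
  assumes "p \<in> S" "t > 0"
  shows "(h has_real_derivative deriv h (W (p, t))) (at (W (p, t)))"
    "(deriv h has_real_derivative deriv (deriv h) (W (p, t))) (at (W (p, t)))"
  using Ck_on_2_real[OF I(1,2) I(3)[OF assms]] by auto

lemma time_h:
  assumes p: "p \<in> S" and t: "t > 0"
  shows "((\<lambda>s. h (W (p, s))) has_real_derivative deriv h (W (p, t)) * Wdot t p) (at t)"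
  by (rule DERIV_chain2[OF h_deriv(1)[OF p t] time_slice_at[OF smooth_W p t]])

text \<open>The equation holds at every positive time and may be differentiated in time: the time
  derivative of \<open>f\<close> solves the linearised equation.\<close>

lemma time_Wdot:
  assumes p: "p \<in> S" and t: "t > 0"
  shows "((\<lambda>s. Wdot s p) has_real_derivative lapV V (Wdot t) p
    + 2 * (\<Sum>l\<in>UNIV. gradv (Wt t) l p * D l (Wdot t) p) + deriv h (W (p, t)) * Wdot t p) (at t)"
  by (rule DERIV_cong_pos[OF DERIV_add[OF DERIV_add[OF time_lapV[OF p t] time_normsq[OF p t]] time_h[OF p t]] t])
     (simp add: pde[OF p])

definition harnack :: "(real \<Rightarrow> real) \<Rightarrow> (real \<Rightarrow> real) \<Rightarrow> (real \<Rightarrow> real) \<Rightarrow> real^'n \<Rightarrow> real \<Rightarrow> real" where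
  "harnack \<gamma> \<alpha> \<phi> p t = \<gamma> t * normsq (Wt t) p - \<alpha> t * Wdot t p + \<alpha> t * h (W (p, t)) - \<phi> t"

text \<open>The normal does not depend on time, so differentiating the Neumann condition in time
  gives the second claim. In the normal derivative of the Harnack quantity only the gradient term is
  then left.\<close>

lemma normal_deriv_harnack:
  assumes p: "p \<in> S" "p \<notin> interior S" and t: "t > 0" and conv: "convex_boundary M"
    and neu: "\<And>q s. q \<in> S \<Longrightarrow> q \<notin> interior S \<Longrightarrow> s > 0 \<Longrightarrow> (\<Sum>i\<in>UNIV. outer_normal M c q $ i * D i (Wt s) q) = 0"
  shows "(\<Sum>i\<in>UNIV. outer_normal M c p $ i * D i (normsq (Wt t)) p) \<le> 0"
    "(\<Sum>i\<in>UNIV. outer_normal M c p $ i * D i (Wdot t) p) = 0"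
proof -
  show "(\<Sum>i\<in>UNIV. outer_normal M c p $ i * D i (normsq (Wt t)) p) \<le> 0"
    by (rule normal_deriv_normsq[OF diff2D(4)[OF Wt_diff2[OF t]] p conv neu[OF _ _ t]])
  have "((\<lambda>s. \<Sum>i\<in>UNIV. outer_normal M c p $ i * D i (Wt s) p) has_real_derivative
      (\<Sum>i\<in>UNIV. outer_normal M c p $ i * D i (Wdot t) p)) (at t)"
    by (intro DERIV_sum DERIV_cmult time_pd p t)
  then have "((\<lambda>s. 0) has_real_derivative (\<Sum>i\<in>UNIV. outer_normal M c p $ i * D i (Wdot t) p)) (at t)"
    by (rule DERIV_cong_pos[OF _ t]) (rule neu[OF p])
  then show "(\<Sum>i\<in>UNIV. outer_normal M c p $ i * D i (Wdot t) p) = 0"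
    using DERIV_unique[OF _ DERIV_const] by blast
qed

text \<open>The parabolic maximum principle at one point: a maximum in space gives a vanishing
  gradient and a nonpositive drift Laplacian, comparison with earlier times gives a nonnegative time
  derivative, and \<open>differential_harnack_algebra\<close> contradicts the three
  together.\<close>

lemma no_positive_max:
  assumes p: "p \<in> S" and t: "t > 0" and K: "K \<ge> 0"
    and d: "(\<gamma> has_real_derivative \<gamma>') (at t)" "(\<alpha> has_real_derivative \<alpha>') (at t)" "(\<phi> has_real_derivative \<phi>') (at t)"
    and A1: "4 * \<gamma> t / m * k + (\<alpha> t - \<gamma> t) * deriv h (W (p, t)) + \<alpha> t * deriv (deriv h) (W (p, t)) - 2 * K * \<gamma> t - \<gamma>'
        \<ge> \<gamma> t / \<alpha> t * (4 * \<gamma> t / m * k - \<alpha>')"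
      "\<phi>' - 2 * \<gamma> t / m * k\<^sup>2 + \<phi> t / \<alpha> t * (4 * \<gamma> t / m * k - \<alpha> t * deriv h (W (p, t)) - \<alpha>') \<ge> 0"
      "4 * \<gamma> t / m * k - \<alpha> t * deriv h (W (p, t)) - \<alpha>' > 0" "\<alpha> t > 0" "\<gamma> t > 0"
    and space: "\<And>q. q \<in> S \<Longrightarrow> harnack \<gamma> \<alpha> \<phi> q t \<le> harnack \<gamma> \<alpha> \<phi> p t"
    and time: "r < t" "\<And>s. r < s \<Longrightarrow> s < t \<Longrightarrow> harnack \<gamma> \<alpha> \<phi> p s \<le> harnack \<gamma> \<alpha> \<phi> p t"
    and edge: "p \<notin> interior S \<Longrightarrow> convex_boundary M"
      "\<And>q s. p \<notin> interior S \<Longrightarrow> q \<in> S \<Longrightarrow> q \<notin> interior S \<Longrightarrow> s > 0 \<Longrightarrow>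
        (\<Sum>i\<in>UNIV. outer_normal M c q $ i * D i (Wt s) q) = 0"
  shows "harnack \<gamma> \<alpha> \<phi> p t \<le> 0"
proof (rule ccontr)
  assume pos: "\<not> ?thesis"
  let ?f = "Wt t" and ?w = "Wdot t"
  let ?h' = "deriv h (W (p, t))" and ?h'' = "deriv (deriv h) (W (p, t))"
  let ?N = "\<lambda>x. \<Sum>l\<in>UNIV. gradv ?f l p * D l x p"
  define Q where "Q = normsq ?f p"
  define P where "P = lapV V ?f p"
  have f2: "diff2 ?f" and w2: "diff2 ?w" using Wt_diff2[OF t] Wdot_diff2[OF t] by auto
  have f1: "diff1 ?f" and w1: "diff1 ?w" using f2 w2 diff2D by auto
  have Q1: "diff1 (normsq ?f)" by (rule diff1_normsq[OF f2])
  have hf1: "diff1 (\<lambda>q. h (?f q))"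
    by (rule diff1_compose[OF f1 h_deriv[OF _ t]])
  define y where "y q = \<gamma> t * normsq ?f q + ((- \<alpha> t) * ?w q + (\<alpha> t * h (?f q) + (- \<phi> t)))" for q
  have yh: "harnack \<gamma> \<alpha> \<phi> q t = y q" for q unfolding harnack_def y_def by simp
  have d1: "diff1 (\<lambda>q. \<alpha> t * h (?f q) + (- \<phi> t))"
    by (intro diff1_add diff1_cmult diff1_const hf1)
  have d2: "diff1 (\<lambda>q. (- \<alpha> t) * ?w q + (\<alpha> t * h (?f q) + (- \<phi> t)))"
    by (intro diff1_add diff1_cmult w1 d1)
  have y1: "diff1 y" unfolding y_def by (intro diff1_add diff1_cmult Q1 d2)
  have Dh: "D i (\<lambda>q. h (?f q)) p = ?h' * D i ?f p" for i
    by (rule pd_compose_real[OF diff1D(1)[OF f1] h_deriv(1)[OF p t] p])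
  have Dy: "D i y p = \<gamma> t * D i (normsq ?f) p - \<alpha> t * D i ?w p + \<alpha> t * ?h' * D i ?f p" for i
    unfolding y_def
    by (simp only: pd_add diff1D(1) diff1_cmult Q1 d2 d1 w1 hf1 diff1_const p pd_cmult pd_const Dh)
  have nor: "(\<Sum>i\<in>UNIV. outer_normal M c p $ i * D i y p) \<le> 0" if np: "p \<notin> interior S"
  proof -
    note nd = normal_deriv_harnack[OF p np t edge(1)[OF np] edge(2)[OF np]]
    have "(\<Sum>i\<in>UNIV. outer_normal M c p $ i * D i y p)
      = (\<Sum>i\<in>UNIV. \<gamma> t * (outer_normal M c p $ i * D i (normsq ?f) p)
        - \<alpha> t * (outer_normal M c p $ i * D i ?w p) + \<alpha> t * ?h' * (outer_normal M c p $ i * D i ?f p))"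
      unfolding Dy by (intro sum.cong refl) (simp add: algebra_simps)
    also have "\<dots> = \<gamma> t * (\<Sum>i\<in>UNIV. outer_normal M c p $ i * D i (normsq ?f) p)"
      by (simp add: sum.distrib sum_subtractf sum_distrib_left[symmetric] nd(2) edge(2)[OF np p np t])
    finally show ?thesis using nd(1) A1(5) by (simp add: mult_nonneg_nonpos)
  qed
  have space': "y q \<le> y p" if "q \<in> S" for q using space[OF that] yh by simp
  have Dy0: "D i y p = 0" for i
    by (rule gradient_zero_at_max[OF diff1D(1)[OF y1] p space' nor])
  \<comment> \<open>The vanishing gradient of the Harnack quantity, paired with the gradient of
    \<open>f\<close>.\<close>
  have b: "\<gamma> t * ?N (normsq ?f) - \<alpha> t * ?N ?w + \<alpha> t * ?h' * Q = 0"
  proof -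
    have "0 = (\<Sum>l\<in>UNIV. gradv ?f l p * D l y p)" by (simp add: Dy0)
    also have "\<dots> = (\<Sum>l\<in>UNIV. \<gamma> t * (gradv ?f l p * D l (normsq ?f) p)
        - \<alpha> t * (gradv ?f l p * D l ?w p) + \<alpha> t * ?h' * (gradv ?f l p * D l ?f p))"
      unfolding Dy by (intro sum.cong refl) (simp add: algebra_simps)
    finally show ?thesis
      unfolding Q_def normsq_def[of ?f p] by (simp add: sum.distrib sum_subtractf sum_distrib_left[symmetric])
  qed
  have a: "\<gamma> t * lapV V (normsq ?f) p - \<alpha> t * lapV V ?w p + \<alpha> t * (?h' * P + ?h'' * Q) \<le> 0"
  proof -
    have "lapV V y p = \<gamma> t * lapV V (normsq ?f) p - \<alpha> t * lapV V ?w p + \<alpha> t * lapV V (\<lambda>q. h (?f q)) p"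
      unfolding y_def
      by (simp only: lapV_add diff1_cmult Q1 d2 d1 w1 hf1 diff1_const p lapV_cmult lapV_const)
    moreover have "lapV V (\<lambda>q. h (?f q)) p = ?h' * P + ?h'' * Q"
      unfolding P_def Q_def by (rule lapV_compose[OF f1 p h_deriv[OF _ t]])
    ultimately show ?thesis using lapV_max_le_0[OF y1 p space' Dy0, of V] by simp
  qed
  have pde': "?w q = lapV V ?f q + normsq ?f q + h (?f q)" if "q \<in> S" for q
    by (rule pde[OF that t])
  \<comment> \<open>The Bochner inequality contains the gradient of \<Delta>_V f; the equation
    replaces it by gradients of f_t, of the squared gradient and of h(f).\<close>
  have vP: "?N (lapV V ?f) = ?N ?w - ?N (normsq ?f) - ?h' * Q"
  proof -
    have e: "D s (lapV V ?f) p = D s ?w p - D s (normsq ?f) p - ?h' * D s ?f p" for s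
    proof -
      have "D s (lapV V ?f) p = D s (\<lambda>q. ?w q - normsq ?f q - h (?f q)) p"
        by (rule pd_cong[OF _ p]) (simp add: pde')
      also have "\<dots> = D s ?w p - D s (normsq ?f) p - D s (\<lambda>q. h (?f q)) p"
        by (simp add: pd_diff differentiable_on_diff diff1D(1) w1 Q1 hf1 p)
      finally show ?thesis by (simp add: Dh)
    qed
    have "?N (lapV V ?f) = (\<Sum>l\<in>UNIV. gradv ?f l p * D l ?w p - gradv ?f l p * D l (normsq ?f) p
        - ?h' * (gradv ?f l p * D l ?f p))"
      unfolding e by (intro sum.cong refl) (simp add: algebra_simps)
    then show ?thesis
      unfolding Q_def normsq_def[of ?f p] by (simp add: sum_subtractf sum_distrib_left[symmetric])
  qed
  have boch: "P\<^sup>2 / m - K * Q + ?N (lapV V ?f) \<le> lapV V (normsq ?f) p / 2"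
    unfolding P_def Q_def by (rule bochner_inequality[OF f2 p V_differentiable ric m])
  define E' where "E' = \<gamma>' * Q + \<gamma> t * (2 * ?N ?w) - (\<alpha>' * ?w p + \<alpha> t * (lapV V ?w p + 2 * ?N ?w + ?h' * ?w p))
      + (\<alpha>' * h (W (p, t)) + \<alpha> t * (?h' * ?w p)) - \<phi>'"
  have "((\<lambda>s. harnack \<gamma> \<alpha> \<phi> p s) has_real_derivative E') (at t)"
    unfolding harnack_def E'_def Q_def
    by (rule DERIV_cong[OF DERIV_diff[OF DERIV_add[OF DERIV_diff[OF DERIV_mult[OF d(1) time_normsq[OF p t]]
          DERIV_mult[OF d(2) time_Wdot[OF p t]]] DERIV_mult[OF d(2) time_h[OF p t]]] d(3)]])
       (simp add: algebra_simps)
  \<comment> \<open>Only earlier times are compared, since the maximum may lie at the end of the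
    time interval; a negative derivative would make the quantity larger just before
    \<open>t\<close>.\<close>
  then have Epos: "E' \<ge> 0"
  proof -
    assume der: "((\<lambda>s. harnack \<gamma> \<alpha> \<phi> p s) has_real_derivative E') (at t)"
    show ?thesis
    proof (rule ccontr)
      assume "\<not> E' \<ge> 0"
      then obtain e where e: "e > 0" "\<And>s. 0 < s \<Longrightarrow> s < e \<Longrightarrow> harnack \<gamma> \<alpha> \<phi> p t < harnack \<gamma> \<alpha> \<phi> p (t - s)"
        using DERIV_neg_dec_left[OF der] by auto
      define s where "s = min e (t - r) / 2"
      have "0 < s" "s < e" "s < t - r" using e(1) time(1) by (auto simp: s_def)
      then show False using e(2)[of s] time(2)[of "t - s"] by auto
    qed
  qed
  have wp: "?w p = P + Q + h (W (p, t))" using pde'[OF p] by (simp add: P_def Q_def)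
  have "m > 0" using m by (smt (verit) of_nat_0_le_iff)
  have fin: "\<gamma>' * Q - \<alpha>' * (P + Q) - \<phi>' - 2 * \<gamma> t * P\<^sup>2 / m + 2 * \<gamma> t * K * Q + 2 * \<gamma> t * ?h' * Q
    - \<alpha> t * ?h' * (P + Q) - \<alpha> t * ?h' * Q - \<alpha> t * ?h'' * Q < 0"
    by (rule differential_harnack_algebra[OF A1(4,5) \<open>m > 0\<close> _ A1(1,2,3)])
       (use pos normsq_nonneg[OF p] wp in \<open>auto simp: harnack_def Q_def algebra_simps\<close>)
  define R vw vq LQ Lw where "R = P\<^sup>2 / m" and "vw = ?N ?w" and "vq = ?N (normsq ?f)"
    and "LQ = lapV V (normsq ?f) p" and "Lw = lapV V ?w p"
  note defs = this
  have LQ: "\<gamma> t * (2 * (R - K * Q + (vw - vq - ?h' * Q))) \<le> \<gamma> t * LQ"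
  proof (rule mult_left_mono)
    have "R - K * Q + (vw - vq - ?h' * Q) \<le> LQ / 2" using boch unfolding vP defs .
    then show "2 * (R - K * Q + (vw - vq - ?h' * Q)) \<le> LQ" by (simp only: le_divide_eq_numeral1(1) mult.commute[of _ "2::real"])
  qed (use A1(5) in simp)
  \<comment> \<open>After the Bochner inequality has been inserted, \<open>vw\<close> and
    \<open>vq\<close> survive only as twice \<gamma> \<open>vq\<close> - \<alpha> \<open>vw\<close>,
    which this identity evaluates.\<close>
  have b': "\<gamma> t * vq = \<alpha> t * vw - \<alpha> t * ?h' * Q" using b by (simp add: defs)
  have a': "- \<alpha> t * Lw \<le> - \<gamma> t * LQ - \<alpha> t * (?h' * P + ?h'' * Q)" using a by (simp add: defs)
  have "E' = \<gamma>' * Q - \<alpha>' * (P + Q) - \<phi>' + 2 * (\<gamma> t * vw) - \<alpha> t * Lw - 2 * (\<alpha> t * vw)"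
    unfolding E'_def wp by (simp add: defs algebra_simps)
  also have "\<dots> \<le> \<gamma>' * Q - \<alpha>' * (P + Q) - \<phi>' + 2 * (\<gamma> t * vw) - \<gamma> t * (2 * (R - K * Q + (vw - vq - ?h' * Q)))
      - \<alpha> t * (?h' * P + ?h'' * Q) - 2 * (\<alpha> t * vw)"
    using a' LQ by linarith
  also have "\<dots> = \<gamma>' * Q - \<alpha>' * (P + Q) - \<phi>' - 2 * \<gamma> t * R + 2 * \<gamma> t * K * Q + 2 * \<gamma> t * ?h' * Q
      - \<alpha> t * (?h' * P + ?h'' * Q) + 2 * (\<gamma> t * vq) - 2 * (\<alpha> t * vw)"
    by (simp add: algebra_simps)
  also have "\<dots> = \<gamma>' * Q - \<alpha>' * (P + Q) - \<phi>' - 2 * \<gamma> t * P\<^sup>2 / m + 2 * \<gamma> t * K * Q + 2 * \<gamma> t * ?h' * Q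
    - \<alpha> t * ?h' * (P + Q) - \<alpha> t * ?h' * Q - \<alpha> t * ?h'' * Q"
    unfolding b' R_def by (simp add: algebra_simps)
  finally have "E' < 0" using fin by linarith
  then show False using Epos by simp
qed

end

subsection \<open>From charts to the manifold\<close>

lemma
  assumes "smooth_manifold_with_boundary M" "k \<in> atlas M"
  shows chart_open: "openin (mtop M) (fst k)"
    and chart_homeo: "homeomorphic_map (subtopology (mtop M) (fst k)) (top_of_set (cimg k)) (snd k)"
    and chart_subset: "fst k \<subseteq> topspace (mtop M)"
    and chart_inj: "inj_on (snd k) (fst k)"
proof -
  show 1: "openin (mtop M) (fst k)"
    and 2: "homeomorphic_map (subtopology (mtop M) (fst k)) (top_of_set (cimg k)) (snd k)"
    using assms unfolding smooth_manifold_with_boundary_def by blast+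
  show 3: "fst k \<subseteq> topspace (mtop M)" using 1 openin_subset by blast
  show "inj_on (snd k) (fst k)"
    using homeomorphic_imp_injective_map[OF 2] 3 by (simp add: Int_absorb1)
qed

lemma chart_exists:
  assumes "smooth_manifold_with_boundary M" "x \<in> topspace (mtop M)"
  obtains k where "k \<in> atlas M" "x \<in> fst k"
proof -
  have "x \<in> (\<Union>c\<in>atlas M. fst c)" using assms unfolding smooth_manifold_with_boundary_def by blast
  then show ?thesis using that by blast
qed

lemma cinv_chart: "inj_on (snd k) (fst k) \<Longrightarrow> x \<in> fst k \<Longrightarrow> cinv k (snd k x) = x"
  unfolding cinv_def by simp

lemma chart_cinv: "p \<in> cimg k \<Longrightarrow> snd k (cinv k p) = p" "p \<in> cimg k \<Longrightarrow> cinv k p \<in> fst k"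
  unfolding cinv_def cimg_def by (auto intro: f_inv_into_f inv_into_into)

lemma chart_in_cimg: "x \<in> fst k \<Longrightarrow> snd k x \<in> cimg k"
  unfolding cimg_def by blast

text \<open>Continuity is known in coordinates only; the pasting lemma turns it into continuity on
  the manifold, to which compactness can be applied.\<close>

lemma continuous_map_charts:
  assumes M: "smooth_manifold_with_boundary M"
    and w: "\<And>k. k \<in> atlas M \<Longrightarrow> continuous_on (cimg k \<times> T) (\<lambda>(p, t). w (cinv k p) t)"
  shows "continuous_map (prod_topology (mtop M) (top_of_set T)) euclideanreal (\<lambda>(x, t). w x t)"
proof (rule pasting_lemma[where I="atlas M" and T="\<lambda>k. fst k \<times> T" and f="\<lambda>k (x, t). w x t"])
  fix k assume k: "k \<in> atlas M"
  show "openin (prod_topology (mtop M) (top_of_set T)) (fst k \<times> T)"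
    using chart_open[OF M k] by (simp add: openin_prod_Times_iff)
  have "continuous_map (subtopology (mtop M) (fst k)) (top_of_set (cimg k)) (snd k)"
    using chart_homeo[OF M k] homeomorphic_imp_continuous_map by blast
  then have "continuous_map (prod_topology (subtopology (mtop M) (fst k)) (top_of_set T))
      (prod_topology (top_of_set (cimg k)) (top_of_set T)) (\<lambda>z. (snd k (fst z), snd z))"
    by (intro continuous_map_pairedI continuous_map_compose[OF continuous_map_fst, unfolded o_def]
        continuous_map_snd)
  then have 1: "continuous_map (prod_topology (subtopology (mtop M) (fst k)) (top_of_set T))
      (top_of_set (cimg k \<times> T)) (\<lambda>z. (snd k (fst z), snd z))" by simp
  have 2: "continuous_map (top_of_set (cimg k \<times> T)) euclideanreal (\<lambda>(p, t). w (cinv k p) t)"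
    using w[OF k] by simp
  have eq: "subtopology (prod_topology (mtop M) (top_of_set T)) (fst k \<times> T)
      = prod_topology (subtopology (mtop M) (fst k)) (top_of_set T)"
    by (simp add: subtopology_Times subtopology_subtopology)
  show "continuous_map (subtopology (prod_topology (mtop M) (top_of_set T)) (fst k \<times> T)) euclideanreal (\<lambda>(x, t). w x t)"
    unfolding eq
    by (rule continuous_map_eq[OF continuous_map_compose[OF 1 2]])
       (auto simp: cinv_chart[OF chart_inj[OF M k]])
next
  show "\<exists>k. k \<in> atlas M \<and> z \<in> fst k \<times> T \<and> (case z of (x, t) \<Rightarrow> w x t) = (case z of (x, t) \<Rightarrow> w x t)"
    if z: "z \<in> topspace (prod_topology (mtop M) (top_of_set T))" for z
  proof -
    have "fst z \<in> topspace (mtop M)" using z by auto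
    then obtain k where "k \<in> atlas M" "fst z \<in> fst k" by (rule chart_exists[OF M])
    then show ?thesis using z by (intro exI[of _ k]) (auto simp: mem_Times_iff)
  qed
qed auto

lemma continuous_map_attains_max:
  assumes X: "compact_space X" "topspace X \<noteq> {}" and F: "continuous_map X euclideanreal F"
  obtains z where "z \<in> topspace X" "\<And>y. y \<in> topspace X \<Longrightarrow> F y \<le> F z"
proof -
  have "compactin euclideanreal (F ` topspace X)"
    using X(1) F image_compactin unfolding compact_space_def by blast
  then have "compact (F ` topspace X)" by simp
  then show ?thesis using compact_attains_sup[of "F ` topspace X"] X(2) that by blast
qed

lemma continuous_map_bounded:
  assumes X: "compact_space X" and F: "continuous_map X euclideanreal F"
  obtains C where "\<And>y. y \<in> topspace X \<Longrightarrow> \<bar>F y\<bar> \<le> C"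
proof -
  have "compactin euclideanreal (F ` topspace X)"
    using X F image_compactin unfolding compact_space_def by blast
  then have "bounded (F ` topspace X)" by (simp add: compact_imp_bounded)
  then show ?thesis using that unfolding bounded_iff by auto
qed

context riem_chart
begin

lemma manifold: "smooth_manifold_with_boundary M"
  using riem unfolding riemannian_manifold_def by blast

lemma gradient_norm2_eq:
  assumes x: "x \<in> fst c"
  shows "grad_norm2 M c w x = normsq (w \<circ> cinv c) (snd c x)"
proof -
  have "grad M c w x = (\<chi> l. gradv (w \<circ> cinv c) l (snd c x))"
    by (simp add: grad_def gradv_def vec_eq_iff matrix_vector_mult_def)
  then show ?thesis
    unfolding grad_norm2_def ginner_def normsq_def inner_vec_def
    by (simp add: matrix_vector_mult_def lower_gradv[OF chart_in_cimg[OF x]])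
qed

lemma laplacianV_eq:
  assumes x: "x \<in> fst c"
  shows "laplacianV M V c w x = lapV V (w \<circ> cinv c) (snd c x)"
proof -
  let ?p = "snd c x"
  have "ginner M c ?p (V c ?p) (grad M c w x) = (\<Sum>i\<in>UNIV. V c ?p $ i * D i (w \<circ> cinv c) ?p)"
    unfolding ginner_def grad_def metric_ginv_vec[OF chart_in_cimg[OF x]] inner_vec_def by simp
  then show ?thesis unfolding laplacianV_def lapV_def laplacian_def lap_def hess_def by simp
qed

text \<open>The energy density as a maximum over tangent vectors: this yields its independence of the
  chart without inverting the differential of the transition map.\<close>

lemma normsq_variational:
  assumes p: "p \<in> S"
  shows "2 * (\<Sum>i\<in>UNIV. v $ i * D i f p) - ginner M c p v v \<le> normsq f p"
    and "2 * (\<Sum>i\<in>UNIV. gradv f i p * D i f p) - ginner M c p (\<chi> i. gradv f i p) (\<chi> i. gradv f i p) = normsq f p"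
proof -
  define z where "z = (\<chi> i. gradv f i p)"
  have g: "metric M c p *v z = (\<chi> i. D i f p)"
    using lower_gradv[OF p] by (simp add: vec_eq_iff matrix_vector_mult_def z_def)
  have zz: "ginner M c p z z = normsq f p"
    unfolding ginner_def g normsq_def by (simp add: z_def inner_vec_def)
  then show "2 * (\<Sum>i\<in>UNIV. gradv f i p * D i f p) - ginner M c p (\<chi> i. gradv f i p) (\<chi> i. gradv f i p) = normsq f p"
    unfolding z_def normsq_def by simp
  have "v \<bullet> (metric M c p *v z) = z \<bullet> (metric M c p *v v)"
    by (metis dot_lmul_matrix inner_commute metric_symmetric p vector_transpose_matrix)
  moreover have "v \<bullet> (metric M c p *v z) = (\<Sum>i\<in>UNIV. v $ i * D i f p)"
    unfolding g by (simp add: inner_vec_def)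
  moreover have "0 \<le> ginner M c p (v - z) (v - z)"
    using metric_pos[OF p, of "v - z"] unfolding ginner_def by (cases "v = z") auto
  ultimately show "2 * (\<Sum>i\<in>UNIV. v $ i * D i f p) - ginner M c p v v \<le> normsq f p"
    using zz unfolding ginner_def by (simp add: matrix_vector_mult_diff_distrib inner_diff_left inner_diff_right)
qed

text \<open>An overlap is relatively open in the chart image and so keeps the orthant property;
  derivatives within it are unique.\<close>

lemma overlap_orthant_open:
  assumes d: "d \<in> atlas M"
  shows "orthant_open (overlap c d)"
proof -
  have "openin (subtopology (mtop M) (fst c)) (fst c \<inter> fst d)"
    using chart_open[OF manifold d] by (simp add: openin_subtopology_Int2)
  then have "openin (top_of_set S) (overlap c d)"
    using chart_homeo[OF manifold in_atlas] homeomorphic_map_openness unfolding overlap_def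
    by (metis homeomorphic_imp_open_map open_map_def)
  then obtain T where "open T" "overlap c d = S \<inter> T" unfolding openin_open by blast
  then show ?thesis using orthant_open_Int[OF orthant_open] open_imp_orthant_open by metis
qed

end

text \<open>The maximising vector of chart \<open>c\<close>, pushed forward by
  \<open>dtrans\<close>, competes in chart \<open>d\<close> with the same length and the same
  pairing with the differential of \<open>w\<close>.\<close>

lemma grad_norm2_le_chart:
  fixes M :: "('a, 'n::finite) riem"
  assumes M: "riemannian_manifold M" and c: "c \<in> atlas M" and d: "d \<in> atlas M"
    and x: "x \<in> fst c" "x \<in> fst d"
    and w: "(w \<circ> cinv c) differentiable_on cimg c" "(w \<circ> cinv d) differentiable_on cimg d"
  shows "grad_norm2 M c w x \<le> grad_norm2 M d w x"
proof -
  interpret C: riem_chart M c by unfold_locales (fact M c)+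
  interpret E: riem_chart M d by unfold_locales (fact M d)+
  let ?p = "snd c x" and ?q = "snd d x" and ?O = "overlap c d" and ?T = "transition c d"
  let ?wc = "w \<circ> cinv c" and ?wd = "w \<circ> cinv d"
  have inj: "inj_on (snd c) (fst c)" "inj_on (snd d) (fst d)"
    using chart_inj[OF C.manifold] c d by auto
  have p: "?p \<in> ?O" "?p \<in> cimg c" "?q \<in> cimg d"
    using x unfolding overlap_def cimg_def by auto
  have sub: "?O \<subseteq> cimg c" unfolding overlap_def cimg_def by blast
  have im: "?T ` ?O \<subseteq> cimg d"
    unfolding transition_def overlap_def cimg_def using cinv_chart[OF inj(1)] by force
  have Tp: "?T ?p = ?q" unfolding transition_def using cinv_chart[OF inj(1) x(1)] by simp
  have "smooth_on ?O ?T"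
    using C.manifold c d unfolding smooth_manifold_with_boundary_def by blast
  then have dT: "(?T has_derivative dtrans c d x) (at ?p within ?O)"
    using smooth_on_imp_differentiable_on p(1) unfolding dtrans_def differentiable_on_def
    by (metis frechet_derivative_works)
  have 1: "((\<lambda>q. ?wd (?T q)) has_derivative (\<lambda>v. \<Sum>i\<in>UNIV. dtrans c d x v $ i * E.D i ?wd ?q)) (at ?p within ?O)"
    using has_derivative_in_compose2[where g="?wd" and t="cimg d" and s="?O" and f="?T"
        and g'="\<lambda>q v. \<Sum>i\<in>UNIV. v $ i * E.D i ?wd q", OF E.has_derivative_pd[OF w(2)] im p(1) dT] Tp by simp
  have e: "?wd (?T q) = ?wc q" if q: "q \<in> ?O" for q
  proof -
    obtain y where y: "y \<in> fst c" "y \<in> fst d" "q = snd c y" using q unfolding overlap_def by blast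
    then show ?thesis unfolding transition_def by (simp add: cinv_chart[OF inj(1)] cinv_chart[OF inj(2)])
  qed
  have 2: "(?wc has_derivative (\<lambda>v. \<Sum>i\<in>UNIV. dtrans c d x v $ i * E.D i ?wd ?q)) (at ?p within ?O)"
    by (rule has_derivative_transform[OF p(1) e[symmetric] 1])
  have 3: "(?wc has_derivative (\<lambda>v. \<Sum>i\<in>UNIV. v $ i * C.D i ?wc ?p)) (at ?p within ?O)"
    by (rule has_derivative_subset[OF C.has_derivative_pd[OF w(1) p(2)] sub])
  \<comment> \<open>Both sides are derivatives of the same function within the overlap: one by
    restriction from the chart image, the other by the chain rule through the transition
    map.\<close>
  have eq: "(\<Sum>i\<in>UNIV. v $ i * C.D i ?wc ?p) = (\<Sum>i\<in>UNIV. dtrans c d x v $ i * E.D i ?wd ?q)" for v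
    using unique_frechet_within[OF C.overlap_orthant_open[OF d] p(1) 3 2] by metis
  define z where "z = (\<chi> i. C.gradv ?wc i ?p)"
  have "C.normsq ?wc ?p = 2 * (\<Sum>i\<in>UNIV. z $ i * C.D i ?wc ?p) - ginner M c ?p z z"
    using C.normsq_variational(2)[OF p(2), of ?wc] unfolding z_def by simp
  also have "\<dots> = 2 * (\<Sum>i\<in>UNIV. dtrans c d x z $ i * E.D i ?wd ?q) - ginner M d ?q (dtrans c d x z) (dtrans c d x z)"
  proof -
    have "z \<bullet> (metric M c ?p *v z) = dtrans c d x z \<bullet> (metric M d ?q *v dtrans c d x z)"
      using M c d x unfolding riemannian_manifold_def by blast
    then show ?thesis unfolding eq ginner_def by simp
  qed
  also have "\<dots> \<le> E.normsq ?wd ?q" by (rule E.normsq_variational(1)[OF p(3)])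
  finally show ?thesis by (simp add: C.gradient_norm2_eq[OF x(1)] E.gradient_norm2_eq[OF x(2)])
qed

lemma grad_norm2_chart:
  fixes M :: "('a, 'n::finite) riem"
  assumes "riemannian_manifold M" "c \<in> atlas M" "d \<in> atlas M" "x \<in> fst c" "x \<in> fst d"
    and "\<And>k. k \<in> atlas M \<Longrightarrow> (w \<circ> cinv k) differentiable_on cimg k"
  shows "grad_norm2 M c w x = grad_norm2 M d w x"
  using grad_norm2_le_chart[OF assms(1-5) assms(6)[OF assms(2)] assms(6)[OF assms(3)]]
    grad_norm2_le_chart[OF assms(1,3,2,5,4) assms(6)[OF assms(3)] assms(6)[OF assms(2)]]
  by simp

section \<open>Regularity of the solution up to the initial time\<close>

lemma at_within_halfline: "t > 0 \<Longrightarrow> at t within {0::real..} = at t"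
  by (rule at_within_interior) simp

text \<open>Here \<open>u\<close> is treated up to t = 0, where time derivatives are one-sided. The
  continuity obtained on the closed half-line of times is what bounds the gradient and the time
  derivative near t = 0.\<close>

locale initial_chart = riem_chart M k for M :: "('a, 'n::finite) riem" and k +
  fixes u :: "'a \<Rightarrow> real \<Rightarrow> real"
  assumes smooth_u: "smooth_spacetime M {0..} u"
begin

abbreviation "U \<equiv> \<lambda>(p, t). u (cinv k p) t"

sublocale one_sided_spacetime S "{0..}"
  by unfold_locales (rule orthant_open_halfline)

lemma smooth_U: "smooth_on (S \<times> {0..}) U"
  using smooth_u in_atlas unfolding smooth_spacetime_def by blast

lemma U_slice_differentiable: assumes "t \<ge> 0" shows "((\<lambda>y. u y t) \<circ> cinv k) differentiable_on S"
  using slice_differentiable_on[OF smooth_on_imp_differentiable_on[OF smooth_U], of t] assms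
  by (simp add: o_def)

lemma dt_eq:
  assumes p: "p \<in> S" and t: "t \<ge> 0"
  shows "dt u (cinv k p) t = time_deriv S {0..} U (p, t)"
proof -
  have "((\<lambda>s. U (p, s)) has_real_derivative time_deriv S {0..} U (p, t)) (at t within {0..})"
    by (rule time_slice[OF smooth_on_imp_differentiable_on[OF smooth_U] p]) (use t in auto)
  then have "(u (cinv k p) has_vector_derivative time_deriv S {0..} U (p, t)) (at t within {0..})"
    by (simp add: has_real_derivative_iff_has_vector_derivative)
  moreover have "at t within {0..} \<noteq> bot"
  proof -
    have "at_right t \<le> at t within {0..}" by (rule at_le) (use t in auto)
    then show ?thesis using trivial_limit_at_right_real[of t] by (auto simp: bot_unique)
  qed
  ultimately show ?thesis unfolding dt_def by (intro vector_derivative_within)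
qed

lemma continuous_on_dt: "continuous_on (S \<times> {0..}) (\<lambda>(p, t). dt u (cinv k p) t)"
proof -
  have "continuous_on (S \<times> {0..}) (time_deriv S {0..} U)"
    by (rule smooth_on_imp_continuous_on[OF smooth_on_time_deriv[OF smooth_U]])
  then show ?thesis by (rule continuous_on_eq) (auto simp: dt_eq)
qed

lemma continuous_on_grad_norm2:
  "continuous_on (S \<times> {0..}) (\<lambda>(p, t). grad_norm2 M k (\<lambda>y. u y t) (cinv k p))"
proof -
  have G: "continuous_on (S \<times> {0..}) (\<lambda>z. G i j (fst z))" for i j
    by (rule continuous_on_compose2[OF differentiable_imp_continuous_on[OF G_differentiable]])
       (auto intro: continuous_intros)
  have X: "continuous_on (S \<times> {0..}) (space_deriv S {0..} i U)" for i
    by (rule smooth_on_imp_continuous_on[OF smooth_on_space_deriv[OF smooth_U]])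
  have "continuous_on (S \<times> {0..}) (\<lambda>z. \<Sum>l\<in>UNIV. (\<Sum>j\<in>UNIV. G l j (fst z) * space_deriv S {0..} j U z) * space_deriv S {0..} l U z)"
    by (intro continuous_on_sum continuous_on_mult G X)
  then show ?thesis
  proof (rule continuous_on_eq)
    fix z assume "z \<in> S \<times> {0::real..}"
    then obtain p t where z: "z = (p, t)" "p \<in> S" "t \<ge> 0" by auto
    have "D i ((\<lambda>y. u y t) \<circ> cinv k) p = space_deriv S {0..} i U (p, t)" for i
      using pd_slice[OF smooth_on_imp_differentiable_on[OF smooth_U] z(2), of t i] z(3) by (simp add: o_def)
    then have "normsq ((\<lambda>y. u y t) \<circ> cinv k) p
      = (\<Sum>l\<in>UNIV. (\<Sum>j\<in>UNIV. G l j (fst z) * space_deriv S {0..} j U z) * space_deriv S {0..} l U z)"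
      unfolding normsq_def gradv_def z(1) by simp
    then show "(\<Sum>l\<in>UNIV. (\<Sum>j\<in>UNIV. G l j (fst z) * space_deriv S {0..} j U z) * space_deriv S {0..} l U z)
      = (case z of (p, t) \<Rightarrow> grad_norm2 M k (\<lambda>y. u y t) (cinv k p))"
      using gradient_norm2_eq[OF chart_cinv(2)[OF z(2)]] by (simp add: z(1) chart_cinv(1)[OF z(2)])
  qed
qed

end

section \<open>The equation and the Neumann condition for the logarithm of the solution\<close>

locale solution_chart = initial_chart M k u for M :: "('a, 'n::finite) riem" and k and u :: "'a \<Rightarrow> real \<Rightarrow> real" +
  fixes V :: "('a, 'n) vfield" and m K :: real and H :: "real \<Rightarrow> real"
  assumes V: "C1_vector_field M V" and ric: "ricVm_ge M V m (- K)" and m: "m > real CARD('n)"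
    and sol: "smooth_positive_solution M V H u"
    and smooth_f: "smooth_spacetime M {0<..} (\<lambda>x t. ln (u x t))"
    and h: "\<exists>I. open I \<and> is_interval I \<and> (\<forall>x\<in>topspace (mtop M). \<forall>t>0. ln (u x t) \<in> I)
      \<and> Ck_on 2 I (\<lambda>s. H (exp s) / exp s)"
begin

abbreviation "W \<equiv> \<lambda>(p, t). ln (u (cinv k p) t)"

lemma chart_topspace: "p \<in> S \<Longrightarrow> cinv k p \<in> topspace (mtop M)"
  using chart_subset[OF manifold in_atlas] chart_cinv(2) by blast

lemma u_pos: "p \<in> S \<Longrightarrow> t \<ge> 0 \<Longrightarrow> u (cinv k p) t > 0"
  using sol chart_topspace unfolding smooth_positive_solution_def by blast

lemma smooth_W: "smooth_on (S \<times> {0<..}) W"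
  using smooth_f in_atlas unfolding smooth_spacetime_def by blast

interpretation P: one_sided_spacetime S "{0<..}"
  by unfold_locales (rule orthant_open_halfline)

lemma W_slice_diff1: assumes t: "t > 0" shows "diff1 (\<lambda>q. W (q, t))"
proof -
  have d: "(\<lambda>q. Z (q, t)) differentiable_on S" if "smooth_on (S \<times> {0<..}) Z" for Z :: "(real^'n) \<times> real \<Rightarrow> real"
    using P.slice_differentiable_on[OF smooth_on_imp_differentiable_on[OF that]] t by simp
  have "D i (\<lambda>q. W (q, t)) differentiable_on S" for i
    by (rule differentiable_on_cong[OF d[OF smooth_on_space_deriv[OF smooth_W, of i]]])
       (rule P.pd_slice[OF smooth_on_imp_differentiable_on[OF smooth_W], symmetric], use t in auto)
  then show ?thesis unfolding diff1_def using d[OF smooth_W] by blast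
qed

lemma u_slice: "p \<in> S \<Longrightarrow> t > 0 \<Longrightarrow> ((\<lambda>y. u y t) \<circ> cinv k) p = exp (W (p, t))"
  using u_pos[of p t] by simp

lemma pd_u: assumes p: "p \<in> S" and t: "t > 0"
  shows "D i ((\<lambda>y. u y t) \<circ> cinv k) p = u (cinv k p) t * D i (\<lambda>q. W (q, t)) p"
proof -
  have "D i ((\<lambda>y. u y t) \<circ> cinv k) p = D i (\<lambda>q. exp (W (q, t))) p"
    by (rule pd_cong[OF u_slice[OF _ t] p])
  also have "\<dots> = exp (W (p, t)) * D i (\<lambda>q. W (q, t)) p"
    by (rule pd_compose_real[OF diff1D(1)[OF W_slice_diff1[OF t]] DERIV_exp p])
  finally show ?thesis using u_pos[OF p, of t] t by simp
qed

lemma normsq_u: assumes p: "p \<in> S" and t: "t > 0"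
  shows "normsq ((\<lambda>y. u y t) \<circ> cinv k) p = (u (cinv k p) t)\<^sup>2 * normsq (\<lambda>q. W (q, t)) p"
  unfolding normsq_def gradv_def pd_u[OF p t]
  by (simp add: sum_distrib_left sum_distrib_right power2_eq_square mult_ac)

text \<open>The second derivative of the exponential in the chain rule is the source of the squared
  gradient in the equation for f = ln u.\<close>

lemma lapV_u: assumes p: "p \<in> S" and t: "t > 0"
  shows "lapV V ((\<lambda>y. u y t) \<circ> cinv k) p
    = u (cinv k p) t * (lapV V (\<lambda>q. W (q, t)) p + normsq (\<lambda>q. W (q, t)) p)"
proof -
  have 1: "D j ((\<lambda>y. u y t) \<circ> cinv k) q = D j (\<lambda>q. exp (W (q, t))) q" if "q \<in> S" for j q
    by (rule pd_cong[OF u_slice[OF _ t] that])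
  have 2: "D i (D j ((\<lambda>y. u y t) \<circ> cinv k)) p = D i (D j (\<lambda>q. exp (W (q, t)))) p" for i j
    by (rule pd_cong[OF 1 p])
  have "lapV V ((\<lambda>y. u y t) \<circ> cinv k) p = lapV V (\<lambda>q. exp (W (q, t))) p"
    unfolding lapV_def lap_def hess_def 2 1[OF p] ..
  also have "\<dots> = exp (W (p, t)) * lapV V (\<lambda>q. W (q, t)) p + exp (W (p, t)) * normsq (\<lambda>q. W (q, t)) p"
    by (rule lapV_compose[OF W_slice_diff1[OF t] p DERIV_exp DERIV_exp])
  finally show ?thesis using u_pos[OF p, of t] t by (simp add: distrib_left)
qed

lemma dt_u: assumes p: "p \<in> S" and t: "t > 0"
  shows "dt u (cinv k p) t = u (cinv k p) t * time_deriv S {0<..} W (p, t)"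
proof -
  have "((\<lambda>s. W (p, s)) has_real_derivative time_deriv S {0<..} W (p, t)) (at t within {0<..})"
    by (rule P.time_slice[OF smooth_on_imp_differentiable_on[OF smooth_W] p]) (use t in auto)
  moreover have "at t within {0<..} = at t" using t by (intro at_within_open) auto
  ultimately have "((\<lambda>s. exp (W (p, s))) has_real_derivative exp (W (p, t)) * time_deriv S {0<..} W (p, t)) (at t)"
    using DERIV_chain2[OF DERIV_exp] by metis
  then have "(u (cinv k p) has_real_derivative exp (W (p, t)) * time_deriv S {0<..} W (p, t)) (at t)"
    by (rule DERIV_cong_pos[OF _ t]) (use u_pos[OF p] in auto)
  then have "(u (cinv k p) has_vector_derivative exp (W (p, t)) * time_deriv S {0<..} W (p, t)) (at t)"
    by (simp only: has_real_derivative_iff_has_vector_derivative)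
  then show ?thesis
    unfolding dt_def at_within_halfline[OF t] using u_pos[OF p, of t] t by (simp add: vector_derivative_at)
qed

text \<open>The equation for \<open>u\<close> divided by \<open>u\<close>, which is positive; exp
  (ln u) = u identifies the quotient of \<open>H\<close> with \<open>h\<close>.\<close>

lemma flow:
  assumes I: "open I" "\<forall>x\<in>topspace (mtop M). \<forall>t>0. ln (u x t) \<in> I" "Ck_on 2 I (\<lambda>s. H (exp s) / exp s)"
  shows "chart_flow M k V m K (\<lambda>s. H (exp s) / exp s) I W"
proof unfold_locales
  show "Ck_on 1 S (V k)" using V in_atlas unfolding C1_vector_field_def by blast
  show "W (p, t) \<in> I" if "p \<in> S" "t > 0" for p t
    using I(2) chart_topspace[OF that(1)] that(2) by simp
  fix p and t :: real assume p: "p \<in> S" and t: "t > 0"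
  let ?x = "cinv k p"
  have "dt u ?x t = laplacianV M V k (\<lambda>y. u y t) ?x + H (u ?x t)"
    using sol in_atlas chart_cinv(2)[OF p] t unfolding smooth_positive_solution_def by simp
  also have "laplacianV M V k (\<lambda>y. u y t) ?x = u ?x t * (lapV V (\<lambda>q. W (q, t)) p + normsq (\<lambda>q. W (q, t)) p)"
    using laplacianV_eq[OF chart_cinv(2)[OF p]] lapV_u[OF p t] by (simp add: chart_cinv(1)[OF p])
  finally have "u ?x t * time_deriv S {0<..} W (p, t)
    = u ?x t * (lapV V (\<lambda>q. W (q, t)) p + normsq (\<lambda>q. W (q, t)) p) + H (u ?x t)"
    unfolding dt_u[OF p t] .
  then show "time_deriv S {0<..} W (p, t) = lapV V (\<lambda>q. W (q, t)) p + normsq (\<lambda>q. W (q, t)) p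
      + H (exp (W (p, t))) / exp (W (p, t))"
    using u_pos[OF p, of t] t by (simp add: field_simps)
qed (use I ric m smooth_W in auto)

lemma neumann_W:
  assumes neu: "neumann_condition M u" and p: "p \<in> S" "p \<notin> interior S" and t: "t > 0"
  shows "(\<Sum>i\<in>UNIV. outer_normal M k p $ i * D i (\<lambda>q. W (q, t)) p) = 0"
proof -
  have "normal_deriv M k (\<lambda>y. u y t) (cinv k p) = 0"
    using neu in_atlas chart_cinv[OF p(1)] p(2) t unfolding neumann_condition_def by auto
  then have "u (cinv k p) t * (\<Sum>i\<in>UNIV. outer_normal M k p $ i * D i (\<lambda>q. W (q, t)) p) = 0"
    unfolding normal_deriv_def chart_cinv(1)[OF p(1)] pd_u[OF p(1) t] by (simp add: sum_distrib_left mult_ac)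
  then show ?thesis using u_pos[OF p(1), of t] t by simp
qed

end

section \<open>The maximum principle on the compact manifold\<close>

theorem theorem2p1:
  fixes M :: "('a, 'n::finite) riem"
    and V :: "('a, 'n) vfield"
    and m K :: real
    and H \<gamma> \<alpha> \<phi> c :: "real \<Rightarrow> real"
    and u :: "'a \<Rightarrow> real \<Rightarrow> real"
  defines "f \<equiv> \<lambda>x t. ln (u x t)"
    and "h \<equiv> \<lambda>s. H (exp s) / exp s"
  assumes "closed_riemannian_manifold M \<or>
      (compact_riemannian_manifold_convex_boundary M \<and> neumann_condition M u)"
    and "C1_vector_field M V"
    and "m > real CARD('n)" and "K \<ge> 0"
    and "ricVm_ge M V m (- K)"
    and "Ck_on 2 {0<..} H"
    and "smooth_positive_solution M V H u"
    and "smooth_on {0<..} \<gamma>" and "smooth_on {0<..} \<alpha>"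
    and "smooth_on {0<..} \<phi>" and "smooth_on {0<..} c"
    and "A2_system M m K \<gamma> \<alpha> \<phi> c h f"
  shows "\<forall>k\<in>atlas M. \<forall>x\<in>fst k. \<forall>t>0.
      \<gamma> t * (grad_norm2 M k (\<lambda>y. u y t) x / (u x t)\<^sup>2) - \<alpha> t * (dt u x t / u x t)
        + \<alpha> t * h (f x t) - \<phi> t \<le> 0"
proof (rule ccontr)
  assume "\<not> ?thesis"
  then obtain k1 x1 t1 where k1: "k1 \<in> atlas M" "x1 \<in> fst k1" and t1: "t1 > 0"
    and pos1: "\<gamma> t1 * (grad_norm2 M k1 (\<lambda>y. u y t1) x1 / (u x1 t1)\<^sup>2) - \<alpha> t1 * (dt u x1 t1 / u x1 t1)
        + \<alpha> t1 * h (f x1 t1) - \<phi> t1 > 0"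
    by (auto simp: not_le)
  have M: "riemannian_manifold M" and compact: "compact_space (mtop M)"
    using assms(3) unfolding closed_riemannian_manifold_def compact_riemannian_manifold_convex_boundary_def by auto
  then have mf: "smooth_manifold_with_boundary M" unfolding riemannian_manifold_def by blast
  have A1: "A1_system M m K \<gamma> \<alpha> \<phi> c h f"
    and lims: "\<exists>l. (\<alpha> \<longlongrightarrow> l) (at_right 0)" "\<exists>l. (\<gamma> \<longlongrightarrow> l) (at_right 0)" "filterlim \<phi> at_top (at_right 0)"
    using assms(14) unfolding A2_system_def by auto
  have smooth_f: "smooth_spacetime M {0<..} (\<lambda>x t. ln (u x t))"
    using A1 unfolding A1_system_def f_def by blast
  have upos: "u x t > 0" if "x \<in> topspace (mtop M)" "t \<ge> 0" for x t
    using assms(9) that unfolding smooth_positive_solution_def by blast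
  obtain I where I: "open I" "is_interval I" "\<forall>x\<in>topspace (mtop M). \<forall>t>0. ln (u x t) \<in> I" "Ck_on 2 I h"
    using A1 unfolding A1_system_def f_def by blast
  have chart: "solution_chart M k u V m K H" if "k \<in> atlas M" for k
    by unfold_locales (use that M assms(4,5,7,9) smooth_f I in
        \<open>auto simp: smooth_positive_solution_def h_def\<close>)

  \<comment> \<open>\<open>grad_norm2\<close> refers to a chart. Choosing one at each point yields a
    single function on the manifold, as a global maximum requires; \<open>grad\<close> shows that
    the choice is immaterial.\<close>
  define B where "B x t = grad_norm2 M (SOME k. k \<in> atlas M \<and> x \<in> fst k) (\<lambda>y. u y t) x / (u x t)\<^sup>2" for x t
  define A where "A x t = dt u x t / u x t" for x t
  \<comment> \<open>This is h(f) written through \<open>u\<close>: continuity of \<open>H\<close>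
    then gives continuity up to t = 0, where \<open>I\<close> is not known to contain the value of
    \<open>f\<close>.\<close>
  define L where "L x t = H (u x t) / u x t" for x t
  define \<Psi> where "\<Psi> x t = \<gamma> t * B x t - \<alpha> t * A x t + \<alpha> t * L x t - \<phi> t" for x t
  have grad: "grad_norm2 M (SOME k. k \<in> atlas M \<and> x \<in> fst k) (\<lambda>y. u y t) x = grad_norm2 M k (\<lambda>y. u y t) x"
    if k: "k \<in> atlas M" "x \<in> fst k" and t: "t \<ge> 0" for k x t
  proof -
    have 1: "(SOME k. k \<in> atlas M \<and> x \<in> fst k) \<in> atlas M \<and> x \<in> fst (SOME k. k \<in> atlas M \<and> x \<in> fst k)"
      by (rule someI[of "\<lambda>k. k \<in> atlas M \<and> x \<in> fst k"]) (use k in blast)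
    show ?thesis
    proof (rule grad_norm2_chart[OF M])
      fix d assume "d \<in> atlas M"
      then interpret solution_chart M d u V m K H by (rule chart)
      show "((\<lambda>y. u y t) \<circ> cinv d) differentiable_on cimg d" by (rule U_slice_differentiable[OF t])
    qed (use 1 k in auto)
  qed

  have cont: "continuous_on (cimg k \<times> {0..}) (\<lambda>(p, t). B (cinv k p) t)"
    "continuous_on (cimg k \<times> {0..}) (\<lambda>(p, t). A (cinv k p) t)"
    "continuous_on (cimg k \<times> {0..}) (\<lambda>(p, t). L (cinv k p) t)" if k: "k \<in> atlas M" for k
  proof -
    interpret solution_chart M k u V m K H by (rule chart[OF k])
    have cu: "continuous_on (cimg k \<times> {0..}) U" by (rule smooth_on_imp_continuous_on[OF smooth_U])
    have u0: "U z > 0" if "z \<in> cimg k \<times> {0..}" for z using u_pos that by auto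
    have u1: "\<forall>z\<in>cimg k \<times> {0..}. U z \<noteq> 0" "\<forall>z\<in>cimg k \<times> {0..}. (U z)\<^sup>2 \<noteq> 0"
      using u0 by (metis less_irrefl, metis less_irrefl power_eq_0_iff)
    have "H differentiable_on {0<..}" using assms(8) by (simp add: numeral_2_eq_2)
    then have cH: "continuous_on {0<..} H" by (rule differentiable_imp_continuous_on)
    have "continuous_on (cimg k \<times> {0..}) (\<lambda>z. H (U z))"
      by (rule continuous_on_compose2[OF cH cu]) (use u0 in auto)
    then have "continuous_on (cimg k \<times> {0..}) (\<lambda>z. H (U z) / U z)"
      by (intro continuous_on_divide cu u1)
    then show "continuous_on (cimg k \<times> {0..}) (\<lambda>(p, t). L (cinv k p) t)"
      by (rule continuous_on_eq) (auto simp: L_def)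
    have "continuous_on (cimg k \<times> {0..}) (\<lambda>z. (\<lambda>(p, t). dt u (cinv k p) t) z / U z)"
      by (intro continuous_on_divide continuous_on_dt cu u1)
    then show "continuous_on (cimg k \<times> {0..}) (\<lambda>(p, t). A (cinv k p) t)"
      by (rule continuous_on_eq) (auto simp: A_def)
    have "continuous_on (cimg k \<times> {0..}) (\<lambda>z. (\<lambda>(p, t). grad_norm2 M k (\<lambda>y. u y t) (cinv k p)) z / (U z)\<^sup>2)"
      by (intro continuous_on_divide continuous_on_grad_norm2 continuous_on_power cu u1)
    then show "continuous_on (cimg k \<times> {0..}) (\<lambda>(p, t). B (cinv k p) t)"
      by (rule continuous_on_eq) (auto simp: B_def grad[OF k chart_cinv(2)])
  qed

  have cpt: "compact_space (prod_topology (mtop M) (top_of_set {a..b::real}))" for a b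
    using compact by (simp add: compact_space_prod_topology compact_space_subtopology)
  have top: "topspace (prod_topology (mtop M) (top_of_set {a..b::real})) = topspace (mtop M) \<times> {a..b}" for a b
    by simp
  \<comment> \<open>Compactness and continuity up to t = 0 give bounds on a time interval that
    includes 0; its right end 1 is arbitrary.\<close>
  have bound: "\<exists>C. \<forall>x\<in>topspace (mtop M). \<forall>t\<in>{0..1::real}. \<bar>w x t\<bar> \<le> C"
    if "\<And>k. k \<in> atlas M \<Longrightarrow> continuous_on (cimg k \<times> {0..}) (\<lambda>(p, t). w (cinv k p) t)" for w :: "'a \<Rightarrow> real \<Rightarrow> real"
  proof -
    have "continuous_map (prod_topology (mtop M) (top_of_set {0..1::real})) euclideanreal (\<lambda>(x, t). w x t)"
      by (rule continuous_map_charts[OF mf]) (rule continuous_on_subset[OF that], auto)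
    then obtain C where C: "\<And>y. y \<in> topspace (prod_topology (mtop M) (top_of_set {0..1::real})) \<Longrightarrow> \<bar>(\<lambda>(x, t). w x t) y\<bar> \<le> C"
      by (rule continuous_map_bounded[OF cpt]) blast
    have "\<bar>w x t\<bar> \<le> C" if "x \<in> topspace (mtop M)" "t \<in> {0..1}" for x t
      using C[of "(x, t)"] that unfolding top by simp
    then show ?thesis by blast
  qed
  obtain CB where CB: "\<forall>x\<in>topspace (mtop M). \<forall>t\<in>{0..1::real}. \<bar>B x t\<bar> \<le> CB" using bound[OF cont(1)] by blast
  obtain CA where CA: "\<forall>x\<in>topspace (mtop M). \<forall>t\<in>{0..1::real}. \<bar>A x t\<bar> \<le> CA" using bound[OF cont(2)] by blast
  obtain CL where CL: "\<forall>x\<in>topspace (mtop M). \<forall>t\<in>{0..1::real}. \<bar>L x t\<bar> \<le> CL" using bound[OF cont(3)] by blast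

  have "\<exists>\<epsilon>>0. \<forall>x\<in>topspace (mtop M). \<forall>t. 0 < t \<longrightarrow> t < \<epsilon> \<longrightarrow> \<Psi> x t < 0"
  proof -
    obtain la lg where la: "(\<alpha> \<longlongrightarrow> la) (at_right 0)" and lg: "(\<gamma> \<longlongrightarrow> lg) (at_right 0)" using lims by blast
    \<comment> \<open>Near t = 0 the limits bound the absolute values of \<alpha> and \<gamma> by
      those of \<open>la\<close> and \<open>lg\<close> plus 1, so \<open>R\<close> dominates all
      terms other than \<phi>, and \<phi> exceeds \<open>R\<close> for small times.\<close>
    define R where "R = (\<bar>lg\<bar> + 1) * CB + (\<bar>la\<bar> + 1) * CA + (\<bar>la\<bar> + 1) * CL"
    have "eventually (\<lambda>t. \<bar>\<alpha> t\<bar> < \<bar>la\<bar> + 1) (at_right 0)"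
      by (rule order_tendstoD(2)[OF tendsto_rabs[OF la]]) simp
    moreover have "eventually (\<lambda>t. \<bar>\<gamma> t\<bar> < \<bar>lg\<bar> + 1) (at_right 0)"
      by (rule order_tendstoD(2)[OF tendsto_rabs[OF lg]]) simp
    moreover have "eventually (\<lambda>t. \<phi> t > R) (at_right 0)"
      using lims(3) unfolding filterlim_at_top_dense by blast
    moreover have "eventually (\<lambda>t::real. t < 1) (at_right 0)"
      unfolding eventually_at_right_field by (intro exI[of _ 1]) auto
    ultimately have "eventually (\<lambda>t. \<bar>\<alpha> t\<bar> < \<bar>la\<bar> + 1 \<and> \<bar>\<gamma> t\<bar> < \<bar>lg\<bar> + 1 \<and> \<phi> t > R \<and> t < 1) (at_right 0)"
      by (intro eventually_conj)
    then obtain \<epsilon> where \<epsilon>: "\<epsilon> > 0" "\<And>t. 0 < t \<Longrightarrow> t < \<epsilon> \<Longrightarrow> \<bar>\<alpha> t\<bar> < \<bar>la\<bar> + 1 \<and> \<bar>\<gamma> t\<bar> < \<bar>lg\<bar> + 1 \<and> \<phi> t > R \<and> t < 1"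
      unfolding eventually_at_right_field by blast
    have "\<Psi> x t < 0" if x: "x \<in> topspace (mtop M)" and t: "0 < t" "t < \<epsilon>" for x t
    proof -
      note e = \<epsilon>(2)[OF t]
      have b: "\<bar>B x t\<bar> \<le> CB" "\<bar>A x t\<bar> \<le> CA" "\<bar>L x t\<bar> \<le> CL" using CB CA CL x t e by auto
      have 1: "\<bar>\<gamma> t * B x t\<bar> \<le> (\<bar>lg\<bar> + 1) * CB"
        unfolding abs_mult using e b(1) by (intro mult_mono) auto
      have 2: "\<bar>\<alpha> t * A x t\<bar> \<le> (\<bar>la\<bar> + 1) * CA"
        unfolding abs_mult using e b(2) by (intro mult_mono) auto
      have 3: "\<bar>\<alpha> t * L x t\<bar> \<le> (\<bar>la\<bar> + 1) * CL"
        unfolding abs_mult using e b(3) by (intro mult_mono) auto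
      show ?thesis unfolding \<Psi>_def using 1 2 3 e unfolding R_def by linarith
    qed
    then show ?thesis using \<epsilon>(1) by blast
  qed
  then obtain \<epsilon> where \<epsilon>: "\<epsilon> > 0" "\<And>x t. x \<in> topspace (mtop M) \<Longrightarrow> 0 < t \<Longrightarrow> t < \<epsilon> \<Longrightarrow> \<Psi> x t < 0" by blast

  have \<Psi>: "\<Psi> x t = \<gamma> t * (grad_norm2 M k (\<lambda>y. u y t) x / (u x t)\<^sup>2) - \<alpha> t * (dt u x t / u x t)
        + \<alpha> t * h (f x t) - \<phi> t" if "k \<in> atlas M" "x \<in> fst k" "t > 0" for k x t
  proof -
    have "exp (ln (u x t)) = u x t"
      using upos chart_subset[OF mf that(1)] that(2,3) by (intro exp_ln) auto
    then show ?thesis unfolding \<Psi>_def B_def A_def L_def h_def f_def using grad[OF that(1,2)] that(3) by simp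
  qed
  have x1: "x1 \<in> topspace (mtop M)" using chart_subset[OF mf k1(1)] k1(2) by blast
  have "\<Psi> x1 t1 > 0" using pos1 \<Psi>[OF k1 t1] by simp
  \<comment> \<open>Half the minimum lies strictly below both: at time \<open>a\<close> the quantity
    is still negative, and \<open>t1\<close> belongs to the interval.\<close>
  define a where "a = min \<epsilon> t1 / 2"
  have a: "0 < a" "a < \<epsilon>" "a < t1" using \<epsilon>(1) t1 by (auto simp: a_def)

  have diff: "\<gamma> differentiable_on {0<..}" "\<alpha> differentiable_on {0<..}" "\<phi> differentiable_on {0<..}"
    using assms(10-12) smooth_on_imp_differentiable_on by auto
  have deriv: "(w has_real_derivative deriv w t) (at t)" if "w differentiable_on {0<..}" "t > 0" for w :: "real \<Rightarrow> real" and t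
    using that at_within_open[of t "{0<..}"]
    by (metis DERIV_deriv_iff_real_differentiable differentiable_on_def greaterThan_iff open_greaterThan)
  have cont\<Psi>: "continuous_map (prod_topology (mtop M) (top_of_set {a..t1})) euclideanreal (\<lambda>(x, t). \<Psi> x t)"
  proof (rule continuous_map_charts[OF mf])
    fix k assume k: "k \<in> atlas M"
    have s: "cimg k \<times> {a..t1} \<subseteq> cimg k \<times> {0..}" using a by auto
    have w: "continuous_on (cimg k \<times> {a..t1}) (\<lambda>z. w (snd z))" if "w differentiable_on {0<..}" for w :: "real \<Rightarrow> real"
      by (rule continuous_on_compose2[OF differentiable_imp_continuous_on[OF that]])
         (use a in \<open>auto intro: continuous_intros\<close>)
    have "continuous_on (cimg k \<times> {a..t1}) (\<lambda>z. \<gamma> (snd z) * (\<lambda>(p, t). B (cinv k p) t) z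
      - \<alpha> (snd z) * (\<lambda>(p, t). A (cinv k p) t) z + \<alpha> (snd z) * (\<lambda>(p, t). L (cinv k p) t) z - \<phi> (snd z))"
      by (intro continuous_on_add continuous_on_diff continuous_on_mult w diff continuous_on_subset[OF cont(1)[OF k] s]
          continuous_on_subset[OF cont(2)[OF k] s] continuous_on_subset[OF cont(3)[OF k] s])
    then show "continuous_on (cimg k \<times> {a..t1}) (\<lambda>(p, t). \<Psi> (cinv k p) t)"
      by (rule continuous_on_eq) (auto simp: \<Psi>_def)
  qed
  have ne: "topspace (prod_topology (mtop M) (top_of_set {a..t1})) \<noteq> {}"
    unfolding top using x1 a by auto
  obtain z where z': "z \<in> topspace (prod_topology (mtop M) (top_of_set {a..t1}))"
    "\<And>y. y \<in> topspace (prod_topology (mtop M) (top_of_set {a..t1})) \<Longrightarrow> (\<lambda>(x, t). \<Psi> x t) y \<le> (\<lambda>(x, t). \<Psi> x t) z"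
    by (rule continuous_map_attains_max[OF cpt ne cont\<Psi>]) blast
  note z = z'[unfolded top]
  obtain x0 t0 where z0: "z = (x0, t0)" by fastforce
  have x0: "x0 \<in> topspace (mtop M)" and t0: "a \<le> t0" "t0 \<le> t1" using z(1) by (auto simp: z0)
  have max: "\<Psi> x t \<le> \<Psi> x0 t0" if "x \<in> topspace (mtop M)" "a \<le> t" "t \<le> t1" for x t
    using z(2)[of "(x, t)"] that by (simp add: z0)
  have pos0: "\<Psi> x0 t0 > 0" using max[OF x1, of t1] \<open>\<Psi> x1 t1 > 0\<close> a by simp
  \<comment> \<open>The maximum is positive, so it is not attained at time \<open>a\<close>. The
    times between \<open>a\<close> and \<open>t0\<close> then provide the comparison with the past;
    t0 = t1 remains possible.\<close>
  have "a < t0"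
  proof (rule ccontr)
    assume "\<not> a < t0"
    then have "\<Psi> x0 t0 < 0" using t0 a by (intro \<epsilon>(2)[OF x0]) auto
    then show False using pos0 by simp
  qed
  then have t0pos: "t0 > 0" using a by simp

  \<comment> \<open>Any chart around the maximum point will do, since a maximum over the manifold is
    also one over the chart image.\<close>
  obtain k where k: "k \<in> atlas M" "x0 \<in> fst k" by (rule chart_exists[OF mf x0])
  interpret N: solution_chart M k u V m K H by (rule chart[OF k(1)])
  interpret F: chart_flow M k V m K h I N.W
    unfolding h_def by (rule N.flow) (use I h_def in auto)
  define p where "p = snd k x0"
  have p: "p \<in> cimg k" and x0p: "cinv k p = x0"
    unfolding p_def using chart_in_cimg[OF k(2)] cinv_chart[OF chart_inj[OF mf k(1)] k(2)] by auto
  have har: "F.harnack \<gamma> \<alpha> \<phi> q t = \<Psi> (cinv k q) t" if q: "q \<in> cimg k" and t: "t > 0" for q t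
  proof -
    have up: "u (cinv k q) t > 0" using N.u_pos[OF q] t by simp
    have "grad_norm2 M k (\<lambda>y. u y t) (cinv k q) / (u (cinv k q) t)\<^sup>2 = N.normsq (\<lambda>q. N.W (q, t)) q"
      using N.gradient_norm2_eq[OF chart_cinv(2)[OF q], of "\<lambda>y. u y t"] N.normsq_u[OF q t] up
      by (simp add: chart_cinv(1)[OF q])
    then show ?thesis
      unfolding F.harnack_def \<Psi>[OF k(1) chart_cinv(2)[OF q] t] N.dt_u[OF q t] f_def using up by simp
  qed
  have A1': "4 * \<gamma> t0 / m * c t0 + (\<alpha> t0 - \<gamma> t0) * deriv h (f x0 t0) + \<alpha> t0 * deriv (deriv h) (f x0 t0)
            - 2 * K * \<gamma> t0 - deriv \<gamma> t0
          \<ge> \<gamma> t0 / \<alpha> t0 * (4 * \<gamma> t0 / m * c t0 - deriv \<alpha> t0)"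
        "deriv \<phi> t0 - 2 * \<gamma> t0 / m * (c t0)\<^sup>2
            + \<phi> t0 / \<alpha> t0 * (4 * \<gamma> t0 / m * c t0 - \<alpha> t0 * deriv h (f x0 t0) - deriv \<alpha> t0) \<ge> 0"
        "4 * \<gamma> t0 / m * c t0 - \<alpha> t0 * deriv h (f x0 t0) - deriv \<alpha> t0 > 0" "\<alpha> t0 > 0" "\<gamma> t0 > 0"
    using A1 x0 t0pos unfolding A1_system_def by auto
  have "F.harnack \<gamma> \<alpha> \<phi> p t0 \<le> 0"
  proof (rule F.no_positive_max[OF p t0pos assms(6) deriv[OF diff(1) t0pos] deriv[OF diff(2) t0pos] deriv[OF diff(3) t0pos],
        where k="c t0" and r=a])
    show "F.harnack \<gamma> \<alpha> \<phi> q t0 \<le> F.harnack \<gamma> \<alpha> \<phi> p t0" if "q \<in> cimg k" for q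
      using max[OF N.chart_topspace[OF that], of t0] t0 by (simp add: har that p t0pos x0p)
    show "F.harnack \<gamma> \<alpha> \<phi> p s \<le> F.harnack \<gamma> \<alpha> \<phi> p t0" if "a < s" "s < t0" for s
      using max[OF x0, of s] that t0 a by (simp add: har p t0pos x0p)
    \<comment> \<open>A non-interior chart point belongs to \<open>bdry M\<close>, which is empty in
      the closed case, so only the alternative with convex boundary and Neumann condition is
      left.\<close>
    have edge: "compact_riemannian_manifold_convex_boundary M \<and> neumann_condition M u" if "p \<notin> interior (cimg k)"
    proof -
      have "x0 \<in> bdry M" unfolding bdry_def using k that p_def by blast
      then show ?thesis using assms(3) unfolding closed_riemannian_manifold_def by blast
    qed
    show "convex_boundary M" if "p \<notin> interior (cimg k)"
      using edge[OF that] unfolding compact_riemannian_manifold_convex_boundary_def by blast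
    show "(\<Sum>i\<in>UNIV. outer_normal M k q $ i * pd (cimg k) i (\<lambda>q. N.W (q, s)) q) = 0"
      if "p \<notin> interior (cimg k)" "q \<in> cimg k" "q \<notin> interior (cimg k)" "s > 0" for q s
      by (rule N.neumann_W) (use edge that in auto)
  qed (use A1' \<open>a < t0\<close> in \<open>simp_all add: x0p f_def\<close>)
  then show False using pos0 by (simp add: har p t0pos x0p)
qed

end
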